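(* Let $\mathcal{W}\subset\mathbb{C}$ be a Jordan measurable set which is star-shaped with respect to the origin and satisfies $-\mathcal{W}\subset\sqrt{2}\,\mathcal{W}$. Let $C=\mathbb{P}\cup\{\lambda\}$. Then the density of the set of visible points of $\mathcal{A}_{\mathcal{W}}$ is $$\theta(\widehat{\mathcal{A}_\mathcal{W}})=\sum_{\substack{F\subset C\\ \#F<\infty}}(-1)^{\#F}\,\theta\Big(\mathcal{A}_\mathcal{W}\cap\bigcap_{c\in F} c\mathcal{A}_\mathcal{W}\Big)=\frac{2|\sigma(\lambda)|\,\theta(\mathcal{A}_\mathcal{W})}{\zeta_K(2)}.$$
   Context: Identify $\mathbb{C}$ with $\mathbb{R}^2$. For a locally finite set $\mathcal{P}\subset\mathbb{R}^d$, the set of visible points is $\widehat{\mathcal{P}}=\{x\in\mathcal{P}\mid tx\notin\mathcal{P}\ \forall t\in(0,1)\}$. $\mathcal{P}$ has density $\theta(\mathcal{P})$ if $\lim_{T\to\infty}\#(\mathcal{P}\cap TD)/\mathrm{vol}(TD)=\theta(\mathcal{P})$ for every Jordan measurable $D\subset\mathbb{R}^d$ with $\mathrm{vol}(D)>0$. (Jordan measurable: bounded with boundary of Lebesgue measure zero. Star-shaped with respect to the origin: nonempty, and $tx\in\mathcal{W}$ for all $x\in\mathcal{W}$, $t\in[0,1]$.) Let $\zeta=e^{2\pi i/8}$, $K=\mathbb{Q}(\zeta)\cap\mathbb{R}=\mathbb{Q}(\sqrt2)$, $\mathcal{O}_K=\mathbb{Z}[\sqrt2]$ (a Euclidean domain),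 with fundamental unit $\lambda=1+\sqrt2$. Let $\sigma$ be the automorphism of $\mathbb{Q}(\zeta)$ with $\sigma(\zeta)=\zeta^3$; it restricts to the nontrivial automorphism of $K$. Let $\mathbb{P}=\{\pi\in\mathcal{O}_K\mid \pi \text{ prime},\ 1<\pi<\lambda\}$. For bounded $\mathcal{W}\subset\mathbb{C}$ let $\mathcal{A}_\mathcal{W}=\{x\in\mathbb{Z}[\zeta]\mid\sigma(x)\in\mathcal{W}\}$. $\zeta_K$ denotes the Dedekind zeta function of $K$. The sum ranges over all finite subsets $F$ of $C$, including $F=\emptyset$ (which gives the term $\theta(\mathcal{A}_\mathcal{W})$). *)

theory Defs
  imports
    "HOL-Analysis.Analysis"
    "HOL-Algebra.QuotRing"
    "HOL-Algebra.Ring_Divisibility"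
    "HOL-Algebra.Generated_Fields"
begin

section \<open>Point sets, visibility and density\<close>

definition locally_finite :: "'a::euclidean_space set \<Rightarrow> bool" where
  "locally_finite P \<longleftrightarrow> (\<forall>B. bounded B \<longrightarrow> finite (P \<inter> B))"

definition visible :: "'a::euclidean_space set \<Rightarrow> 'a set" where
  "visible P = {x \<in> P. \<forall>t\<in>{0<..<1::real}. t *\<^sub>R x \<notin> P}"

definition jordan_measurable :: "'a::euclidean_space set \<Rightarrow> bool" where
  "jordan_measurable D \<longleftrightarrow> bounded D \<and> frontier D \<in> null_sets lebesgue"

definition star_shaped :: "'a::euclidean_space set \<Rightarrow> bool" where
  "star_shaped W \<longleftrightarrow> W \<noteq> {} \<and> (\<forall>x\<in>W. \<forall>t\<in>{0..1::real}. t *\<^sub>R x \<in> W)"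

definition has_point_density :: "'a::euclidean_space set \<Rightarrow> real \<Rightarrow> bool" where
  "has_point_density P d \<longleftrightarrow> locally_finite P \<and>
     (\<forall>D. jordan_measurable D \<and> measure lebesgue D > 0 \<longrightarrow>
        ((\<lambda>T::real. real (card (P \<inter> (*\<^sub>R) T ` D)) / measure lebesgue ((*\<^sub>R) T ` D)) \<longlongrightarrow> d) at_top)"

text \<open>Only meaningful when a density exists; it is then unique.\<close>

definition point_density :: "'a::euclidean_space set \<Rightarrow> real" where
  "point_density P = (THE d. has_point_density P d)"

section \<open>Number fields and rings\<close>

text \<open>A subset of a commutative ring type as a ring structure of \<^theory>\<open>HOL-Algebra.Ring\<close>,
  with the operations of the type.\<close>

definition ring_on :: "'a::comm_ring_1 set \<Rightarrow> 'a ring" where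
  "ring_on S = \<lparr>carrier = S, monoid.mult = (*), one = 1, zero = 0, add = (+)\<rparr>"

definition ideal_norm :: "('a, 'b) ring_scheme \<Rightarrow> 'a set \<Rightarrow> nat" where
  "ideal_norm R I = card (carrier (R Quot I))"

text \<open>The Dedekind zeta function of a number field with ring of integers \<open>R\<close>, at real arguments
  in the half-plane of absolute convergence, that is \<open>s > 1\<close>.\<close>

definition dedekind_zeta :: "('a, 'b) ring_scheme \<Rightarrow> real \<Rightarrow> real" where
  "dedekind_zeta R s =
     (\<Sum>\<^sub>\<infinity> I \<in> {I. ideal I R \<and> I \<noteq> {\<zero>\<^bsub>R\<^esub>}}. real (ideal_norm R I) powr (- s))"

definition zeta8 :: complex where
  "zeta8 = exp (2 * of_real pi * \<i> / 8)"

definition Q_zeta8 :: "complex set" where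
  "Q_zeta8 = generate_field (ring_on UNIV) {zeta8}"

definition Z_zeta8 :: "complex set" where
  "Z_zeta8 = generate_ring (ring_on UNIV) {zeta8}"

text \<open>The ring of integers \<open>\<int>[\<surd>2]\<close> of the real field \<open>\<rat>(\<zeta>) \<inter> \<real> = \<rat>(\<surd>2)\<close>; its elements are
  taken to be of type \<^typ>\<open>real\<close>.\<close>

definition O_K :: "real set" where
  "O_K = generate_ring (ring_on UNIV) {sqrt 2}"

text \<open>The field automorphism of \<open>\<rat>(\<zeta>)\<close> with \<open>\<zeta> \<mapsto> \<zeta>\<^sup>3\<close>. It is uniquely determined on
  \<^const>\<open>Q_zeta8\<close>, the only place where it is used; outside, its values are unspecified.\<close>

definition galois_sigma :: "complex \<Rightarrow> complex" where
  "galois_sigma = (SOME h. h \<in> ring_iso (ring_on Q_zeta8) (ring_on Q_zeta8) \<and> h zeta8 = zeta8 ^ 3)"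

definition fund_unit :: real where
  "fund_unit = 1 + sqrt 2"

text \<open>One positive representative of each prime of \<^const>\<open>O_K\<close> up to multiplication by units.\<close>

definition prime_reps :: "real set" where
  "prime_reps = {p \<in> O_K. ring_prime\<^bsub>ring_on O_K\<^esub> p \<and> 1 < p \<and> p < fund_unit}"

definition model_set :: "complex set \<Rightarrow> complex set" where
  "model_set W = {x \<in> Z_zeta8. galois_sigma x \<in> W}"

end

theory Submission
  imports Defs
begin

text \<open>Since \<open>\<int>[\<surd>2]\<close> is Euclidean, a point \<open>x\<close> of the model set is invisible iff \<open>x / p\<close> is again in
  the model set for some prime \<open>p\<close>, or \<open>x / \<lambda>\<close> is. The condition on \<open>W\<close> makes
  \<open>\<sigma>(x / p) \<in> W\<close> automatic, so that only divisibility by \<open>p\<close> matters, and turns \<open>x / \<lambda>\<close> into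
  the window condition \<open>\<sigma>(x) \<in> \<sigma>(\<lambda>) W\<close>: the visible points are the \<open>x\<close> that no prime
  divides and whose conjugate lies in \<open>W - \<sigma>(\<lambda>) W\<close>.

  Points \<open>x\<close> with \<open>x\<close> in a large set and \<open>\<sigma>(x)\<close> in a fixed window are counted by multiplying with
  a unit that makes both sets large and then comparing with the volume of fundamental cells of the
  lattice of pairs \<open>(x, \<sigma>(x))\<close>. Each prime \<open>p\<close> contributes a factor \<open>1 - N(p)\<^sup>-\<^sup>2\<close> to the
  density, and passing to infinitely many primes is justified by a uniform bound
  \<open>O((R S)\<^sup>2)\<close> for the number of nonzero \<open>y\<close> with \<open>\<bar>y\<bar> \<le> R\<close> and \<open>\<bar>\<sigma>(y)\<bar> \<le> S\<close>.\<close>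

section \<open>Arithmetic of \<open>\<int>[\<surd>2]\<close>\<close>


text \<open>The factor \<surd>2 in the window hypothesis comes from the prime \<surd>2: its
  conjugate is -\<surd>2, and no element of Z[\<surd>2] in (1, \<lambda>) has a conjugate in
  (-\<surd>2, 1]. Hence 1/\<sigma>(p) always lies in [-1/\<surd>2, 1], the range of factors that map
  W into itself. The unit \<lambda> behaves in the opposite way: W is contained in \<sigma>(p) W,
  but \<sigma>(\<lambda>) W is contained in W. Intersecting with p A thus only adds a divisibility,
  intersecting with \<lambda> A only shrinks the window. So the term of a finite F is \<theta>(A)
  times a product over F, and the signed series is an expanded infinite product, in which \<lambda>
  supplies the factor 1 - \<sigma>(\<lambda>)^2 = 2 |\<sigma>(\<lambda>)|.

  The obstacle is the tail of the sieve. A volume estimate with an additive boundary error cannot be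
  summed over infinitely many primes. The uniform bound has no such term, because nonzero points do
  not exist at all when R S < 1; only the origin has to be counted separately.\<close>

lemma sqrt2_irrational: "sqrt 2 \<notin> \<rat>"
proof
  assume "sqrt 2 \<in> \<rat>"
  then obtain m n :: int where n: "n \<noteq> 0" and r: "sqrt 2 = of_int m / of_int n" and c: "coprime m n"
    by (metis Rats_cases' less_int_code(1))
  then have "of_int m = of_int n * sqrt 2" by (simp add: field_simps)
  then have "(of_int m)^2 = (of_int n)^2 * (2::real)" by (simp add: power_mult_distrib)
  then have eq: "m^2 = 2 * n^2" by (metis mult.commute of_int_eq_iff of_int_mult of_int_numeral of_int_power)
  then have "even (m^2)" by simp
  then have "even m" by simp
  then obtain k where "m = 2 * k" by blast
  with eq have "n^2 = 2 * k^2" by (simp add: power2_eq_square)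
  then have "even (n^2)" by simp
  then have "even n" by simp
  with \<open>even m\<close> c show False by (metis not_coprimeI odd_one)
qed

lemma ring_on_sel [simp]:
  "carrier (ring_on S) = S" "x \<otimes>\<^bsub>ring_on S\<^esub> y = x * y" "x \<oplus>\<^bsub>ring_on S\<^esub> y = x + y"
  "\<one>\<^bsub>ring_on S\<^esub> = 1" "\<zero>\<^bsub>ring_on S\<^esub> = 0"
  by (auto simp: ring_on_def)

lemma cring_ring_on:
  assumes "1 \<in> S" "\<And>x y. x \<in> S \<Longrightarrow> y \<in> S \<Longrightarrow> x + y \<in> S"
    "\<And>x y. x \<in> S \<Longrightarrow> y \<in> S \<Longrightarrow> x * y \<in> S" "\<And>x. x \<in> S \<Longrightarrow> - x \<in> S"
  shows "cring (ring_on (S :: 'a::comm_ring_1 set))"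
proof -
  have "0 \<in> S" using assms(1,2,4) by (metis add.right_inverse)
  then show ?thesis
    using assms
    by (intro cringI abelian_groupI comm_monoidI)
       (auto simp: algebra_simps intro: bexI[of _ "- x" for x])
qed

lemma cring_ring_on_UNIV: "cring (ring_on (UNIV :: 'a::comm_ring_1 set))"
  by (rule cring_ring_on) auto

lemma a_inv_ring_on_UNIV [simp]: "\<ominus>\<^bsub>ring_on (UNIV :: 'a::comm_ring_1 set)\<^esub> x = - x"
proof -
  interpret cring "ring_on (UNIV :: 'a set)" by (rule cring_ring_on_UNIV)
  show ?thesis by (rule minus_equality) auto
qed

lemma m_inv_ring_on_UNIV [simp]:
  assumes "x \<noteq> 0" shows "inv\<^bsub>ring_on (UNIV :: 'a::field set)\<^esub> x = inverse x"
proof -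
  interpret cring "ring_on (UNIV :: 'a set)" by (rule cring_ring_on_UNIV)
  show ?thesis using assms by (intro comm_inv_char) auto
qed

lemma O_K_eq: "O_K = {of_int m + of_int n * sqrt 2 | m n. True}"
proof (intro equalityI subsetI)
  fix x assume "x \<in> O_K"
  then show "x \<in> {of_int m + of_int n * sqrt 2 | m n. True}"
    unfolding O_K_def
  proof (induction rule: generate_ring.induct)
    case one
    have "(1::real) = of_int 1 + of_int 0 * sqrt 2" by simp
    then show ?case by (simp only: ring_on_sel mem_Collect_eq) blast
  next
    case (incl h)
    then have "h = of_int 0 + of_int 1 * sqrt 2" by simp
    then show ?case by blast
  next
    case (a_inv h)
    then obtain m n where "h = of_int m + of_int n * sqrt 2" by auto
    then have "- h = of_int (-m) + of_int (-n) * sqrt 2" by simp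
    then show ?case unfolding a_inv_ring_on_UNIV by blast
  next
    case (eng_add h1 h2)
    then obtain m n p q where "h1 = of_int m + of_int n * sqrt 2" "h2 = of_int p + of_int q * sqrt 2" by auto
    then have "h1 + h2 = of_int (m+p) + of_int (n+q) * sqrt 2" by (simp add: algebra_simps)
    then show ?case unfolding ring_on_sel by blast
  next
    case (eng_mult h1 h2)
    then obtain m n p q where "h1 = of_int m + of_int n * sqrt 2" "h2 = of_int p + of_int q * sqrt 2" by auto
    then have "h1 * h2 = of_int (m*p+2*n*q) + of_int (m*q+n*p) * sqrt 2" by (simp add: algebra_simps)
    then show ?case unfolding ring_on_sel by blast
  qed
next
  note gr = generate_ring.intros[where R = "ring_on UNIV" and H = "{sqrt 2}", simplified]
  have nat: "of_nat n \<in> O_K" for n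
    unfolding O_K_def
  proof (induction n)
    case 0
    have "1 + - 1 \<in> generate_ring (ring_on UNIV) {sqrt 2}" by (intro gr)
    then show ?case by simp
  next
    case (Suc n)
    then show ?case using gr by (auto simp: add.commute)
  qed
  have int: "of_int n \<in> O_K" for n
    by (cases n rule: int_cases2) (use nat gr in \<open>auto simp: O_K_def\<close>)
  fix x assume "x \<in> {of_int m + of_int n * sqrt 2 | m n. True}"
  then show "x \<in> O_K" using gr int by (auto simp: O_K_def)
qed

lemma O_K_E:
  assumes "x \<in> O_K"
  obtains m n where "x = of_int m + of_int n * sqrt 2"
  using assms by (auto simp: O_K_eq)

lemma O_K_I [simp, intro]: "of_int m + of_int n * sqrt 2 \<in> O_K"
  by (auto simp: O_K_eq)

lemma O_K_of_int [simp, intro]: "of_int m \<in> O_K"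
  using O_K_I[of m 0] by simp

lemma O_K_0 [simp, intro]: "0 \<in> O_K" and O_K_1 [simp, intro]: "1 \<in> O_K"
  using O_K_of_int[of 0] O_K_of_int[of 1] by simp_all

lemma O_K_sqrt2 [simp, intro]: "sqrt 2 \<in> O_K"
  using O_K_I[of 0 1] by simp

lemma O_K_add [intro]: "x \<in> O_K \<Longrightarrow> y \<in> O_K \<Longrightarrow> x + y \<in> O_K"
  and O_K_mult [intro]: "x \<in> O_K \<Longrightarrow> y \<in> O_K \<Longrightarrow> x * y \<in> O_K"
  and O_K_minus [intro]: "x \<in> O_K \<Longrightarrow> - x \<in> O_K"
  using generate_ring.intros[where R = "ring_on UNIV" and H = "{sqrt 2}", simplified] by (auto simp: O_K_def)

lemma O_K_diff [intro]: "x \<in> O_K \<Longrightarrow> y \<in> O_K \<Longrightarrow> x - y \<in> O_K"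
  by (metis O_K_add O_K_minus add_uminus_conv_diff)

lemma O_K_power [intro]: "x \<in> O_K \<Longrightarrow> x ^ n \<in> O_K"
  by (induction n) auto

lemma O_K_prod [intro]: "(\<And>i. i \<in> A \<Longrightarrow> f i \<in> O_K) \<Longrightarrow> prod f A \<in> O_K"
  by (induction A rule: infinite_finite_induct) auto

lemma rat_sqrt2_unique:
  fixes a b c d :: real
  assumes "a \<in> \<rat>" "b \<in> \<rat>" "c \<in> \<rat>" "d \<in> \<rat>" "a + b * sqrt 2 = c + d * sqrt 2"
  shows "a = c \<and> b = d"
proof -
  have "b = d"
  proof (rule ccontr)
    assume "b \<noteq> d"
    then have "sqrt 2 = (c - a) / (b - d)" using assms(5) by (simp add: field_simps)
    also have "\<dots> \<in> \<rat>" using assms by (intro Rats_divide Rats_diff) auto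
    finally show False using sqrt2_irrational by simp
  qed
  then show ?thesis using assms(5) by simp
qed

section \<open>Conjugation and norm on the field generated by \<surd>2\<close>

definition Q_sqrt2 :: "real set" where
  "Q_sqrt2 = {a + b * sqrt 2 | a b. a \<in> \<rat> \<and> b \<in> \<rat>}"

text \<open>The nontrivial automorphism of \<open>Q_sqrt2\<close>, given by its formula because
  \<open>galois_sigma\<close> is only characterised by a choice; the two are linked once
  \<open>galois_sigma\<close> is known explicitly. Outside \<open>Q_sqrt2\<close> the value is
  unspecified.\<close>

definition conj_K :: "real \<Rightarrow> real" where
  "conj_K x = (THE y. \<exists>a\<in>\<rat>. \<exists>b\<in>\<rat>. x = a + b * sqrt 2 \<and> y = a - b * sqrt 2)"

lemma conj_K_rat: "a \<in> \<rat> \<Longrightarrow> b \<in> \<rat> \<Longrightarrow> conj_K (a + b * sqrt 2) = a - b * sqrt 2"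
  unfolding conj_K_def by (rule the_equality) (use rat_sqrt2_unique in blast)+

lemma conj_K_eq [simp]: "conj_K (of_int m + of_int n * sqrt 2) = of_int m - of_int n * sqrt 2"
  by (rule conj_K_rat) auto

lemma Q_sqrt2_E:
  assumes "x \<in> Q_sqrt2"
  obtains a b where "a \<in> \<rat>" "b \<in> \<rat>" "x = a + b * sqrt 2" "conj_K x = a - b * sqrt 2"
  using assms conj_K_rat by (auto simp: Q_sqrt2_def)

lemma Q_sqrt2_I: "a \<in> \<rat> \<Longrightarrow> b \<in> \<rat> \<Longrightarrow> a + b * sqrt 2 \<in> Q_sqrt2"
  by (auto simp: Q_sqrt2_def)

lemma O_K_subset_Q_sqrt2: "O_K \<subseteq> Q_sqrt2"
  unfolding O_K_eq Q_sqrt2_def using Rats_of_int by blast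

lemma Q_sqrt2_add: "x \<in> Q_sqrt2 \<Longrightarrow> y \<in> Q_sqrt2 \<Longrightarrow> x + y \<in> Q_sqrt2 \<and> conj_K (x + y) = conj_K x + conj_K y"
proof (elim Q_sqrt2_E)
  fix a b c d assume *: "a \<in> \<rat>" "b \<in> \<rat>" "x = a + b * sqrt 2" "conj_K x = a - b * sqrt 2"
   "c \<in> \<rat>" "d \<in> \<rat>" "y = c + d * sqrt 2" "conj_K y = c - d * sqrt 2"
  have e: "x + y = (a+c) + (b+d) * sqrt 2" by (simp add: * algebra_simps)
  have "conj_K (x + y) = (a+c) - (b+d) * sqrt 2" unfolding e using * by (intro conj_K_rat) auto
  moreover have "x + y \<in> Q_sqrt2" unfolding e using * by (intro Q_sqrt2_I) auto
  ultimately show ?thesis unfolding *(4,8) by (simp add: algebra_simps)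
qed

lemma Q_sqrt2_mult: "x \<in> Q_sqrt2 \<Longrightarrow> y \<in> Q_sqrt2 \<Longrightarrow> x * y \<in> Q_sqrt2 \<and> conj_K (x * y) = conj_K x * conj_K y"
proof (elim Q_sqrt2_E)
  fix a b c d assume *: "a \<in> \<rat>" "b \<in> \<rat>" "x = a + b * sqrt 2" "conj_K x = a - b * sqrt 2"
   "c \<in> \<rat>" "d \<in> \<rat>" "y = c + d * sqrt 2" "conj_K y = c - d * sqrt 2"
  have e: "x * y = (a*c + 2*b*d) + (a*d+b*c) * sqrt 2" by (simp add: * algebra_simps)
  have "conj_K (x * y) = (a*c + 2*b*d) - (a*d+b*c) * sqrt 2" unfolding e using * by (intro conj_K_rat) auto
  moreover have "x * y \<in> Q_sqrt2" unfolding e using * by (intro Q_sqrt2_I) auto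
  ultimately show ?thesis unfolding *(4,8) by (simp add: algebra_simps)
qed

lemma Q_sqrt2_minus: "x \<in> Q_sqrt2 \<Longrightarrow> - x \<in> Q_sqrt2 \<and> conj_K (- x) = - conj_K x"
proof (elim Q_sqrt2_E)
  fix a b assume *: "a \<in> \<rat>" "b \<in> \<rat>" "x = a + b * sqrt 2" "conj_K x = a - b * sqrt 2"
  have e: "- x = -a + (-b) * sqrt 2" by (simp add: * algebra_simps)
  have "conj_K (-x) = -a - (-b) * sqrt 2" unfolding e using * by (intro conj_K_rat) auto
  moreover have "- x \<in> Q_sqrt2" unfolding e using * by (intro Q_sqrt2_I) auto
  ultimately show ?thesis unfolding *(4) by simp
qed

lemma Q_sqrt2_conj: "x \<in> Q_sqrt2 \<Longrightarrow> conj_K x \<in> Q_sqrt2 \<and> conj_K (conj_K x) = x"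
proof (elim Q_sqrt2_E)
  fix a b assume *: "a \<in> \<rat>" "b \<in> \<rat>" "x = a + b * sqrt 2" "conj_K x = a - b * sqrt 2"
  have e: "conj_K x = a + (-b) * sqrt 2" unfolding *(4) by simp
  have "conj_K (conj_K x) = a - (-b) * sqrt 2" unfolding e using * by (intro conj_K_rat) auto
  moreover have "conj_K x \<in> Q_sqrt2" unfolding e using * by (intro Q_sqrt2_I) auto
  ultimately show ?thesis unfolding *(3) by simp
qed

lemma Q_sqrt2_conj_eq_0: 
  assumes "x \<in> Q_sqrt2" shows "conj_K x = 0 \<longleftrightarrow> x = 0"
  using conj_K_rat[of 0 0] Q_sqrt2_conj[OF assms] by auto

lemma Q_sqrt2_norm_Rats: 
  assumes "x \<in> Q_sqrt2" shows "x * conj_K x \<in> \<rat>"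
  using assms
proof (elim Q_sqrt2_E)
  fix a b assume *: "a \<in> \<rat>" "b \<in> \<rat>" "x = a + b * sqrt 2" "conj_K x = a - b * sqrt 2"
  have "x * conj_K x = a*a - 2*b*b" unfolding *(4) unfolding *(3) by (simp add: algebra_simps)
  also have "\<dots> \<in> \<rat>" using * by auto
  finally show ?thesis .
qed

lemma Q_sqrt2_Rats: "x \<in> \<rat> \<Longrightarrow> x \<in> Q_sqrt2"
  using Q_sqrt2_I[of x 0] by simp

lemma Q_sqrt2_inverse: 
  assumes "x \<in> Q_sqrt2" shows "inverse x \<in> Q_sqrt2"
proof (cases "x = 0")
  case True
  then show ?thesis using assms by simp
next
  case False
  then have "inverse x = conj_K x * inverse (x * conj_K x)"
    using Q_sqrt2_conj_eq_0[OF assms] by simp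
  moreover have "inverse (x * conj_K x) \<in> Q_sqrt2"
    using Q_sqrt2_norm_Rats[OF assms] by (intro Q_sqrt2_Rats Rats_inverse)
  ultimately show ?thesis using Q_sqrt2_mult Q_sqrt2_conj[OF assms] by metis
qed

lemma conj_K_add: "x \<in> O_K \<Longrightarrow> y \<in> O_K \<Longrightarrow> conj_K (x + y) = conj_K x + conj_K y"
  and conj_K_mult: "x \<in> O_K \<Longrightarrow> y \<in> O_K \<Longrightarrow> conj_K (x * y) = conj_K x * conj_K y"
  and conj_K_minus: "x \<in> O_K \<Longrightarrow> conj_K (- x) = - conj_K x"
  and conj_K_eq_0: "x \<in> O_K \<Longrightarrow> conj_K x = 0 \<longleftrightarrow> x = 0"
  using Q_sqrt2_add Q_sqrt2_mult Q_sqrt2_minus Q_sqrt2_conj_eq_0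
    O_K_subset_Q_sqrt2[THEN subsetD] by simp_all

lemma conj_K_in_O_K [intro]: "x \<in> O_K \<Longrightarrow> conj_K x \<in> O_K"
proof (elim O_K_E)
  fix m n assume "x = of_int m + of_int n * sqrt 2"
  then show ?thesis using O_K_I[of m "-n"] by simp
qed

lemma conj_K_of_int [simp]: "conj_K (of_int m) = of_int m"
  using conj_K_eq[of m 0] by simp

lemma conj_K_1 [simp]: "conj_K 1 = 1"
  using conj_K_of_int[of 1] by simp

lemma conj_K_power: "x \<in> O_K \<Longrightarrow> conj_K (x ^ n) = conj_K x ^ n"
  by (induction n) (auto simp: conj_K_mult O_K_power)

text \<open>The absolute value of the field norm. On \<open>O_K\<close> the floor changes nothing;
  it only makes the value an integer, so that elements of least norm can be chosen.\<close>

definition norm_K :: "real \<Rightarrow> int" where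
  "norm_K x = \<lfloor>\<bar>x * conj_K x\<bar>\<rfloor>"

lemma of_int_norm_K: "x \<in> O_K \<Longrightarrow> of_int (norm_K x) = \<bar>x * conj_K x\<bar>"
proof (elim O_K_E)
  fix m n assume x: "x = of_int m + of_int n * sqrt 2"
  have "x * conj_K x = of_int (m*m - 2*n*n)" by (simp add: x algebra_simps)
  then have "\<bar>x * conj_K x\<bar> = of_int \<bar>m*m - 2*n*n\<bar>" by (metis of_int_abs)
  then show ?thesis unfolding norm_K_def by (metis floor_of_int)
qed

lemma norm_K_mult: "x \<in> O_K \<Longrightarrow> y \<in> O_K \<Longrightarrow> norm_K (x * y) = norm_K x * norm_K y"
proof -
  assume "x \<in> O_K" "y \<in> O_K"
  then have "of_int (norm_K (x * y)) = (of_int (norm_K x * norm_K y) :: real)"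
    by (simp add: of_int_norm_K O_K_mult conj_K_mult abs_mult mult_ac)
  then show ?thesis by linarith
qed

lemma norm_K_ge_1: "x \<in> O_K \<Longrightarrow> x \<noteq> 0 \<Longrightarrow> norm_K x \<ge> 1"
proof -
  assume "x \<in> O_K" "x \<noteq> 0"
  then have "0 < \<bar>x * conj_K x\<bar>" using conj_K_eq_0[of x] by simp
  then have "0 < real_of_int (norm_K x)" using of_int_norm_K \<open>x \<in> O_K\<close> by simp
  then show ?thesis by linarith
qed

lemma norm_K_1 [simp]: "norm_K 1 = 1"
  by (simp add: norm_K_def)

lemma norm_K_nonneg: "norm_K x \<ge> 0"
  by (simp add: norm_K_def)

lemma unit_inverse:
  assumes "u \<in> O_K" "norm_K u = 1" shows "inverse u \<in> O_K"
proof -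
  have *: "\<bar>u * conj_K u\<bar> = 1" using of_int_norm_K[of u] assms by simp
  then have "u * conj_K u = 1 \<or> u * conj_K u = -1" by linarith
  then have "inverse u = conj_K u \<or> inverse u = - conj_K u" 
    using inverse_unique[of u "conj_K u"] inverse_unique[of u "- conj_K u"] by auto
  then show ?thesis using assms conj_K_in_O_K O_K_minus by metis
qed

section \<open>The fundamental unit and the position of conjugates\<close>

lemma fund_unit_O_K [simp, intro]: "fund_unit \<in> O_K"
  using O_K_I[of 1 1] by (simp add: fund_unit_def)

lemma conj_fund_unit: "conj_K fund_unit = 1 - sqrt 2"
  using conj_K_eq[of 1 1] by (simp add: fund_unit_def)

lemma inverse_fund_unit: "inverse fund_unit = sqrt 2 - 1"
proof -
  have "fund_unit * (sqrt 2 - 1) = 1" by (simp add: fund_unit_def algebra_simps)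
  then show ?thesis by (rule inverse_unique)
qed

lemma sqrt2_bounds: "707/500 < sqrt 2" "sqrt 2 < 283/200"
proof -
  show "707/500 < sqrt 2" by (rule real_less_rsqrt) (simp add: power2_eq_square)
  show "sqrt 2 < 283/200" by (rule real_less_lsqrt) (simp_all add: power2_eq_square)
qed

lemma fund_unit_bounds: "2.414 < fund_unit" "fund_unit < 2.415"
  using sqrt2_bounds by (auto simp: fund_unit_def)

text \<open>The two case distinctions that make the windows fit together: for \<open>m + n \<surd>2\<close> in the given
  interval, \<open>m\<close> is determined by small \<open>n\<close>, while for large \<open>n\<close> the conjugate is far away.\<close>

lemma conj_K_between_1_fund_unit:
  assumes "x \<in> O_K" "1 < x" "x < fund_unit"
  shows "conj_K x \<le> - sqrt 2 \<or> 1 < conj_K x"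
proof -
  obtain m n where x: "x = of_int m + of_int n * sqrt 2" using assms(1) by (rule O_K_E)
  have c: "conj_K x = x - 2 * of_int n * sqrt 2" by (simp add: x)
  consider "n \<le> 0" | "n = 1" | "n \<ge> 2" by linarith
  then show ?thesis
  proof cases
    case 1
    then have "of_int n * sqrt 2 \<le> 0" by (simp add: mult_nonpos_nonneg)
    then show ?thesis using assms c by simp
  next
    case 2
    then have "-1 < (of_int m :: real)" "of_int m < (1::real)" using x assms sqrt2_bounds by (auto simp: fund_unit_def)
    then have "m = 0" by linarith
    then show ?thesis using c 2 x by simp
  next
    case 3
    define t where "t = of_int n * sqrt 2"
    have "2 * sqrt 2 \<le> t" unfolding t_def using 3 by simp
    moreover have "conj_K x = x - 2 * t" using c by (simp add: t_def)
    ultimately show ?thesis using assms(3) sqrt2_bounds by (simp add: fund_unit_def)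
  qed
qed

lemma conj_K_between_0_1:
  assumes "x \<in> O_K" "0 < x" "x < 1"
  shows "conj_K x \<le> - fund_unit \<or> sqrt 2 * fund_unit \<le> conj_K x"
proof -
  obtain m n where x: "x = of_int m + of_int n * sqrt 2" using assms(1) by (rule O_K_E)
  have c: "conj_K x = x - 2 * of_int n * sqrt 2" by (simp add: x)
  consider "n = 0" | "n \<le> -2" | "n = -1" | "n = 1" | "n \<ge> 2" by linarith
  then show ?thesis
  proof cases
    case 1
    then have "0 < (of_int m :: real)" "of_int m < (1::real)" using x assms by auto
    then have "0 < m" "m < 1" by linarith+
    then show ?thesis by simp
  next
    case 2
    then have "of_int n * sqrt 2 \<le> (-2) * sqrt 2" by (intro mult_right_mono) auto
    then show ?thesis using assms c sqrt2_bounds by (simp add: fund_unit_def algebra_simps)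
  next
    case 3
    then have "1 < (of_int m :: real)" "of_int m < (3::real)" using x assms sqrt2_bounds by auto
    \<comment> \<open>Both bounds are sharp: 2 - \<surd>2 attains the second one here, and \<surd>2
      - 1 = 1/\<lambda> attains the first one in the next case.\<close>
    then have "m = 2" by linarith
    then have "conj_K x = 2 + sqrt 2" using c 3 x by simp
    then show ?thesis by (simp add: fund_unit_def algebra_simps)
  next
    case 4
    then have "-2 < (of_int m :: real)" "of_int m < (0::real)" using x assms sqrt2_bounds by auto
    then have "m = -1" by linarith
    then have "conj_K x = - 1 - sqrt 2" using c 4 x by simp
    then show ?thesis by (simp add: fund_unit_def)
  next
    case 5
    define t where "t = of_int n * sqrt 2"
    have "2 * sqrt 2 \<le> t" unfolding t_def using 5 by simp
    moreover have "conj_K x = x - 2 * t" using c by (simp add: t_def)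
    ultimately show ?thesis using assms(3) sqrt2_bounds by (simp add: fund_unit_def)
  qed
qed

text \<open>The conjugate has absolute value above 1 as well. Consequently no unit lies strictly
  between 1 and \<open>fund_unit\<close>, which is what makes this unit fundamental.\<close>

lemma norm_K_gt_1:
  assumes "x \<in> O_K" "1 < x" "x < fund_unit"
  shows "1 < norm_K x"
proof -
  have "1 < \<bar>conj_K x\<bar>" using conj_K_between_1_fund_unit[OF assms] sqrt2_bounds by auto
  then have "1 < \<bar>x * conj_K x\<bar>" using assms by (simp add: abs_mult less_1_mult)
  then show ?thesis using of_int_norm_K[OF assms(1)] by linarith
qed

section \<open>Division with remainder and principal ideals\<close>

lemma O_K_euclid:
  assumes "a \<in> O_K" "b \<in> O_K" "b \<noteq> 0"
  obtains q where "q \<in> O_K" "norm_K (a - q * b) < norm_K b"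
proof -
  have "a / b \<in> Q_sqrt2"
    unfolding divide_inverse using assms O_K_subset_Q_sqrt2 Q_sqrt2_inverse Q_sqrt2_mult by blast
  then obtain x y where xy: "x \<in> \<rat>" "y \<in> \<rat>" "a / b = x + y * sqrt 2" by (rule Q_sqrt2_E)
  \<comment> \<open>Rounding both coordinates of a/b leaves an error u + v \<surd>2 with coordinates
    at most 1/2 in size, and u^2 - 2 v^2 then lies between -1/2 and 1/4.\<close>
  define q where "q = of_int (round x) + of_int (round y) * sqrt 2"
  define u v where "u = x - of_int (round x)" and "v = y - of_int (round y)"
  have uv: "u \<in> \<rat>" "v \<in> \<rat>" "\<bar>u\<bar> \<le> 1/2" "\<bar>v\<bar> \<le> 1/2"
    using xy of_int_round_abs_le[of x] of_int_round_abs_le[of y] by (auto simp: u_def v_def abs_minus_commute)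
  have q: "q \<in> O_K" by (simp add: q_def)
  have e: "a - q * b = b * (u + v * sqrt 2)"
    using xy(3) assms(3) by (simp add: field_simps q_def u_def v_def)
  have "conj_K (b * (u + v * sqrt 2)) = conj_K b * (u - v * sqrt 2)"
    using Q_sqrt2_mult[of b "u + v * sqrt 2"] assms(2) O_K_subset_Q_sqrt2 Q_sqrt2_I[OF uv(1,2)] conj_K_rat[OF uv(1,2)]
    by auto
  then have "(a - q * b) * conj_K (a - q * b) = (b * conj_K b) * (u\<^sup>2 - 2 * v\<^sup>2)"
    unfolding e by (simp only:) (simp add: algebra_simps power2_eq_square)
  then have "\<bar>(a - q * b) * conj_K (a - q * b)\<bar> = \<bar>b * conj_K b\<bar> * \<bar>u\<^sup>2 - 2 * v\<^sup>2\<bar>"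
    by (simp add: abs_mult)
  also have "\<dots> < \<bar>b * conj_K b\<bar> * 1"
  proof (rule mult_strict_left_mono)
    have "u\<^sup>2 \<le> (1/2)\<^sup>2" "v\<^sup>2 \<le> (1/2)\<^sup>2" using uv by (auto simp: abs_le_square_iff[symmetric])
    then show "\<bar>u\<^sup>2 - 2 * v\<^sup>2\<bar> < 1" using zero_le_power2[of u] zero_le_power2[of v]
      unfolding power2_eq_square by (simp add: abs_if del: zero_le_square)
    show "0 < \<bar>b * conj_K b\<bar>" using assms conj_K_eq_0[of b] by simp
  qed
  finally have "real_of_int (norm_K (a - q * b)) < of_int (norm_K b)"
    using of_int_norm_K[of "a - q * b"] of_int_norm_K[of b] assms q by (simp add: O_K_diff O_K_mult)
  then show ?thesis using that q by auto
qed

text \<open>A fundamental domain for multiplication by \<plusminus>1 and powers of \<lambda>: every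
  nonzero element has exactly one associate here. These elements later index the nonzero
  ideals.\<close>

definition O_K_reps :: "real set" where
  "O_K_reps = {x \<in> O_K. 1 \<le> x \<and> x < fund_unit}"

lemma norm_K_eq_1I:
  assumes "u \<in> O_K" "v \<in> O_K" "u * v = 1" shows "norm_K u = 1"
proof -
  have "norm_K u * norm_K v = 1" using norm_K_mult[of u v] assms by simp
  then show ?thesis using norm_K_nonneg[of u] by (metis abs_of_nonneg zmult_eq_1_iff abs_1 abs_minus_cancel)
qed

lemma inverse_fund_unit_O_K [simp, intro]: "inverse fund_unit \<in> O_K"
  by (simp add: inverse_fund_unit O_K_diff)

lemma fund_unit_powi_O_K: "fund_unit powi k \<in> O_K"
  by (cases "k \<ge> 0") (auto simp: power_int_def)

lemma fund_unit_scale: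
  assumes "x > 0"
  obtains k :: int where "1 \<le> x * fund_unit powi k" "x * fund_unit powi k < fund_unit"
proof -
  have l: "fund_unit > 1" using fund_unit_bounds by simp
  define m where "m = \<lfloor>log fund_unit x\<rfloor>"
  have m: "of_int m \<le> log fund_unit x" "log fund_unit x < of_int m + 1" unfolding m_def by linarith+
  have "fund_unit powr of_int m \<le> x" using m(1) l assms le_log_iff[of fund_unit x "of_int m"] by simp
  moreover have "x < fund_unit powr (of_int m + 1)" using m(2) l assms log_less_iff[of fund_unit x "of_int m + 1"] by simp
  ultimately have *: "fund_unit powi m \<le> x" "x < fund_unit powi m * fund_unit"
    using l by (auto simp: powr_add powr_real_of_int')
  have "fund_unit powi (-m) = inverse (fund_unit powi m)" by (rule power_int_minus)
  moreover have "fund_unit powi m > 0" using l by (simp add: zero_less_power_int)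
  ultimately show ?thesis using * that[of "-m"] by (simp add: field_simps)
qed

lemma O_K_reps_scale:
  assumes "x \<in> O_K" "x \<noteq> 0"
  obtains u where "u \<in> O_K" "inverse u \<in> O_K" "u \<noteq> 0" "u * x \<in> O_K_reps"
proof -
  obtain k where k: "1 \<le> \<bar>x\<bar> * fund_unit powi k" "\<bar>x\<bar> * fund_unit powi k < fund_unit"
    using fund_unit_scale[of "\<bar>x\<bar>"] assms by auto
  define u where "u = sgn x * fund_unit powi k"
  have l: "fund_unit > 1" using fund_unit_bounds by simp
  have "u \<in> O_K" "inverse u \<in> O_K" 
    using assms fund_unit_powi_O_K[of k] fund_unit_powi_O_K[of "-k"] 
    by (auto simp: u_def sgn_if power_int_minus O_K_minus)
  moreover have "u \<noteq> 0" using assms l by (auto simp: u_def sgn_if)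
  moreover have "u * x = \<bar>x\<bar> * fund_unit powi k" by (simp add: u_def sgn_if)
  moreover from this have "u * x \<in> O_K_reps" using k O_K_mult[OF \<open>u \<in> O_K\<close> assms(1)] by (simp add: O_K_reps_def)
  ultimately show ?thesis using that by blast
qed

text \<open>If two associates differed, the larger divided by the smaller would be a unit strictly
  between 1 and \<open>fund_unit\<close>.\<close>

lemma O_K_reps_unique:
  assumes "b \<in> O_K_reps" "c \<in> O_K_reps" "b / c \<in> O_K" "c / b \<in> O_K"
  shows "b = c"
proof -
  have *: False if "b \<in> O_K_reps" "c \<in> O_K_reps" "b / c \<in> O_K" "c / b \<in> O_K" "c < b" for b c
  proof -
    have "fund_unit * 1 \<le> fund_unit * c" using that fund_unit_bounds by (intro mult_left_mono) (auto simp: O_K_reps_def)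
    moreover have "b < fund_unit" using that by (simp add: O_K_reps_def)
    ultimately have "b < fund_unit * c" by linarith
    then have "1 < b / c" "b / c < fund_unit" using that by (auto simp: O_K_reps_def field_simps)
    moreover have "norm_K (b / c) = 1" using that by (intro norm_K_eq_1I[of _ "c / b"]) (auto simp: O_K_reps_def)
    ultimately show False using norm_K_gt_1 that by fastforce
  qed
  show ?thesis using *[of b c] *[of c b] assms by argo
qed

definition O_K_ideal :: "real set \<Rightarrow> bool" where
  "O_K_ideal I \<longleftrightarrow> I \<subseteq> O_K \<and> 0 \<in> I \<and> (\<forall>x\<in>I. \<forall>y\<in>I. x + y \<in> I) \<and> (\<forall>r\<in>O_K. \<forall>x\<in>I. r * x \<in> I)"

text \<open>A nonzero element of least norm divides all others by division with remainder, and a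
  unit moves it into \<open>O_K_reps\<close>. Writing the multiples of b as the x with
  \<open>x / b \<in> O_K\<close> makes divisibility a membership in \<open>O_K\<close>
  throughout.\<close>

lemma O_K_principal:
  assumes I: "O_K_ideal I" and "I \<noteq> {0}"
  obtains b where "b \<in> O_K_reps" "I = {x. x / b \<in> O_K}"
proof -
  define P where "P = (\<lambda>b. b \<in> I \<and> b \<noteq> 0)"
  have "\<exists>b. P b" using assms by (auto simp: O_K_ideal_def P_def)
  then obtain b where b: "P b" and min: "\<And>c. P c \<Longrightarrow> nat (norm_K b) \<le> nat (norm_K c)"
    using ex_has_least_nat[of P _ "\<lambda>b. nat (norm_K b)"] by blast
  have bO: "b \<in> O_K" "b \<in> I" "b \<noteq> 0" using b I by (auto simp: P_def O_K_ideal_def)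
  obtain u where u: "u \<in> O_K" "inverse u \<in> O_K" "u \<noteq> 0" "u * b \<in> O_K_reps" using O_K_reps_scale bO by metis
  have "x / b \<in> O_K" if "x \<in> I" for x
  proof -
    have "x \<in> O_K" using that I by (auto simp: O_K_ideal_def)
    then obtain q where q: "q \<in> O_K" "norm_K (x - q * b) < norm_K b" using O_K_euclid bO by metis
    have "x + (- q) * b \<in> I" using that bO q I O_K_minus unfolding O_K_ideal_def by blast
    then have "x - q * b \<in> I" by simp
    then have "x - q * b = 0" using min[of "x - q * b"] q(2) norm_K_nonneg[of "x - q * b"] unfolding P_def by fastforce
    then have "x / b = q" using bO by (simp add: field_simps)
    then show ?thesis using q by simp
  qed
  moreover have "x \<in> I" if "x / b \<in> O_K" for x
  proof -
    have "(x / b) * b \<in> I" using that bO I unfolding O_K_ideal_def by blast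
    then show ?thesis using bO by simp
  qed
  ultimately have I_eq: "I = {x. x / b \<in> O_K}" by blast
  have "x / b \<in> O_K \<longleftrightarrow> x / (u * b) \<in> O_K" for x
  proof
    assume "x / b \<in> O_K"
    then have "inverse u * (x / b) \<in> O_K" using u by blast
    then show "x / (u * b) \<in> O_K" by (simp add: field_simps)
  next
    assume "x / (u * b) \<in> O_K"
    then have "u * (x / (u * b)) \<in> O_K" using u by blast
    then show "x / b \<in> O_K" using u by simp
  qed
  then have "I = {x. x / (u * b) \<in> O_K}" using I_eq by simp
  then show ?thesis using that u by blast
qed

lemma O_K_gcd:
  assumes "a \<in> O_K" "b \<in> O_K" "b \<noteq> 0"
  obtains d u v where "d \<in> O_K_reps" "a / d \<in> O_K" "b / d \<in> O_K" "u \<in> O_K" "v \<in> O_K" "u * a + v * b = d"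
proof -
  define I where "I = {u * a + v * b | u v. u \<in> O_K \<and> v \<in> O_K}"
  have I: "u * a + v * b \<in> I" if "u \<in> O_K" "v \<in> O_K" for u v using that by (auto simp: I_def)
  have "O_K_ideal I"
    unfolding O_K_ideal_def
  proof (intro conjI ballI)
    show "I \<subseteq> O_K" using assms by (auto simp: I_def O_K_add O_K_mult)
    show "0 \<in> I" using I[of 0 0] by simp
    fix x y assume "x \<in> I" "y \<in> I"
    then obtain u v u' v' where *: "u \<in> O_K" "v \<in> O_K" "u' \<in> O_K" "v' \<in> O_K" "x = u * a + v * b" "y = u' * a + v' * b"
      by (auto simp: I_def)
    have "x + y = (u + u') * a + (v + v') * b" by (simp add: * algebra_simps)
    then show "x + y \<in> I" using I * O_K_add by metis
  next
    fix r x assume "r \<in> O_K" "x \<in> I"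
    then obtain u v where *: "u \<in> O_K" "v \<in> O_K" "x = u * a + v * b" by (auto simp: I_def)
    have "r * x = (r * u) * a + (r * v) * b" by (simp add: * algebra_simps)
    then show "r * x \<in> I" using I * O_K_mult \<open>r \<in> O_K\<close> by metis
  qed
  moreover have "a \<in> I" "b \<in> I" using I[of 1 0] I[of 0 1] by auto
  ultimately obtain d where d: "d \<in> O_K_reps" "I = {x. x / d \<in> O_K}"
    using O_K_principal[of I] assms by blast
  have "d \<in> I" using d by (auto simp: O_K_reps_def)
  then show ?thesis using that d \<open>a \<in> I\<close> \<open>b \<in> I\<close> by (auto simp: I_def)
qed

section \<open>Prime elements\<close>

lemma prime_reps_subset: "prime_reps \<subseteq> O_K_reps"
  by (auto simp: prime_reps_def O_K_reps_def)

lemma O_K_divides: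
  assumes "p \<noteq> 0"
  shows "p divides\<^bsub>ring_on O_K\<^esub> x \<longleftrightarrow> x / p \<in> O_K"
proof
  assume "p divides\<^bsub>ring_on O_K\<^esub> x"
  then show "x / p \<in> O_K" using assms by (auto simp: factor_def)
next
  assume "x / p \<in> O_K"
  then show "p divides\<^bsub>ring_on O_K\<^esub> x" using assms by (auto simp: factor_def intro!: bexI[of _ "x / p"])
qed

lemma O_K_ring_prime_iff:
  assumes "p \<in> O_K"
  shows "ring_prime\<^bsub>ring_on O_K\<^esub> p \<longleftrightarrow> p \<noteq> 0 \<and> inverse p \<notin> O_K \<and>
    (\<forall>a\<in>O_K. \<forall>b\<in>O_K. a * b / p \<in> O_K \<longrightarrow> a / p \<in> O_K \<or> b / p \<in> O_K)"
proof (cases "p = 0")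
  case True
  then show ?thesis by (simp add: ring_prime_def)
next
  case False
  have "p \<in> Units (ring_on O_K) \<longleftrightarrow> inverse p \<in> O_K"
    using assms False by (auto simp: Units_def) (metis inverse_unique mult.commute, metis left_inverse right_inverse)
  then show ?thesis using False by (simp add: ring_prime_def prime_def O_K_divides)
qed

lemma prime_reps_prime:
  assumes "p \<in> prime_reps" "a \<in> O_K" "b \<in> O_K" "a * b / p \<in> O_K"
  shows "a / p \<in> O_K \<or> b / p \<in> O_K"
  using assms O_K_ring_prime_iff[of p] by (auto simp: prime_reps_def)

text \<open>The prime is a normalised divisor p \<noteq> 1 of b of least norm. If p divides a c, let
  d be the normalised gcd of a and p. Either d \<noteq> 1, then minimality makes p an associate of d
  and p divides a; or d = 1, and the Bezout identity shows that p divides c.\<close>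

lemma exists_prime_divisor:
  assumes "b \<in> O_K" "b \<noteq> 0" "inverse b \<notin> O_K"
  obtains p where "p \<in> prime_reps" "b / p \<in> O_K"
proof -
  define P where "P = (\<lambda>p. p \<in> O_K_reps \<and> p \<noteq> 1 \<and> b / p \<in> O_K)"
  have unit_dvd: "inverse u \<in> O_K" if "norm_K u = 1" "u \<in> O_K" for u using unit_inverse that by blast
  have "\<exists>p. P p"
  proof -
    obtain u where u: "u \<in> O_K" "inverse u \<in> O_K" "u \<noteq> 0" "u * b \<in> O_K_reps" using O_K_reps_scale assms by metis
    have "u * b \<noteq> 1" using assms(3) u by (metis inverse_unique mult.commute)
    moreover have "b / (u * b) \<in> O_K" using u assms by (simp add: field_simps)
    ultimately show ?thesis using u by (auto simp: P_def)
  qed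
  then obtain p where p: "P p" and min: "\<And>c. P c \<Longrightarrow> nat (norm_K p) \<le> nat (norm_K c)"
    using ex_has_least_nat[of P _ "\<lambda>b. nat (norm_K b)"] by blast
  have pO: "p \<in> O_K" "1 < p" "p < fund_unit" "b / p \<in> O_K" using p by (auto simp: P_def O_K_reps_def)
  have "inverse p \<notin> O_K"
    using norm_K_gt_1[OF pO(1-3)] norm_K_eq_1I[OF pO(1), of "inverse p"] pO by auto
  moreover have "c / p \<in> O_K" if "a \<in> O_K" "c \<in> O_K" "a * c / p \<in> O_K" "a / p \<notin> O_K" for a c
  proof -
    obtain d u v where d: "d \<in> O_K_reps" "a / d \<in> O_K" "p / d \<in> O_K" and uv: "u \<in> O_K" "v \<in> O_K" "u * a + v * p = d"
      by (rule O_K_gcd[of a p]) (use \<open>a \<in> O_K\<close> pO in auto)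
    have dO: "d \<in> O_K" "d > 0" using d by (auto simp: O_K_reps_def)
    have "d = 1"
    proof (rule ccontr)
      assume "d \<noteq> 1"
      have "(b / p) * (p / d) \<in> O_K" using pO d by blast
      then have "b / d \<in> O_K" using pO by simp
      then have "norm_K p \<le> norm_K d" using min[of d] d \<open>d \<noteq> 1\<close> norm_K_ge_1[of d] dO by (auto simp: P_def)
      moreover have "norm_K p = norm_K d * norm_K (p / d)" using norm_K_mult[of d "p / d"] d dO by simp
      moreover have "norm_K d \<ge> 1" using norm_K_ge_1 dO by auto
      moreover have "norm_K (p / d) \<ge> 1" using norm_K_ge_1 d pO dO by auto
      ultimately have "norm_K (p / d) = 1" 
        by (smt (verit) mult_le_cancel_left1 mult_cancel_left1)
      then have "inverse (p / d) \<in> O_K" using unit_dvd d by blast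
      then have "inverse (p / d) * (a / d) \<in> O_K" using d by blast
      then show False using that dO by (simp add: field_simps)
    qed
    then have "c / p = u * (a * c / p) + v * c" using uv(3) pO by (simp add: field_simps) (metis distrib_left mult.commute mult.left_commute mult_1)
    moreover have "u * (a * c / p) + v * c \<in> O_K" using uv that by blast
    ultimately show ?thesis by simp
  qed
  ultimately have "ring_prime\<^bsub>ring_on O_K\<^esub> p" using O_K_ring_prime_iff[OF pO(1)] pO by auto
  then show ?thesis using that pO by (auto simp: prime_reps_def)
qed

text \<open>Primality of p, applied to p = d (p/d) with d the gcd, makes d either a unit or an
  associate of p; likewise for q. If d were not a unit, p and q would be associates, hence equal by
  uniqueness of representatives.\<close>

lemma prime_reps_bezout:
  assumes p: "p \<in> prime_reps" and q: "q \<in> prime_reps" and "p \<noteq> q"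
  obtains u v where "u \<in> O_K" "v \<in> O_K" "u * p + v * q = 1"
proof -
  have pq: "p \<in> O_K" "q \<in> O_K" "p > 0" "q > 0" "p \<in> O_K_reps" "q \<in> O_K_reps"
    using p q by (auto simp: prime_reps_def O_K_reps_def)
  obtain d u v where d: "d \<in> O_K_reps" "p / d \<in> O_K" "q / d \<in> O_K" and uv: "u \<in> O_K" "v \<in> O_K" "u * p + v * q = d"
    by (rule O_K_gcd[of p q]) (use pq in auto)
  have dO: "d \<in> O_K" "d > 0" using d by (auto simp: O_K_reps_def)
  have *: "d / p \<in> O_K \<or> inverse d \<in> O_K" if "p \<in> prime_reps" "p / d \<in> O_K" for p
  proof -
    have pp: "p > 0" "p \<in> O_K" using that by (auto simp: prime_reps_def)
    have "d * (p / d) / p \<in> O_K" using dO pp by simp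
    then have "d / p \<in> O_K \<or> (p / d) / p \<in> O_K" using prime_reps_prime that dO by blast
    then show ?thesis using pp by (simp add: field_simps)
  qed
  have "inverse d \<in> O_K"
  proof (rule ccontr)
    assume "inverse d \<notin> O_K"
    then have "d / p \<in> O_K" "d / q \<in> O_K" using * p q d by blast+
    then have "(d / p) * (q / d) \<in> O_K" "(d / q) * (p / d) \<in> O_K" using d by blast+
    then have "q / p \<in> O_K" "p / q \<in> O_K" using dO by simp_all
    then show False using O_K_reps_unique pq assms(3) by blast
  qed
  then have "inverse d * u \<in> O_K" "inverse d * v \<in> O_K" using uv by blast+
  moreover have "(inverse d * u) * p + (inverse d * v) * q = 1"
    using uv(3) dO by (simp add: field_simps)
  ultimately show ?thesis using that by blast
qed

section \<open>The ring \<open>\<int>[\<zeta>]\<close> and its visible points\<close>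

text \<open>The integral combination of 1, \<zeta>, \<zeta>^2, \<zeta>^3 with these coefficients,
  written in real and imaginary parts so that identities reduce to algebra with \<surd>2.\<close>

definition z8 :: "int \<Rightarrow> int \<Rightarrow> int \<Rightarrow> int \<Rightarrow> complex" where
  "z8 a b c d = Complex (of_int a + of_int (b - d) * (sqrt 2 / 2)) (of_int c + of_int (b + d) * (sqrt 2 / 2))"

lemma zeta8_eq: "zeta8 = Complex (sqrt 2 / 2) (sqrt 2 / 2)"
proof -
  have "zeta8 = cis (pi / 4)" unfolding zeta8_def cis_conv_exp by (simp add: mult_ac)
  then show ?thesis by (simp add: complex_eq_iff cos_45 sin_45)
qed

lemma zeta8_power2: "zeta8\<^sup>2 = \<i>"
  by (simp add: zeta8_eq power2_eq_square complex_eq_iff)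

lemma zeta8_power3: "zeta8 ^ 3 = Complex (- sqrt 2 / 2) (sqrt 2 / 2)"
proof -
  have "zeta8 ^ 3 = zeta8\<^sup>2 * zeta8" by (simp add: power2_eq_square power3_eq_cube)
  also have "\<dots> = \<i> * Complex (sqrt 2 / 2) (sqrt 2 / 2)" unfolding zeta8_power2 by (simp add: zeta8_eq)
  finally show ?thesis by (simp add: complex_eq_iff)
qed

lemma z8_eq: "z8 a b c d = of_int a + of_int b * zeta8 + of_int c * zeta8\<^sup>2 + of_int d * zeta8 ^ 3"
  by (simp add: z8_def zeta8_power2 zeta8_power3 complex_eq_iff) (simp add: zeta8_eq algebra_simps)

lemma z8_add: "z8 a b c d + z8 a' b' c' d' = z8 (a + a') (b + b') (c + c') (d + d')"
  by (simp add: z8_eq algebra_simps)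

lemma z8_minus: "- z8 a b c d = z8 (- a) (- b) (- c) (- d)"
  by (simp add: z8_eq)

text \<open>The signs come from reducing powers by \<zeta>^4 = -1.\<close>

lemma z8_mult: "z8 a b c d * z8 a' b' c' d' =
    z8 (a*a' - b*d' - c*c' - d*b') (a*b' + b*a' - c*d' - d*c') (a*c' + b*b' + c*a' - d*d') (a*d' + b*c' + c*b' + d*a')"
  by (simp add: z8_def complex_eq_iff algebra_simps add_divide_distrib diff_divide_distrib)

lemma Z_zeta8_eq: "Z_zeta8 = {z8 a b c d | a b c d. True}"
proof (intro equalityI subsetI)
  fix x assume "x \<in> Z_zeta8"
  then show "x \<in> {z8 a b c d | a b c d. True}"
    unfolding Z_zeta8_def
  proof (induction rule: generate_ring.induct)
    case one
    have "1 = z8 1 0 0 0" by (simp add: z8_eq)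
    then show ?case unfolding ring_on_sel by blast
  next
    case (incl h)
    then have "h = z8 0 1 0 0" by (simp add: z8_eq)
    then show ?case by blast
  next
    case (a_inv h)
    then show ?case unfolding a_inv_ring_on_UNIV using z8_minus by blast
  next
    case (eng_add h1 h2)
    then show ?case unfolding ring_on_sel using z8_add by blast
  next
    case (eng_mult h1 h2)
    then show ?case unfolding ring_on_sel using z8_mult by blast
  qed
next
  note gr = generate_ring.intros[where R = "ring_on UNIV" and H = "{zeta8}", simplified]
  have nat: "of_nat n \<in> Z_zeta8" for n
    unfolding Z_zeta8_def
  proof (induction n)
    case 0
    have "1 + - 1 \<in> generate_ring (ring_on UNIV) {zeta8}" by (intro gr)
    then show ?case by simp
  next
    case (Suc n)
    then show ?case using gr by (auto simp: add.commute)
  qed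
  have int: "of_int n \<in> Z_zeta8" for n
    by (cases n rule: int_cases2) (use nat gr in \<open>auto simp: Z_zeta8_def\<close>)
  have pow: "zeta8 ^ n \<in> Z_zeta8" for n unfolding Z_zeta8_def by (induction n) (auto intro: gr)
  fix x assume "x \<in> {z8 a b c d | a b c d. True}"
  then obtain a b c d where "x = z8 a b c d" by blast
  then show "x \<in> Z_zeta8" unfolding z8_eq using gr int pow[of 1] pow[of 2] pow[of 3] by (simp add: Z_zeta8_def)
qed

lemma Z_zeta8_E:
  assumes "x \<in> Z_zeta8" obtains a b c d where "x = z8 a b c d"
  using assms by (auto simp: Z_zeta8_eq)

lemma Z_zeta8_add [intro]: "x \<in> Z_zeta8 \<Longrightarrow> y \<in> Z_zeta8 \<Longrightarrow> x + y \<in> Z_zeta8"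
  and Z_zeta8_mult [intro]: "x \<in> Z_zeta8 \<Longrightarrow> y \<in> Z_zeta8 \<Longrightarrow> x * y \<in> Z_zeta8"
  and Z_zeta8_minus [intro]: "x \<in> Z_zeta8 \<Longrightarrow> - x \<in> Z_zeta8"
  using generate_ring.intros[where R = "ring_on UNIV" and H = "{zeta8}", simplified] by (auto simp: Z_zeta8_def)

lemma of_real_O_K_Z_zeta8: 
  assumes "r \<in> O_K" shows "of_real r \<in> Z_zeta8"
proof -
  obtain m n where "r = of_int m + of_int n * sqrt 2" using assms by (rule O_K_E)
  then have "of_real r = z8 m n 0 (-n)" by (simp add: z8_def complex_eq_iff)
  then show ?thesis by (auto simp: Z_zeta8_eq)
qed

lemma Z_zeta8_scaleR [intro]: "r \<in> O_K \<Longrightarrow> x \<in> Z_zeta8 \<Longrightarrow> r *\<^sub>R x \<in> Z_zeta8"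
  by (auto simp: scaleR_conv_of_real of_real_O_K_Z_zeta8)

lemma Z_zeta8_0 [simp, intro]: "0 \<in> Z_zeta8"
  using of_real_O_K_Z_zeta8[of 0] by simp

text \<open>An explicit candidate for \<sigma>, needed to show that the choice in
  \<open>galois_sigma\<close> is not void. The sign in the imaginary part reflects i = \<zeta>^2,
  which is sent to \<zeta>^6 = -i.\<close>

definition sigma0 :: "complex \<Rightarrow> complex" where
  "sigma0 x = Complex (conj_K (Re x)) (- conj_K (Im x))"

definition Q_sqrt2_i :: "complex set" where
  "Q_sqrt2_i = {x. Re x \<in> Q_sqrt2 \<and> Im x \<in> Q_sqrt2}"

lemma sigma0_add: "x \<in> Q_sqrt2_i \<Longrightarrow> y \<in> Q_sqrt2_i \<Longrightarrow> x + y \<in> Q_sqrt2_i \<and> sigma0 (x + y) = sigma0 x + sigma0 y"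
  by (simp add: sigma0_def Q_sqrt2_i_def Q_sqrt2_add complex_eq_iff)

lemma sigma0_minus: "x \<in> Q_sqrt2_i \<Longrightarrow> - x \<in> Q_sqrt2_i \<and> sigma0 (- x) = - sigma0 x"
  by (simp add: sigma0_def Q_sqrt2_i_def Q_sqrt2_minus complex_eq_iff)

lemma Q_sqrt2_diff: "x \<in> Q_sqrt2 \<Longrightarrow> y \<in> Q_sqrt2 \<Longrightarrow> x - y \<in> Q_sqrt2 \<and> conj_K (x - y) = conj_K x - conj_K y"
  using Q_sqrt2_add[of x "-y"] Q_sqrt2_minus[of y] by simp

lemma sigma0_mult: "x \<in> Q_sqrt2_i \<Longrightarrow> y \<in> Q_sqrt2_i \<Longrightarrow> x * y \<in> Q_sqrt2_i \<and> sigma0 (x * y) = sigma0 x * sigma0 y"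
  by (simp add: sigma0_def Q_sqrt2_i_def Q_sqrt2_add Q_sqrt2_diff Q_sqrt2_mult complex_eq_iff)

lemma sigma0_sigma0: "x \<in> Q_sqrt2_i \<Longrightarrow> sigma0 x \<in> Q_sqrt2_i \<and> sigma0 (sigma0 x) = x"
  by (simp add: sigma0_def Q_sqrt2_i_def Q_sqrt2_conj Q_sqrt2_minus complex_eq_iff)

lemma Q_sqrt2_i_inverse: 
  assumes "x \<in> Q_sqrt2_i" shows "inverse x \<in> Q_sqrt2_i"
proof -
  have "(Re x)\<^sup>2 + (Im x)\<^sup>2 \<in> Q_sqrt2"
    unfolding power2_eq_square using assms Q_sqrt2_add Q_sqrt2_mult by (simp add: Q_sqrt2_i_def)
  then show ?thesis using assms Q_sqrt2_mult Q_sqrt2_inverse Q_sqrt2_minus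
    by (simp add: Q_sqrt2_i_def divide_inverse)
qed

lemma sigma0_1: "1 \<in> Q_sqrt2_i \<and> sigma0 1 = 1"
  using conj_K_rat[of 0 0] Q_sqrt2_Rats[of 0] Q_sqrt2_Rats[of 1] by (simp add: sigma0_def Q_sqrt2_i_def complex_eq_iff)

lemma sigma0_zeta8: "zeta8 \<in> Q_sqrt2_i \<and> sigma0 zeta8 = zeta8 ^ 3"
proof -
  have "sqrt 2 / 2 = 0 + (1/2) * sqrt 2" by simp
  moreover have "conj_K (0 + (1/2) * sqrt 2) = 0 - (1/2) * sqrt 2" by (rule conj_K_rat) auto
  moreover have "0 + (1/2) * sqrt 2 \<in> Q_sqrt2" by (rule Q_sqrt2_I) auto
  ultimately show ?thesis unfolding zeta8_power3 unfolding zeta8_eq by (simp add: sigma0_def Q_sqrt2_i_def)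
qed

lemma Q_zeta8_closed:
  "1 \<in> Q_zeta8" "zeta8 \<in> Q_zeta8"
  "x \<in> Q_zeta8 \<Longrightarrow> - x \<in> Q_zeta8"
  "x \<in> Q_zeta8 \<Longrightarrow> x \<noteq> 0 \<Longrightarrow> inverse x \<in> Q_zeta8"
  "x \<in> Q_zeta8 \<Longrightarrow> y \<in> Q_zeta8 \<Longrightarrow> x + y \<in> Q_zeta8"
  "x \<in> Q_zeta8 \<Longrightarrow> y \<in> Q_zeta8 \<Longrightarrow> x * y \<in> Q_zeta8"
  using generate_field.intros[where R = "ring_on UNIV" and H = "{zeta8}", simplified]
    m_inv_ring_on_UNIV[of x] by (auto simp: Q_zeta8_def)

lemma Q_zeta8_sigma0:
  assumes "x \<in> Q_zeta8" shows "x \<in> Q_sqrt2_i \<and> sigma0 x \<in> Q_zeta8"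
  using assms unfolding Q_zeta8_def
proof (induction rule: generate_field.induct)
  case one
  show ?case using sigma0_1 Q_zeta8_closed(1) by (simp add: Q_zeta8_def)
next
  case (incl h)
  have "zeta8 ^ 3 \<in> Q_zeta8" unfolding power3_eq_cube using Q_zeta8_closed(2,6) by blast
  then show ?case using incl sigma0_zeta8 by (simp add: Q_zeta8_def)
next
  case (a_inv h)
  then show ?case using sigma0_minus[of h] Q_zeta8_closed(3)[of "sigma0 h"] by (simp add: Q_zeta8_def)
next
  case (m_inv h)
  then have h: "h \<noteq> 0" "h \<in> Q_sqrt2_i" "inverse h \<in> Q_sqrt2_i" "sigma0 h \<in> Q_zeta8"
    using Q_sqrt2_i_inverse by (auto simp: Q_zeta8_def)
  then have "sigma0 h * sigma0 (inverse h) = 1" using sigma0_mult[of h "inverse h"] sigma0_1 by simp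
  then have "sigma0 (inverse h) = inverse (sigma0 h)" "sigma0 h \<noteq> 0" by (auto dest: inverse_unique)
  then have "sigma0 (inverse h) \<in> Q_zeta8" using Q_zeta8_closed(4) h by simp
  then show ?case using h by (simp add: Q_zeta8_def)
next
  case (eng_add h1 h2)
  then show ?case using sigma0_add[of h1 h2] Q_zeta8_closed(5)[of "sigma0 h1" "sigma0 h2"] by (simp add: Q_zeta8_def)
next
  case (eng_mult h1 h2)
  then show ?case using sigma0_mult[of h1 h2] Q_zeta8_closed(6)[of "sigma0 h1" "sigma0 h2"] by (simp add: Q_zeta8_def)
qed

text \<open>Bijectivity is free: \<open>sigma0\<close> maps \<open>Q_zeta8\<close> into itself and
  is its own inverse there.\<close>

lemma sigma0_ring_iso: "sigma0 \<in> ring_iso (ring_on Q_zeta8) (ring_on Q_zeta8)"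
proof -
  have "bij_betw sigma0 Q_zeta8 Q_zeta8"
    by (rule bij_betw_byWitness[where f' = sigma0]) (use Q_zeta8_sigma0 sigma0_sigma0 in auto)
  then show ?thesis
    using Q_zeta8_sigma0 sigma0_add sigma0_mult sigma0_1 by (auto intro!: ring_iso_memI)
qed

lemma galois_sigma_hom:
  "galois_sigma \<in> ring_iso (ring_on Q_zeta8) (ring_on Q_zeta8)" "galois_sigma zeta8 = zeta8 ^ 3"
  unfolding galois_sigma_def
  using someI[of "\<lambda>h. h \<in> ring_iso (ring_on Q_zeta8) (ring_on Q_zeta8) \<and> h zeta8 = zeta8 ^ 3" sigma0]
    sigma0_ring_iso sigma0_zeta8 by auto

text \<open>A ring homomorphism is determined on the ring generated by \<zeta> by its value at
  \<zeta>, so whichever automorphism was chosen agrees with the explicit one.\<close>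

lemma galois_sigma_eq_sigma0:
  assumes "x \<in> Z_zeta8" shows "x \<in> Q_zeta8 \<and> galois_sigma x = sigma0 x"
  using assms unfolding Z_zeta8_def
proof (induction rule: generate_ring.induct)
  note hom = galois_sigma_hom(1)[unfolded ring_iso_def mem_Collect_eq, THEN conjunct1]
  note hom' = ring_hom_add[OF hom, simplified] ring_hom_mult[OF hom, simplified] ring_hom_one[OF hom, simplified]
  have 0: "0 \<in> Q_zeta8" using Q_zeta8_closed(1) Q_zeta8_closed(3,5) by (metis add.right_inverse)
  have h0: "galois_sigma 0 = 0" using hom'(1)[of 0 0] 0 by simp
  {
    case one
    then show ?case using hom' sigma0_1 Q_zeta8_closed by simp
  next
    case (incl h)
    then show ?case using galois_sigma_hom(2) sigma0_zeta8 Q_zeta8_closed by simp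
  next
    case (a_inv h)
    then have "galois_sigma h + galois_sigma (- h) = 0" using hom'(1)[of h "-h"] Q_zeta8_closed(3)[of h] h0 by simp
    then have "galois_sigma (- h) = - galois_sigma h" by (simp add: add_eq_0_iff)
    then show ?case using a_inv sigma0_minus[of h] Q_zeta8_sigma0[of h] Q_zeta8_closed(3)[of h] by simp
  next
    case (eng_add h1 h2)
    then show ?case using hom'(1)[of h1 h2] sigma0_add[of h1 h2] Q_zeta8_sigma0[of h1] Q_zeta8_sigma0[of h2]
        Q_zeta8_closed(5)[of h1 h2] by simp
  next
    case (eng_mult h1 h2)
    then show ?case using hom'(2)[of h1 h2] sigma0_mult[of h1 h2] Q_zeta8_sigma0[of h1] Q_zeta8_sigma0[of h2]
        Q_zeta8_closed(6)[of h1 h2] by simp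
  }
qed

lemma galois_sigma_z8: 
  "galois_sigma (z8 a b c d) = Complex (of_int a - of_int (b - d) * (sqrt 2 / 2)) (- of_int c + of_int (b + d) * (sqrt 2 / 2))"
proof -
  have *: "conj_K (of_int m + of_int n * (sqrt 2 / 2)) = of_int m - of_int n * (sqrt 2 / 2)" for m n
    using conj_K_rat[of "of_int m" "of_int n / 2"] by simp
  have "galois_sigma (z8 a b c d) = sigma0 (z8 a b c d)"
    using galois_sigma_eq_sigma0[of "z8 a b c d"] by (auto simp: Z_zeta8_eq)
  then show ?thesis unfolding sigma0_def z8_def complex.sel * by simp
qed

lemma galois_sigma_scaleR:
  assumes "r \<in> O_K" "x \<in> Z_zeta8"
  shows "galois_sigma (r *\<^sub>R x) = conj_K r *\<^sub>R galois_sigma x"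
proof -
  have "r *\<^sub>R x \<in> Z_zeta8" "r \<in> Q_sqrt2" using assms O_K_subset_Q_sqrt2 by auto
  moreover have "Re x \<in> Q_sqrt2" "Im x \<in> Q_sqrt2" using galois_sigma_eq_sigma0[OF assms(2)] Q_zeta8_sigma0[of x]
    by (auto simp: Q_sqrt2_i_def)
  ultimately show ?thesis using galois_sigma_eq_sigma0 assms
    by (simp add: sigma0_def complex_eq_iff Q_sqrt2_mult)
qed

lemma galois_sigma_0 [simp]: "galois_sigma 0 = 0"
  using galois_sigma_scaleR[of 0 0] conj_K_of_int[of 0] by simp

section \<open>Relative norms and real ratios of cyclotomic integers\<close>

lemma cmod_power2_Z_zeta8:
  assumes "x \<in> Z_zeta8"
  shows "(cmod x)\<^sup>2 \<in> O_K" "conj_K ((cmod x)\<^sup>2) = (cmod (galois_sigma x))\<^sup>2"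
proof -
  obtain a b c d where x: "x = z8 a b c d" using assms by (rule Z_zeta8_E)
  have e: "(cmod x)\<^sup>2 = of_int (a*a + b*b + c*c + d*d) + of_int (a*(b-d) + c*(b+d)) * sqrt 2"
    unfolding x z8_def cmod_power2 by (simp add: power2_eq_square algebra_simps add_divide_distrib diff_divide_distrib)
  show "(cmod x)\<^sup>2 \<in> O_K" unfolding e by (rule O_K_I)
  show "conj_K ((cmod x)\<^sup>2) = (cmod (galois_sigma x))\<^sup>2" unfolding e conj_K_eq unfolding x galois_sigma_z8 cmod_power2
    by (simp add: power2_eq_square algebra_simps add_divide_distrib diff_divide_distrib)
qed

text \<open>The square of x times its complex conjugate structure: |x|^2 is the relative norm of x
  to Q(\<surd>2), and \<sigma> commutes with complex conjugation. So the square of the product on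
  the right is the absolute norm of x, a positive integer.\<close>

lemma Z_zeta8_norm_ge_1:
  assumes "x \<in> Z_zeta8" "x \<noteq> 0"
  shows "1 \<le> cmod x * cmod (galois_sigma x)"
proof -
  have "1 \<le> norm_K ((cmod x)\<^sup>2)" using norm_K_ge_1 cmod_power2_Z_zeta8[OF assms(1)] assms(2) by simp
  then have "1 \<le> (cmod x * cmod (galois_sigma x))\<^sup>2"
    using of_int_norm_K[of "(cmod x)\<^sup>2"] cmod_power2_Z_zeta8[OF assms(1)] by (simp add: power_mult_distrib)
  then show ?thesis by (metis norm_ge_zero one_power2 power2_le_imp_le mult_nonneg_nonneg)
qed

lemma Z_zeta8_real_ratio:
  assumes "x \<in> Z_zeta8" "x \<noteq> 0" "t *\<^sub>R x \<in> Z_zeta8"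
  obtains a b where "a \<in> O_K" "b \<in> O_K" "b \<noteq> 0" "t = a / b"
proof -
  \<comment> \<open>The factor \<surd>2 clears the denominators of \<surd>2/2 in real and imaginary
    part; it cancels in the quotient that represents t.\<close>
  have *: "sqrt 2 * Re y \<in> O_K \<and> sqrt 2 * Im y \<in> O_K" if "y \<in> Z_zeta8" for y
  proof -
    obtain a b c d where x: "y = z8 a b c d" using Z_zeta8_E[OF \<open>y \<in> Z_zeta8\<close>] by metis
    have "sqrt 2 * Re y = of_int (b - d) + of_int a * sqrt 2" "sqrt 2 * Im y = of_int (b + d) + of_int c * sqrt 2"
      unfolding x z8_def by (simp_all add: algebra_simps add_divide_distrib diff_divide_distrib)
    then show ?thesis by (simp only: O_K_I)
  qed
  show ?thesis
  proof (cases "Re x = 0")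
    case False
    then have "t = (sqrt 2 * Re (t *\<^sub>R x)) / (sqrt 2 * Re x)" by simp
    then show ?thesis using that * assms False by (metis mult_eq_0_iff real_sqrt_eq_zero_cancel_iff zero_neq_numeral)
  next
    case True
    then have "Im x \<noteq> 0" using assms(2) by (simp add: complex_eq_iff)
    from this have "t = (sqrt 2 * Im (t *\<^sub>R x)) / (sqrt 2 * Im x)" by simp
    then show ?thesis using that * assms \<open>Im x \<noteq> 0\<close> by (metis mult_eq_0_iff real_sqrt_eq_zero_cancel_iff zero_neq_numeral)
  qed
qed

text \<open>Write t = a/b in lowest terms. From u a + v b = 1 one gets x/b = u (t x) + v x, so b
  divides x; a prime factor of b would then divide x too, hence b is a unit.\<close>

lemma Z_zeta8_real_multiple:
  assumes "x \<in> Z_zeta8" "x \<noteq> 0" "t *\<^sub>R x \<in> Z_zeta8" "\<And>p. p \<in> prime_reps \<Longrightarrow> x /\<^sub>R p \<notin> Z_zeta8"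
  shows "t \<in> O_K"
proof -
  obtain a0 b0 where ab0: "a0 \<in> O_K" "b0 \<in> O_K" "b0 \<noteq> 0" "t = a0 / b0" using assms Z_zeta8_real_ratio by metis
  obtain d u v where d: "d \<in> O_K_reps" "a0 / d \<in> O_K" "b0 / d \<in> O_K" and uv: "u \<in> O_K" "v \<in> O_K" "u * a0 + v * b0 = d"
    using O_K_gcd ab0 by metis
  have d0: "d > 0" using d by (simp add: O_K_reps_def)
  define a b where "a = a0 / d" and "b = b0 / d"
  have ab: "a \<in> O_K" "b \<in> O_K" "b \<noteq> 0" "t = a / b" "u * a + v * b = 1"
    using d ab0 uv d0 by (auto simp: a_def b_def field_simps)
  have "x /\<^sub>R b = u *\<^sub>R (t *\<^sub>R x) + v *\<^sub>R x"
  proof -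
    have "u * t + v = (u * a + v * b) / b" using ab(3,4) by (simp add: add_divide_distrib)
    then have "u * t + v = inverse b" using ab(5) by (simp add: divide_inverse)
    then show ?thesis by (metis scaleR_add_left scaleR_scaleR)
  qed
  moreover have "u *\<^sub>R (t *\<^sub>R x) + v *\<^sub>R x \<in> Z_zeta8" using assms uv by blast
  ultimately have xb: "x /\<^sub>R b \<in> Z_zeta8" by metis
  have "inverse b \<in> O_K"
  proof (rule ccontr)
    assume "inverse b \<notin> O_K"
    then obtain p where p: "p \<in> prime_reps" "b / p \<in> O_K" using exists_prime_divisor ab by metis
    have "(b / p) *\<^sub>R (x /\<^sub>R b) \<in> Z_zeta8" using p xb by blast
    then have "x /\<^sub>R p \<in> Z_zeta8" using ab by (simp add: field_simps)
    then show False using assms p by blast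
  qed
  then show ?thesis using ab by (simp add: divide_inverse O_K_mult)
qed

text \<open>A sieve with variable window and variable set of primes: \<open>F = {}\<close> is the
  plain model set, finite \<open>F\<close> admits induction, and \<open>F = prime_reps\<close>
  describes the visible points.\<close>

definition coprime_points :: "real set \<Rightarrow> complex set \<Rightarrow> complex set" where
  "coprime_points F V = {x \<in> Z_zeta8. galois_sigma x \<in> V \<and> (\<forall>p\<in>F. x /\<^sub>R p \<notin> Z_zeta8)}"

text \<open>Nonnegative factors are covered by star-shapedness. For negative s write -w = \<surd>2
  w' with w' in W, so that s w = (-s \<surd>2) w' with a factor in [0, 1]. All later uses of the two
  window hypotheses pass through this interval.\<close>

lemma window_scale:
  assumes "star_shaped W" "uminus ` W \<subseteq> (*\<^sub>R) (sqrt 2) ` W" "w \<in> W" "- 1 / sqrt 2 \<le> s" "s \<le> 1"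
  shows "s *\<^sub>R w \<in> W"
proof (cases "s \<ge> 0")
  case True
  then show ?thesis using assms by (auto simp: star_shaped_def)
next
  case False
  obtain w' where w': "w' \<in> W" "- w = sqrt 2 *\<^sub>R w'" using assms by blast
  have "s *\<^sub>R w = (- s) *\<^sub>R (- w)" by simp
  also have "\<dots> = (- s * sqrt 2) *\<^sub>R w'" using w' by simp
  also have "- s * sqrt 2 \<in> {0..1}" using assms False mult_nonpos_nonneg[of s "sqrt 2"] by (auto simp: field_simps)
  then have "(- s * sqrt 2) *\<^sub>R w' \<in> W" using assms(1) w' unfolding star_shaped_def by blast
  finally show ?thesis .
qed

lemma sqrt2_minus_1_fund_unit: "(1 - sqrt 2) * fund_unit = - 1"
  by (simp add: fund_unit_def algebra_simps)

text \<open>From left to right it suffices to try the shrinking factors 1/p and 1/\<lambda> =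
  \<surd>2 - 1. Conversely, when no prime divides x, any shrinking factor t lies in
  \<open>O_K\<close>, and every such t in (0, 1) is reduced to 1/\<lambda>.\<close>

lemma visible_model_set:
  assumes W: "star_shaped W" "uminus ` W \<subseteq> (*\<^sub>R) (sqrt 2) ` W"
  shows "visible (model_set W) = coprime_points prime_reps (W - (*\<^sub>R) (1 - sqrt 2) ` W)"
proof (intro equalityI subsetI)
  fix x assume "x \<in> visible (model_set W)"
  then have x: "x \<in> Z_zeta8" "galois_sigma x \<in> W" and vis: "\<And>t. 0 < t \<Longrightarrow> t < 1 \<Longrightarrow> t *\<^sub>R x \<notin> model_set W"
    by (auto simp: visible_def model_set_def)
  have "x /\<^sub>R p \<notin> Z_zeta8" if p: "p \<in> prime_reps" for p
  proof
    assume y: "x /\<^sub>R p \<in> Z_zeta8"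
    have pp: "p \<in> O_K" "1 < p" "p < fund_unit" using p by (auto simp: prime_reps_def)
    have "galois_sigma x = conj_K p *\<^sub>R galois_sigma (x /\<^sub>R p)"
      using galois_sigma_scaleR[OF pp(1) y] pp by simp
    moreover have c: "conj_K p \<noteq> 0" "- 1 / sqrt 2 \<le> 1 / conj_K p" "1 / conj_K p \<le> 1"
    proof -
      show "conj_K p \<noteq> 0" using pp conj_K_eq_0 by auto
      show "- 1 / sqrt 2 \<le> 1 / conj_K p" "1 / conj_K p \<le> 1"
        using conj_K_between_1_fund_unit[OF pp]
        by (auto simp: field_simps divide_simps sqrt2_bounds split: if_splits) (use sqrt2_bounds in linarith)+
    qed
    ultimately have "galois_sigma (x /\<^sub>R p) = (1 / conj_K p) *\<^sub>R galois_sigma x" by simp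
    then have "galois_sigma (x /\<^sub>R p) \<in> W" using window_scale[OF W x(2)] c by metis
    then have "x /\<^sub>R p \<in> model_set W" using y by (simp add: model_set_def)
    moreover have "0 < inverse p" "inverse p < 1" using pp by (auto simp: inverse_less_1_iff)
    ultimately show False using vis[of "inverse p"] by blast
  qed
  moreover have "galois_sigma x \<notin> (*\<^sub>R) (1 - sqrt 2) ` W"
  proof
    assume "galois_sigma x \<in> (*\<^sub>R) (1 - sqrt 2) ` W"
    then obtain w where w: "w \<in> W" "galois_sigma x = (1 - sqrt 2) *\<^sub>R w" by blast
    have s: "sqrt 2 - 1 \<in> O_K" "conj_K (sqrt 2 - 1) = - fund_unit"
      using O_K_I[of "-1" 1] conj_K_eq[of "-1" 1] by (auto simp: fund_unit_def)
    have "galois_sigma ((sqrt 2 - 1) *\<^sub>R x) = (- fund_unit * (1 - sqrt 2)) *\<^sub>R w"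
      using galois_sigma_scaleR[OF s(1) x(1)] s(2) w by simp
    also have "\<dots> = w" using sqrt2_minus_1_fund_unit by (simp add: mult.commute)
    finally have "(sqrt 2 - 1) *\<^sub>R x \<in> model_set W" using w s x by (auto simp: model_set_def)
    then show False using vis[of "sqrt 2 - 1"] sqrt2_bounds by simp
  qed
  ultimately show "x \<in> coprime_points prime_reps (W - (*\<^sub>R) (1 - sqrt 2) ` W)"
    using x by (simp add: coprime_points_def)
next
  fix x assume "x \<in> coprime_points prime_reps (W - (*\<^sub>R) (1 - sqrt 2) ` W)"
  then have x: "x \<in> Z_zeta8" "galois_sigma x \<in> W" "galois_sigma x \<notin> (*\<^sub>R) (1 - sqrt 2) ` W"
    "\<And>p. p \<in> prime_reps \<Longrightarrow> x /\<^sub>R p \<notin> Z_zeta8" by (auto simp: coprime_points_def)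
  \<comment> \<open>The origin equals each of its multiples, so the window condition removes it; the
    argument with real ratios requires this.\<close>
  have "x \<noteq> 0" 
  proof
    assume "x = 0"
    then have "(1 - sqrt 2) *\<^sub>R galois_sigma x = galois_sigma x" by simp
    then show False using x by (metis imageI)
  qed
  have "t *\<^sub>R x \<notin> model_set W" if t: "0 < t" "t < 1" for t
  proof
    assume tx: "t *\<^sub>R x \<in> model_set W"
    then have tO: "t \<in> O_K" using Z_zeta8_real_multiple x \<open>x \<noteq> 0\<close> by (auto simp: model_set_def)
    then have tW: "conj_K t *\<^sub>R galois_sigma x \<in> W" using tx galois_sigma_scaleR x by (simp add: model_set_def)
    have c: "conj_K t \<le> - fund_unit \<or> sqrt 2 * fund_unit \<le> conj_K t" by (rule conj_K_between_0_1[OF tO t])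
    have f: "fund_unit > 0" using fund_unit_bounds by simp
    \<comment> \<open>Since \<sigma>(1/\<lambda>) = -\<lambda>, this factor carries \<sigma>(t x) to
      \<sigma>(x/\<lambda>). The bounds on \<sigma>(t) are exactly those that place it in
      [-1/\<surd>2, 1].\<close>
    define s where "s = - fund_unit / conj_K t"
    have c0: "conj_K t \<noteq> 0" using tO t conj_K_eq_0 by auto
    have s: "- 1 / sqrt 2 \<le> s" "s \<le> 1"
    proof -
      have "conj_K t < 0 \<or> 0 < conj_K t" using c0 by linarith
      then show "- 1 / sqrt 2 \<le> s" "s \<le> 1" using c f unfolding s_def
        by (auto simp: field_simps) (smt (verit) mult_pos_pos real_sqrt_gt_zero mult_neg_pos mult.commute)+
    qed
    have "s *\<^sub>R (conj_K t *\<^sub>R galois_sigma x) \<in> W" by (rule window_scale[OF W tW s])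
    then have "(- fund_unit) *\<^sub>R galois_sigma x \<in> W" using c0 by (simp add: s_def)
    moreover have "(1 - sqrt 2) *\<^sub>R ((- fund_unit) *\<^sub>R galois_sigma x) = galois_sigma x"
      using sqrt2_minus_1_fund_unit by simp
    ultimately show False using x(3) by (metis imageI)
  qed
  then show "x \<in> visible (model_set W)" using x by (auto simp: visible_def model_set_def)
qed

section \<open>Counting lattice points\<close>

lemma jordan_measurable_lmeasurable: "jordan_measurable D \<Longrightarrow> D \<in> lmeasurable"
  by (auto simp: jordan_measurable_def negligible_iff_null_sets[symmetric] intro: measurable_Jordan)

lemma frontier_scaleR_image:
  fixes D :: "'a::euclidean_space set"
  assumes "c \<noteq> 0" shows "frontier ((*\<^sub>R) c ` D) = (*\<^sub>R) c ` frontier D"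
proof -
  have "interior ((*\<^sub>R) c ` D) = (*\<^sub>R) c ` interior D"
    by (rule interior_injective_linear_image) (use assms in \<open>auto intro: injI linear_scale_self\<close>)
  moreover have "closure ((*\<^sub>R) c ` D) = (*\<^sub>R) c ` closure D"
    by (rule closure_injective_linear_image[symmetric]) (use assms in \<open>auto intro: injI linear_scale_self\<close>)
  moreover have "inj ((*\<^sub>R) c :: 'a \<Rightarrow> 'a)" using assms by (auto intro: injI)
  ultimately show ?thesis by (simp add: frontier_def image_set_diff)
qed

lemma jordan_measurable_scaleR:
  fixes D :: "'a::euclidean_space set"
  assumes "jordan_measurable D" "c \<noteq> 0"
  shows "jordan_measurable ((*\<^sub>R) c ` D)"
proof -
  have D: "negligible (frontier D)" "compact (frontier D)"
    using assms by (auto simp: jordan_measurable_def negligible_iff_null_sets compact_frontier_bounded)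
  then have "measure lebesgue ((*\<^sub>R) c ` frontier D) = 0"
    using measure_lebesgue_affine[of c 0 "frontier D"] by (simp add: negligible_imp_measure0 del: measure_completion)
  moreover have "(*\<^sub>R) c ` frontier D \<in> lmeasurable" using D by (intro lmeasurable_compact compact_scaling)
  ultimately have "negligible ((*\<^sub>R) c ` frontier D)" by (simp add: negligible_iff_measure)
  then show ?thesis using assms
    by (auto simp: jordan_measurable_def frontier_scaleR_image bounded_scaling negligible_iff_null_sets)
qed

lemma jordan_measurable_diff:
  assumes "jordan_measurable A" "jordan_measurable B"
  shows "jordan_measurable (A - B)"
proof -
  have "frontier (A - B) \<subseteq> frontier A \<union> frontier B"
    using frontier_Int_subset[of A "- B"] by (simp add: Diff_eq frontier_complement)
  moreover have "negligible (frontier A \<union> frontier B)"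
    using assms by (simp add: jordan_measurable_def negligible_iff_null_sets[symmetric])
  ultimately have "negligible (frontier (A - B))" by (rule negligible_subset[rotated])
  then show ?thesis using assms bounded_subset[of A "A - B"]
    by (auto simp: jordan_measurable_def negligible_iff_null_sets)
qed

lemma measure_scaleR_image:
  "measure lebesgue ((*\<^sub>R) c ` (D :: complex set)) = c\<^sup>2 * measure lebesgue D"
  using measure_lebesgue_affine[of c 0 D] by simp

text \<open>Together with \<open>inner_nbhd\<close> this brackets a lattice count: when tiles have
  bounded extent r, those of the points in A stay inside the thickened set and cover the shrunken
  one.\<close>

definition outer_nbhd :: "real \<Rightarrow> 'a::euclidean_space set \<Rightarrow> 'a set" where
  "outer_nbhd r A = (\<Union>a\<in>A. ball a r)"

definition inner_nbhd :: "real \<Rightarrow> 'a::euclidean_space set \<Rightarrow> 'a set" where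
  "inner_nbhd r A = {z. ball z r \<subseteq> A}"

lemma open_outer: "open (outer_nbhd r A)"
  by (auto simp: outer_nbhd_def)

lemma inner_eq: "inner_nbhd r A = - outer_nbhd r (- A)"
  by (auto simp: inner_nbhd_def outer_nbhd_def dist_commute)

lemma closed_inner: "closed (inner_nbhd r A)"
  unfolding inner_eq using open_outer closed_def by auto

lemma bounded_outer:
  assumes "bounded A" shows "bounded (outer_nbhd r A)"
proof -
  obtain M where M: "\<And>x. x \<in> A \<Longrightarrow> norm x \<le> M" using assms by (auto simp: bounded_iff)
  have "norm z \<le> M + r" if "z \<in> outer_nbhd r A" for z
  proof -
    obtain a where a: "a \<in> A" "dist a z < r" using \<open>z \<in> outer_nbhd r A\<close> by (auto simp: outer_nbhd_def)
    then have "norm z \<le> norm a + norm (z - a)" by (metis add.commute diff_add_cancel norm_triangle_ineq)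
    then show ?thesis using a M[of a] by (simp add: dist_norm norm_minus_commute)
  qed
  then show ?thesis by (auto simp: bounded_iff)
qed

lemma lmeasurable_outer: "bounded A \<Longrightarrow> outer_nbhd r A \<in> lmeasurable"
  by (simp add: bounded_outer open_outer lmeasurable_open)

lemma inner_subset: "r > 0 \<Longrightarrow> inner_nbhd r A \<subseteq> A"
  by (auto simp: inner_nbhd_def)

lemma lmeasurable_inner: "bounded A \<Longrightarrow> r > 0 \<Longrightarrow> inner_nbhd r A \<in> lmeasurable"
  by (metis bounded_subset closed_inner inner_subset compact_eq_bounded_closed lmeasurable_compact)

lemma outer_mono: "r \<le> s \<Longrightarrow> outer_nbhd r A \<subseteq> outer_nbhd s A"
  by (auto simp: outer_nbhd_def intro: less_le_trans)

lemma inner_antimono: "r \<le> s \<Longrightarrow> inner_nbhd s A \<subseteq> inner_nbhd r A"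
  by (auto simp: inner_nbhd_def intro: less_le_trans)

lemma measure_closure_jordan:
  assumes "jordan_measurable D" shows "measure lebesgue (closure D) = measure lebesgue D"
proof (rule measure_negligible_symdiff)
  show "D \<in> lmeasurable" by (rule jordan_measurable_lmeasurable[OF assms])
  have "D - closure D \<union> (closure D - D) \<subseteq> frontier D"
    using closure_subset[of D] interior_subset[of D] by (auto simp: frontier_def)
  then show "negligible (D - closure D \<union> (closure D - D))"
    using assms negligible_subset by (auto simp: jordan_measurable_def negligible_iff_null_sets)
qed

lemma measure_interior_jordan:
  assumes "jordan_measurable D" shows "measure lebesgue (interior D) = measure lebesgue D"
proof (rule measure_negligible_symdiff)
  show "D \<in> lmeasurable" by (rule jordan_measurable_lmeasurable[OF assms])
  have "D - interior D \<union> (interior D - D) \<subseteq> frontier D"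
    using closure_subset[of D] interior_subset[of D] by (auto simp: frontier_def)
  then show "negligible (D - interior D \<union> (interior D - D))"
    using assms negligible_subset by (auto simp: jordan_measurable_def negligible_iff_null_sets)
qed

text \<open>The thickenings decrease to the closure, and all have finite measure by boundedness, so
  continuity from above applies. The closure has the measure of D because the frontier is
  null.\<close>

lemma tendsto_measure_outer:
  assumes "jordan_measurable D"
  shows "((\<lambda>r. measure lebesgue (outer_nbhd r D)) \<longlongrightarrow> measure lebesgue D) (at_right 0)"
proof (rule tendsto_at_right_sequentially[of 0 1])
  fix S :: "nat \<Rightarrow> real" assume S: "\<And>n. 0 < S n" "decseq S" "S \<longlonglongrightarrow> 0"
  have b: "bounded D" using assms by (simp add: jordan_measurable_def)
  have "(\<lambda>n. measure lebesgue (outer_nbhd (S n) D)) \<longlonglongrightarrow> measure lebesgue (\<Inter> (range (\<lambda>n. outer_nbhd (S n) D)))"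
  proof (rule Lim_measure_decseq)
    show "range (\<lambda>n. outer_nbhd (S n) D) \<subseteq> sets lebesgue" using lmeasurable_outer[OF b] by blast
    show "decseq (\<lambda>n. outer_nbhd (S n) D)" using S(2) outer_mono unfolding decseq_def by blast
    show "emeasure lebesgue (outer_nbhd (S i) D) \<noteq> \<infinity>" for i using lmeasurable_outer[OF b] by (metis fmeasurableD2 infinity_ennreal_def)
  qed
  also have "\<Inter> (range (\<lambda>n. outer_nbhd (S n) D)) = closure D"
  proof (intro equalityI subsetI)
    fix x assume x: "x \<in> \<Inter> (range (\<lambda>n. outer_nbhd (S n) D))"
    show "x \<in> closure D"
    proof (rule closure_approachable[THEN iffD2], intro allI impI)
      fix e :: real assume "e > 0"
      then have "eventually (\<lambda>n. S n < e) sequentially" using S(3) by (rule order_tendstoD(2)[rotated])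
      then obtain n where "S n < e" by (meson eventually_sequentially order_refl)
      moreover obtain a where "a \<in> D" "dist a x < S n" using x by (auto simp: outer_nbhd_def)
      ultimately show "\<exists>y\<in>D. dist y x < e" by (meson less_trans)
    qed
  next
    fix x assume "x \<in> closure D"
    then show "x \<in> \<Inter> (range (\<lambda>n. outer_nbhd (S n) D))" using S(1)
      by (auto simp: outer_nbhd_def closure_approachable)
  qed
  finally show "(\<lambda>n. measure lebesgue (outer_nbhd (S n) D)) \<longlonglongrightarrow> measure lebesgue D"
    using measure_closure_jordan[OF assms] by simp
qed simp

text \<open>The dual argument: the shrunken sets increase to the interior.\<close>

lemma tendsto_measure_inner:
  assumes "jordan_measurable D"
  shows "((\<lambda>r. measure lebesgue (inner_nbhd r D)) \<longlongrightarrow> measure lebesgue D) (at_right 0)"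
proof (rule tendsto_at_right_sequentially[of 0 1])
  fix S :: "nat \<Rightarrow> real" assume S: "\<And>n. 0 < S n" "decseq S" "S \<longlonglongrightarrow> 0"
  have b: "bounded D" using assms by (simp add: jordan_measurable_def)
  have eq: "\<Union> (range (\<lambda>n. inner_nbhd (S n) D)) = interior D"
  proof (intro equalityI subsetI)
    fix x assume "x \<in> \<Union> (range (\<lambda>n. inner_nbhd (S n) D))"
    then show "x \<in> interior D" using S(1) by (auto simp: inner_nbhd_def mem_interior)
  next
    fix x assume "x \<in> interior D"
    then obtain e where e: "e > 0" "ball x e \<subseteq> D" by (auto simp: mem_interior)
    then have "eventually (\<lambda>n. S n < e) sequentially" using S(3) by (intro order_tendstoD(2))
    then obtain n where "S n < e" by (meson eventually_sequentially order_refl)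
    then have "ball x (S n) \<subseteq> D" using e subset_ball[of "S n" e x] by auto
    then show "x \<in> \<Union> (range (\<lambda>n. inner_nbhd (S n) D))" by (auto simp: inner_nbhd_def)
  qed
  have "(\<lambda>n. measure lebesgue (inner_nbhd (S n) D)) \<longlonglongrightarrow> measure lebesgue (\<Union> (range (\<lambda>n. inner_nbhd (S n) D)))"
  proof (rule Lim_measure_incseq)
    show "range (\<lambda>n. inner_nbhd (S n) D) \<subseteq> sets lebesgue" using lmeasurable_inner[OF b S(1)] by blast
    show "incseq (\<lambda>n. inner_nbhd (S n) D)" using S(2) inner_antimono unfolding decseq_def incseq_def by blast
    have "interior D \<in> lmeasurable" using b by (simp add: lmeasurable_interior)
    then show "emeasure lebesgue (\<Union> (range (\<lambda>n. inner_nbhd (S n) D))) \<noteq> \<infinity>" unfolding eq by (metis fmeasurableD2 infinity_ennreal_def)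
  qed
  then show "(\<lambda>n. measure lebesgue (inner_nbhd (S n) D)) \<longlonglongrightarrow> measure lebesgue D"
    unfolding eq using measure_interior_jordan[OF assms] by simp
qed simp

text \<open>Trades a fixed thickness around a large dilate for a thickness tending to 0 around a
  fixed set.\<close>

lemma outer_scaleR:
  assumes "R > 0" shows "outer_nbhd r ((*\<^sub>R) R ` D) = (*\<^sub>R) R ` outer_nbhd (r / R) D"
proof -
  have "ball (R *\<^sub>R a) r = (*\<^sub>R) R ` ball a (r / R)" for a :: 'a
  proof (intro equalityI subsetI)
    fix x assume "x \<in> ball (R *\<^sub>R a) r"
    then have "norm (R *\<^sub>R (a - x /\<^sub>R R)) < r" using assms by (simp add: dist_norm algebra_simps)
    then have "R * norm (a - x /\<^sub>R R) < r" unfolding norm_scaleR using assms by simp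
    then have "x /\<^sub>R R \<in> ball a (r / R)" using assms by (simp add: dist_norm pos_less_divide_eq mult.commute)
    then show "x \<in> (*\<^sub>R) R ` ball a (r / R)" using assms by (intro image_eqI[of _ _ "x /\<^sub>R R"]) auto
  next
    fix x assume "x \<in> (*\<^sub>R) R ` ball a (r / R)"
    then obtain y where "x = R *\<^sub>R y" "y \<in> ball a (r / R)" by (rule imageE)
    then have y: "x = R *\<^sub>R y" "norm (a - y) < r / R" by (simp_all add: dist_norm)
    have "norm (R *\<^sub>R a - R *\<^sub>R y) = R * norm (a - y)"
      using assms by (metis abs_of_pos norm_scaleR scaleR_diff_right)
    then show "x \<in> ball (R *\<^sub>R a) r" using y assms by (simp add: dist_norm field_simps)
  qed
  then show ?thesis by (auto simp: outer_nbhd_def)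
qed

lemma inner_scaleR:
  assumes "R > 0" shows "inner_nbhd r ((*\<^sub>R) R ` D) = (*\<^sub>R) R ` inner_nbhd (r / R) D"
proof -
  have "bij ((*\<^sub>R) R :: 'a \<Rightarrow> 'a)"
    by (rule o_bij[of "\<lambda>x. x /\<^sub>R R"]) (use assms in \<open>auto simp: fun_eq_iff\<close>)
  then show ?thesis unfolding inner_eq by (simp add: bij_image_Compl_eq[symmetric] outer_scaleR[OF assms])
qed

section \<open>The lattice of pairs (x, \<sigma>(x)) and its tiling\<close>

definition emb :: "complex \<Rightarrow> complex \<times> complex" where
  "emb x = (x, galois_sigma x)"

text \<open>The four real coordinates with respect to the \<open>\<int>\<close>-basis of the lattice \<open>emb ` Z_zeta8\<close>
  obtained from the powers of \<^const>\<open>zeta8\<close>.\<close>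

definition coord :: "nat \<Rightarrow> complex \<times> complex \<Rightarrow> real" where
  "coord i p = (let z = fst p; w = snd p in
     if i = 0 then (Re z + Re w) / 2
     else if i = 1 then (Re z - Re w + (Im z + Im w)) * (sqrt 2 / 4)
     else if i = 2 then (Im z - Im w) / 2
     else (Im z + Im w - (Re z - Re w)) * (sqrt 2 / 4))"

lemma coord_diff: "coord i (p - q) = coord i p - coord i q"
  by (simp add: coord_def Let_def algebra_simps add_divide_distrib diff_divide_distrib)

lemma coord_emb:
  "coord 0 (emb (z8 a b c d)) = of_int a" "coord 1 (emb (z8 a b c d)) = of_int b"
  "coord 2 (emb (z8 a b c d)) = of_int c" "coord 3 (emb (z8 a b c d)) = of_int d"
  by (simp_all add: coord_def emb_def galois_sigma_z8) (simp_all add: z8_def algebra_simps)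

definition cell :: "(complex \<times> complex) set" where
  "cell = {p. \<forall>i<4. 0 \<le> coord i p \<and> coord i p < 1}"

lemma all_less_4: "(\<forall>i<4::nat. P i) \<longleftrightarrow> P 0 \<and> P 1 \<and> P 2 \<and> P 3"
  by (auto simp: numeral_eq_Suc less_Suc_eq)

definition tile :: "complex \<Rightarrow> (complex \<times> complex) set" where
  "tile x = {p. p - emb x \<in> cell}"

definition nearest :: "complex \<times> complex \<Rightarrow> complex" where
  "nearest p = z8 \<lfloor>coord 0 p\<rfloor> \<lfloor>coord 1 p\<rfloor> \<lfloor>coord 2 p\<rfloor> \<lfloor>coord 3 p\<rfloor>"

lemma nearest_in: "nearest p \<in> Z_zeta8"
  by (auto simp: nearest_def Z_zeta8_eq)

text \<open>The cell is half-open, so taking floors of the four coordinates finds the only tile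
  containing p: the tiles partition the space.\<close>

lemma tile_iff:
  assumes "x \<in> Z_zeta8" shows "p \<in> tile x \<longleftrightarrow> x = nearest p"
proof
  obtain a b c d where x: "x = z8 a b c d" using assms by (rule Z_zeta8_E)
  assume "p \<in> tile x"
  then have "\<lfloor>coord 0 p\<rfloor> = a" "\<lfloor>coord 1 p\<rfloor> = b" "\<lfloor>coord 2 p\<rfloor> = c" "\<lfloor>coord 3 p\<rfloor> = d"
    unfolding tile_def cell_def mem_Collect_eq all_less_4 coord_diff x coord_emb by linarith+
  then show "x = nearest p" by (simp add: nearest_def x)
next
  assume "x = nearest p"
  then show "p \<in> tile x"
    unfolding tile_def cell_def mem_Collect_eq all_less_4 coord_diff nearest_def by (simp only: coord_emb) linarith
qed

lemma cell_borel [measurable]: "cell \<in> sets borel"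
proof -
  have "continuous_on UNIV (coord i)" for i
    unfolding coord_def Let_def by (cases "i = 0"; cases "i = 1"; cases "i = 2") (auto intro!: continuous_intros)
  then have [measurable]: "coord i \<in> borel_measurable borel" for i by (rule borel_measurable_continuous_onI)
  have "cell = {p \<in> space borel. \<forall>i\<in>{..<4}. 0 \<le> coord i p \<and> coord i p < 1}" by (auto simp: cell_def)
  also have "\<dots> \<in> sets borel" by measurable
  finally show ?thesis .
qed

text \<open>The factor 1 gives the translate the affine shape to which the formula for Lebesgue
  measure applies.\<close>

lemma tile_eq: "tile x = (\<lambda>p. 1 *\<^sub>R p + emb x) ` cell"
  by (auto simp: tile_def image_iff intro!: bexI[of _ "_ - emb x"])

lemma tile_borel [measurable]: "tile x \<in> sets borel"
proof -
  have "tile x = (\<lambda>p. p - emb x) -` cell \<inter> space borel" by (auto simp: tile_def)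
  also have "\<dots> \<in> sets borel" by (rule measurable_sets[OF _ cell_borel]) auto
  finally show ?thesis .
qed

lemma emeasure_tile: "emeasure lebesgue (tile x) = emeasure lebesgue cell"
  unfolding tile_eq by (subst emeasure_lebesgue_affine) simp

text \<open>The radius 8 is a convenient integer: real parts stay below 3 and imaginary parts below
  4 in absolute value.\<close>

lemma cell_bound:
  assumes "p \<in> cell" shows "norm (fst p) < 8" "norm (snd p) < 8"
proof -
  obtain z w where p: "p = (z, w)" by force
  define a b c d where "a = coord 0 p" and "b = coord 1 p" and "c = coord 2 p" and "d = coord 3 p"
  have abcd: "0 \<le> a" "a < 1" "0 \<le> b" "b < 1" "0 \<le> c" "c < 1" "0 \<le> d" "d < 1"
    using assms by (auto simp: a_def b_def c_def d_def cell_def)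
  have e: "Re z = a + (b - d) * (sqrt 2 / 2)" "Re w = a - (b - d) * (sqrt 2 / 2)"
     "Im z = c + (b + d) * (sqrt 2 / 2)" "Im w = - c + (b + d) * (sqrt 2 / 2)"
    by (simp_all add: a_def b_def c_def d_def coord_def p field_simps)
  have s: "\<bar>sqrt 2 / 2\<bar> \<le> 1" using sqrt2_bounds by simp
  have "\<bar>(b - d) * (sqrt 2 / 2)\<bar> \<le> 1 * 1" "\<bar>(b + d) * (sqrt 2 / 2)\<bar> \<le> 2 * 1"
    unfolding abs_mult by (intro mult_mono s; use abcd in auto)+
  then have "\<bar>Re z\<bar> < 3" "\<bar>Im z\<bar> < 4" "\<bar>Re w\<bar> < 3" "\<bar>Im w\<bar> < 4" using abcd e by linarith+
  then show "norm (fst p) < 8" "norm (snd p) < 8" using cmod_le[of z] cmod_le[of w] by (auto simp: p)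
qed

lemma tile_dist:
  assumes "p \<in> tile x" shows "fst p \<in> ball x 8" "snd p \<in> ball (galois_sigma x) 8"
  using cell_bound[of "p - emb x"] assms by (auto simp: tile_def emb_def dist_norm norm_minus_commute)

lemma cell_lmeasurable: "cell \<in> lmeasurable"
proof (rule bounded_set_imp_lmeasurable)
  show "bounded cell"
  proof (rule bounded_subset)
    show "cell \<subseteq> ball 0 8 \<times> ball 0 8" using cell_bound by (auto simp: mem_Times_iff)
    show "bounded (ball (0::complex) 8 \<times> ball (0::complex) 8)" by (intro bounded_Times) auto
  qed
qed auto

lemma tile_lmeasurable: "tile x \<in> lmeasurable"
  using cell_lmeasurable emeasure_tile[of x] tile_borel[of x] by (auto simp: fmeasurable_def)

text \<open>Only positivity of the covolume is used. It enters every density as the same factor, and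
  the theorem compares densities with each other.\<close>

definition covol :: real where "covol = measure lebesgue cell"

lemma measure_tile: "measure lebesgue (tile x) = covol"
  by (simp add: measure_def emeasure_tile covol_def del: emeasure_completion measure_completion)

lemma countable_Z_zeta8: "countable Z_zeta8"
proof -
  have "Z_zeta8 = (\<lambda>(a, b, c, d). z8 a b c d) ` UNIV" 
    unfolding Z_zeta8_eq by (auto simp: image_iff) blast
  then show ?thesis by (metis countable_image countableI_type)
qed

text \<open>Countably many tiles of equal measure cover the space, so they cannot be null
  sets.\<close>

lemma covol_pos: "covol > 0"
proof (rule ccontr)
  assume "\<not> covol > 0"
  moreover have "covol \<ge> 0" unfolding covol_def by (rule measure_nonneg)
  ultimately have "covol = 0" by simp
  then have "tile x \<in> null_sets lebesgue" for x
    using tile_lmeasurable[of x] measure_tile[of x] negligible_iff_measure negligible_iff_null_sets by metis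
  then have "(\<Union>x\<in>Z_zeta8. tile x) \<in> null_sets lebesgue" using countable_Z_zeta8 by (intro null_sets_UN') auto
  moreover have "(\<Union>x\<in>Z_zeta8. tile x) = UNIV" using tile_iff nearest_in by blast
  ultimately have "emeasure lebesgue (UNIV :: (complex \<times> complex) set) = 0" by (metis null_setsD1)
  then show False by simp
qed

lemma measure_UN_tile:
  assumes "finite S" "S \<subseteq> Z_zeta8"
  shows "measure lebesgue (\<Union>x\<in>S. tile x) = real (card S) * covol"
proof -
  have "measure lebesgue (\<Union>x\<in>S. tile x) = (\<Sum>x\<in>S. measure lebesgue (tile x))"
  proof (rule measure_UNION_AE[OF assms(1)])
    show "\<And>x. x \<in> S \<Longrightarrow> tile x \<in> lmeasurable" by (rule tile_lmeasurable)
    have "tile x \<inter> tile y = {}" if "x \<in> S" "y \<in> S" "x \<noteq> y" for x y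
    proof -
      have "x \<in> Z_zeta8" "y \<in> Z_zeta8" using that assms(2) by auto
      then show ?thesis using tile_iff[of x] tile_iff[of y] \<open>x \<noteq> y\<close> by auto
    qed
    then show "pairwise (\<lambda>x y. AE z in lebesgue. z \<notin> tile x \<or> z \<notin> tile y) S"
      by (auto simp: pairwise_def)
  qed
  then show ?thesis by (simp add: measure_tile)
qed

lemma measure_Times_complex:
  fixes U V :: "complex set"
  assumes "U \<in> sets borel" "V \<in> sets borel" "U \<in> lmeasurable" "V \<in> lmeasurable"
  shows "U \<times> V \<in> lmeasurable" "measure lebesgue (U \<times> V) = measure lebesgue U * measure lebesgue V"
proof -
  have UV: "U \<times> V \<in> sets borel" using assms by (metis sets_lborel lborel_prod pair_measureI)
  have "emeasure lborel (U \<times> V) = emeasure lborel U * emeasure lborel V"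
    using assms by (metis lborel.emeasure_pair_measure_Times lborel_prod sets_lborel)
  moreover have "emeasure lborel U < \<infinity>" "emeasure lborel V < \<infinity>" using assms by (auto simp: fmeasurable_def)
  ultimately show "U \<times> V \<in> lmeasurable" "measure lebesgue (U \<times> V) = measure lebesgue U * measure lebesgue V"
    using assms UV by (auto simp: fmeasurable_def measure_def enn2real_mult ennreal_mult_less_top)
qed

section \<open>Lattice points in products of plane sets\<close>

definition lattice_points :: "complex set \<Rightarrow> complex set \<Rightarrow> complex set" where
  "lattice_points A B = {x \<in> Z_zeta8. x \<in> A \<and> galois_sigma x \<in> B}"

text \<open>The tiles of the counted points are disjoint, of equal volume, and contained in the
  thickened product. The estimate is derived for finite subsets, since finiteness of the whole set
  is itself a consequence of it.\<close>

lemma lattice_points_upper: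
  assumes "bounded A" "bounded B"
  shows "finite (lattice_points A B)"
    and "real (card (lattice_points A B)) * covol \<le> measure lebesgue (outer_nbhd 8 A) * measure lebesgue (outer_nbhd 8 B)"
proof -
  let ?M = "measure lebesgue (outer_nbhd 8 A) * measure lebesgue (outer_nbhd 8 B)"
  have *: "real (card S) * covol \<le> ?M" if "finite S" "S \<subseteq> lattice_points A B" for S
  proof -
    have S: "S \<subseteq> Z_zeta8" using that by (auto simp: lattice_points_def)
    note m = measure_Times_complex[OF borel_open[OF open_outer] borel_open[OF open_outer]
        lmeasurable_outer[OF assms(1)] lmeasurable_outer[OF assms(2)], of 8 8]
    have "(\<Union>x\<in>S. tile x) \<subseteq> outer_nbhd 8 A \<times> outer_nbhd 8 B"
      using tile_dist that(2) by (fastforce simp: outer_nbhd_def lattice_points_def mem_Times_iff)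
    moreover have "(\<Union>x\<in>S. tile x) \<in> sets lebesgue"
      using tile_lmeasurable that(1) by (intro sets.finite_UN) auto
    ultimately have "measure lebesgue (\<Union>x\<in>S. tile x) \<le> measure lebesgue (outer_nbhd 8 A \<times> outer_nbhd 8 B)"
      using m by (intro measure_mono_fmeasurable) auto
    then show ?thesis using measure_UN_tile[OF that(1) S] m by simp
  qed
  show "finite (lattice_points A B)"
  proof (rule ccontr)
    assume inf: "infinite (lattice_points A B)"
    obtain S where S: "S \<subseteq> lattice_points A B" "finite S" "card S = nat \<lceil>?M / covol\<rceil> + 1"
      using infinite_arbitrarily_large[OF inf] by metis
    then have "real (card S) > ?M / covol" by linarith
    then have "real (card S) * covol > ?M" using covol_pos by (simp add: field_simps)
    then show False using *[OF S(2,1)] by simp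
  qed
  then show "real (card (lattice_points A B)) * covol \<le> ?M" using * by blast
qed

text \<open>A point of the shrunken product lies in the tile of a lattice point that is less than 8
  away in both components; that lattice point is therefore among those counted.\<close>

lemma lattice_points_lower:
  assumes "bounded A" "bounded B"
  shows "measure lebesgue (inner_nbhd 8 A) * measure lebesgue (inner_nbhd 8 B) \<le> real (card (lattice_points A B)) * covol"
proof -
  let ?S = "lattice_points A B"
  have fin: "finite ?S" "?S \<subseteq> Z_zeta8" using lattice_points_upper(1)[OF assms] by (auto simp: lattice_points_def)
  have "(8::real) > 0" by simp
  note m = measure_Times_complex[OF borel_closed[OF closed_inner] borel_closed[OF closed_inner]
      lmeasurable_inner[OF assms(1) this] lmeasurable_inner[OF assms(2) this]]
  have "inner_nbhd 8 A \<times> inner_nbhd 8 B \<subseteq> (\<Union>x\<in>?S. tile x)"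
  proof
    fix p assume p: "p \<in> inner_nbhd 8 A \<times> inner_nbhd 8 B"
    have t: "p \<in> tile (nearest p)" using tile_iff nearest_in by blast
    then have "nearest p \<in> ball (fst p) 8" "galois_sigma (nearest p) \<in> ball (snd p) 8"
      using tile_dist[OF t] by (auto simp: dist_commute)
    then have "nearest p \<in> ?S" using p nearest_in by (auto simp: lattice_points_def inner_nbhd_def mem_Times_iff)
    then show "p \<in> (\<Union>x\<in>?S. tile x)" using t by blast
  qed
  moreover have "(\<Union>x\<in>?S. tile x) \<in> lmeasurable"
    using tile_lmeasurable fin(1) by (intro fmeasurable.finite_UN) auto
  ultimately have "measure lebesgue (inner_nbhd 8 A \<times> inner_nbhd 8 B) \<le> measure lebesgue (\<Union>x\<in>?S. tile x)"
    using m by (intro measure_mono_fmeasurable) auto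
  then show ?thesis using measure_UN_tile[OF fin] m by simp
qed

text \<open>After rescaling, the boundary layers have thickness 8/R1 and 8/R2, so both radii must
  grow. They may do so at different rates, which leaves the choice of the balancing unit
  free.\<close>

lemma lattice_points_tendsto:
  fixes R1 R2 :: "'t \<Rightarrow> real"
  assumes D: "jordan_measurable D" and V: "jordan_measurable V"
    and R: "filterlim R1 at_top F" "filterlim R2 at_top F"
  shows "((\<lambda>t. real (card (lattice_points ((*\<^sub>R) (R1 t) ` D) ((*\<^sub>R) (R2 t) ` V))) / ((R1 t)\<^sup>2 * (R2 t)\<^sup>2))
     \<longlongrightarrow> measure lebesgue D * measure lebesgue V / covol) F"
proof (rule tendsto_sandwich)
  have b: "bounded D" "bounded V" using D V by (auto simp: jordan_measurable_def)
  have sc: "filterlim (\<lambda>t. 8 / R t) (at_right 0) F" if "filterlim R at_top F" for R :: "'t \<Rightarrow> real"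
  proof -
    have "filterlim (\<lambda>t. inverse (R t * (1/8))) (at_right 0) F"
      by (rule filterlim_compose[OF filterlim_inverse_at_right_top])
         (rule filterlim_tendsto_pos_mult_at_top[of "\<lambda>_. 1/8", unfolded mult.commute[of "1/8"], OF tendsto_const _ that], simp)
    then show ?thesis by (simp add: field_simps)
  qed
  have pos: "eventually (\<lambda>t. R1 t > 0 \<and> R2 t > 0) F"
    using R filterlim_at_top_dense by (metis eventually_conj)
  show "((\<lambda>t. measure lebesgue (inner_nbhd (8 / R1 t) D) * measure lebesgue (inner_nbhd (8 / R2 t) V) / covol) \<longlongrightarrow>
      measure lebesgue D * measure lebesgue V / covol) F"
    by (intro tendsto_divide tendsto_mult tendsto_const filterlim_compose[OF tendsto_measure_inner[OF D] sc[OF R(1)]]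
        filterlim_compose[OF tendsto_measure_inner[OF V] sc[OF R(2)]]) (use covol_pos in auto)
  show "((\<lambda>t. measure lebesgue (outer_nbhd (8 / R1 t) D) * measure lebesgue (outer_nbhd (8 / R2 t) V) / covol) \<longlongrightarrow>
      measure lebesgue D * measure lebesgue V / covol) F"
    by (intro tendsto_divide tendsto_mult tendsto_const filterlim_compose[OF tendsto_measure_outer[OF D] sc[OF R(1)]]
        filterlim_compose[OF tendsto_measure_outer[OF V] sc[OF R(2)]]) (use covol_pos in auto)
  show "eventually (\<lambda>t. measure lebesgue (inner_nbhd (8 / R1 t) D) * measure lebesgue (inner_nbhd (8 / R2 t) V) / covol \<le>
     real (card (lattice_points ((*\<^sub>R) (R1 t) ` D) ((*\<^sub>R) (R2 t) ` V))) / ((R1 t)\<^sup>2 * (R2 t)\<^sup>2)) F"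
    using pos
  proof eventually_elim
    case (elim t)
    have "(R1 t)\<^sup>2 * measure lebesgue (inner_nbhd (8 / R1 t) D) * ((R2 t)\<^sup>2 * measure lebesgue (inner_nbhd (8 / R2 t) V))
      \<le> real (card (lattice_points ((*\<^sub>R) (R1 t) ` D) ((*\<^sub>R) (R2 t) ` V))) * covol"
      using lattice_points_lower[of "(*\<^sub>R) (R1 t) ` D" "(*\<^sub>R) (R2 t) ` V"] b elim
      by (simp add: inner_scaleR measure_scaleR_image bounded_scaling)
    then show ?case using elim covol_pos by (simp add: field_simps)
  qed
  show "eventually (\<lambda>t. real (card (lattice_points ((*\<^sub>R) (R1 t) ` D) ((*\<^sub>R) (R2 t) ` V))) / ((R1 t)\<^sup>2 * (R2 t)\<^sup>2)
     \<le> measure lebesgue (outer_nbhd (8 / R1 t) D) * measure lebesgue (outer_nbhd (8 / R2 t) V) / covol) F"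
    using pos
  proof eventually_elim
    case (elim t)
    have "real (card (lattice_points ((*\<^sub>R) (R1 t) ` D) ((*\<^sub>R) (R2 t) ` V))) * covol
      \<le> (R1 t)\<^sup>2 * measure lebesgue (outer_nbhd (8 / R1 t) D) * ((R2 t)\<^sup>2 * measure lebesgue (outer_nbhd (8 / R2 t) V))"
      using lattice_points_upper(2)[of "(*\<^sub>R) (R1 t) ` D" "(*\<^sub>R) (R2 t) ` V"] b elim
      by (simp add: outer_scaleR measure_scaleR_image bounded_scaling)
    then show ?case using elim covol_pos by (simp add: field_simps)
  qed
qed


section \<open>The Euler product and the zeta function\<close>

text \<open>The term of \<zeta>_K(2) belonging to b, and also the proportion of points divisible by
  b: \<int>[\<zeta>] has rank 2 over \<open>O_K\<close>, so its multiples of b have index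
  N(b)^2.\<close>

definition weight :: "real \<Rightarrow> real" where
  "weight b = 1 / (of_int (norm_K b))\<^sup>2"

lemma weight_nonneg: "0 \<le> weight b"
  by (simp add: weight_def)

lemma weight_mult: "x \<in> O_K \<Longrightarrow> y \<in> O_K \<Longrightarrow> weight (x * y) = weight x * weight y"
  by (simp add: weight_def norm_K_mult power_mult_distrib)

lemma weight_1 [simp]: "weight 1 = 1"
  by (simp add: weight_def)

lemma weight_unit: "u \<in> O_K \<Longrightarrow> v \<in> O_K \<Longrightarrow> u * v = 1 \<Longrightarrow> weight u = 1"
  using norm_K_eq_1I by (simp add: weight_def)

lemma weight_eq: "b \<in> O_K \<Longrightarrow> weight b = 1 / (b * conj_K b)\<^sup>2"
  by (simp add: weight_def of_int_norm_K)

text \<open>The maximum with 1 gives n = 0 the term 1, where 1/0 = 0 would be useless as a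
  majorant.\<close>

lemma summable_on_int_squares: "(\<lambda>n::int. 1 / (max 1 \<bar>of_int n\<bar>)\<^sup>2 :: real) summable_on UNIV"
proof -
  let ?g = "\<lambda>n::int. 1 / (max 1 \<bar>of_int n\<bar>)\<^sup>2 :: real"
  have "summable (\<lambda>n::nat. 1 / (max 1 (real n))\<^sup>2)"
  proof (rule summable_comparison_test_ev)
    show "summable (\<lambda>n. inverse (real n ^ 2))" by (rule inverse_power_summable) simp
    show "eventually (\<lambda>n. norm (1 / (max 1 (real n))\<^sup>2) \<le> inverse (real n ^ 2)) sequentially"
      using eventually_ge_at_top[of 1] by eventually_elim (simp add: max_def divide_inverse)
  qed
  then have *: "(\<lambda>n::nat. 1 / (max 1 (real n))\<^sup>2) summable_on UNIV"
    by (intro norm_summable_imp_summable_on) simp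
  have "?g summable_on range int" "?g summable_on range (\<lambda>n. - int n)"
    by (subst summable_on_reindex; use * in \<open>simp add: o_def inj_on_def\<close>)+
  then have "?g summable_on (range int \<union> range (\<lambda>n. - int n))" by (rule summable_on_union)
  moreover have "range int \<union> range (\<lambda>n. - int n) = UNIV"
    by (auto simp: image_iff) (metis int_cases2)
  ultimately show ?thesis by simp
qed

text \<open>Write b = m + n \<surd>2. As b lies in an interval of length \<surd>2, each n leaves
  only boundedly many m. Moreover |n| is at most N(b), because b \<ge> 1 and the conjugate b - 2 n
  \<surd>2 exceeds |n| in size once |n| \<ge> 2. So three copies of the sum over inverse squares of
  n dominate.\<close>

lemma weight_summable: "weight summable_on O_K_reps"
proof -
  define n where "n = (\<lambda>b. SOME n. \<exists>m. b = of_int m + of_int n * sqrt 2)"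
  have n: "\<exists>m. b = of_int m + of_int (n b) * sqrt 2" if b: "b \<in> O_K" for b
    unfolding n_def by (rule someI_ex) (use O_K_E[OF b] in metis)
  \<comment> \<open>The index of m counted from the least integer that makes b at least 1; together
    with n it determines b.\<close>
  define j where "j = (\<lambda>b. \<lfloor>b - of_int (n b) * sqrt 2\<rfloor> - \<lceil>1 - of_int (n b) * sqrt 2\<rceil>)"
  let ?g = "\<lambda>(n::int, j::int). 1 / (max 1 \<bar>of_int n\<bar>)\<^sup>2 :: real"
  have m: "b = of_int \<lfloor>b - of_int (n b) * sqrt 2\<rfloor> + of_int (n b) * sqrt 2" if "b \<in> O_K" for b
    using n[OF that] by (metis add_diff_cancel_right' floor_of_int)
  have "?g summable_on UNIV \<times> {0..2}"
  proof (rule summable_on_SigmaI)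
    show "((\<lambda>y. ?g (x, y)) has_sum 3 * (1 / (max 1 \<bar>of_int x\<bar>)\<^sup>2)) {0..2}" for x
      by (rule has_sum_finiteI) auto
    show "(\<lambda>x::int. 3 * (1 / (max 1 \<bar>of_int x\<bar>)\<^sup>2) :: real) summable_on UNIV"
      by (intro summable_on_cmult_right summable_on_int_squares)
  qed auto
  moreover have "(\<lambda>b. (n b, j b)) ` O_K_reps \<subseteq> UNIV \<times> {0..2}"
  proof safe
    fix b assume "b \<in> O_K_reps"
    then have b: "b \<in> O_K" "1 \<le> b" "b < 1 + sqrt 2" by (auto simp: O_K_reps_def fund_unit_def)
    have "real_of_int \<lfloor>b - of_int (n b) * sqrt 2\<rfloor> = b - of_int (n b) * sqrt 2" using m[OF b(1)] by linarith
    then show "j b \<in> {0..2}" using b sqrt2_bounds unfolding j_def atLeastAtMost_iff by linarith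
  qed simp
  ultimately have "?g summable_on (\<lambda>b. (n b, j b)) ` O_K_reps" by (rule summable_on_subset_banach)
  moreover have "inj_on (\<lambda>b. (n b, j b)) O_K_reps"
  proof (rule inj_onI)
    fix b c assume bc: "b \<in> O_K_reps" "c \<in> O_K_reps" "(n b, j b) = (n c, j c)"
    then have "\<lfloor>b - of_int (n b) * sqrt 2\<rfloor> = \<lfloor>c - of_int (n c) * sqrt 2\<rfloor>" by (auto simp: j_def)
    then show "b = c" using m[of b] m[of c] bc by (auto simp: O_K_reps_def)
  qed
  ultimately have "(?g \<circ> (\<lambda>b. (n b, j b))) summable_on O_K_reps" by (subst (asm) summable_on_reindex)
  then show ?thesis
  proof (rule summable_on_comparison_test)
    fix b assume "b \<in> O_K_reps"
    then have b: "b \<in> O_K" "1 \<le> b" "b < 1 + sqrt 2" by (auto simp: O_K_reps_def fund_unit_def)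
    obtain k where k: "b = of_int k + of_int (n b) * sqrt 2" using n[OF b(1)] by blast
    define t where "t = of_int (n b) * sqrt 2"
    have cj: "conj_K b = b - 2 * t" using conj_K_eq[of k "n b"] k by (simp add: t_def)
    have "real_of_int \<bar>n b\<bar> \<le> of_int (norm_K b)"
    proof (cases "\<bar>n b\<bar> \<le> 1")
      case True
      moreover have "1 \<le> norm_K b" using norm_K_ge_1 b by auto
      ultimately show ?thesis by simp
    next
      case False
      define N where "N = real_of_int \<bar>n b\<bar>"
      have N: "2 \<le> N" using False unfolding N_def by linarith
      have "\<bar>t\<bar> = N * sqrt 2" by (simp add: t_def abs_mult N_def)
      moreover have "N * 1.4 \<le> N * sqrt 2" using sqrt2_bounds N by (intro mult_left_mono) auto
      ultimately have t: "1.4 * N \<le> \<bar>t\<bar>" by simp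
      have "2 * \<bar>t\<bar> - b \<le> \<bar>b - 2 * t\<bar>" using b(2) by (auto simp: abs_if)
      then have "N \<le> \<bar>conj_K b\<bar>" using N t b(3) sqrt2_bounds(2) unfolding cj by linarith
      then have "real_of_int \<bar>n b\<bar> \<le> \<bar>conj_K b\<bar>" by (simp add: N_def)
      also have "1 * \<bar>conj_K b\<bar> \<le> b * \<bar>conj_K b\<bar>" using b(2) by (intro mult_right_mono) auto
      then have "\<bar>conj_K b\<bar> \<le> b * \<bar>conj_K b\<bar>" by simp
      also have "\<dots> = of_int (norm_K b)" using of_int_norm_K b by (simp add: abs_mult)
      finally show ?thesis .
    qed
    moreover have "1 \<le> real_of_int (norm_K b)" using norm_K_ge_1[of b] b by auto
    ultimately show "weight b \<le> (?g \<circ> (\<lambda>b. (n b, j b))) b"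
    proof -
      assume *: "real_of_int \<bar>n b\<bar> \<le> of_int (norm_K b)" "1 \<le> real_of_int (norm_K b)"
      have "(max 1 \<bar>of_int (n b)\<bar>)\<^sup>2 \<le> (real_of_int (norm_K b))\<^sup>2"
        using * by (intro power_mono) auto
      moreover have "0 < (max 1 \<bar>real_of_int (n b)\<bar>)\<^sup>2" by (intro zero_less_power) simp
      ultimately have "1 / (real_of_int (norm_K b))\<^sup>2 \<le> 1 / (max 1 \<bar>real_of_int (n b)\<bar>)\<^sup>2"
        by (rule frac_le[OF zero_le_one order_refl, rotated])
      then show ?thesis by (simp add: weight_def)
    qed
  qed (simp add: weight_nonneg)
qed

section \<open>The Euler product by sieving one prime at a time\<close>

definition zeta_K_2 :: real where
  "zeta_K_2 = infsum weight O_K_reps"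

definition coprime_reps :: "real set \<Rightarrow> real set" where
  "coprime_reps F = {b \<in> O_K_reps. \<forall>p\<in>F. b / p \<notin> O_K}"

lemma coprime_reps_summable: "weight summable_on coprime_reps F"
  by (rule summable_on_subset_banach[OF weight_summable]) (auto simp: coprime_reps_def)

lemma prime_reps_D: "p \<in> prime_reps \<Longrightarrow> p \<in> O_K \<and> 1 < p \<and> p < fund_unit"
  by (auto simp: prime_reps_def)

lemma inverse_prime_reps: "p \<in> prime_reps \<Longrightarrow> inverse p \<notin> O_K"
  using O_K_ring_prime_iff[of p] by (auto simp: prime_reps_def)

lemma prime_reps_not_divides:
  assumes "p \<in> prime_reps" "q \<in> prime_reps" "p \<noteq> q" shows "p / q \<notin> O_K"
proof
  assume *: "p / q \<in> O_K"
  obtain u v where "u \<in> O_K" "v \<in> O_K" "u * p + v * q = 1" using prime_reps_bezout assms by metis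
  then have uv: "u \<in> O_K" "v \<in> O_K" "u * p + v * q = 1" by auto
  have "q > 0" using prime_reps_D[OF assms(2)] by simp
  then have "u * (p / q) + v = (u * p + v * q) / q" by (simp add: field_simps)
  then have "inverse q = u * (p / q) + v" using uv by (simp add: divide_inverse)
  moreover have "u * (p / q) + v \<in> O_K" using uv * by blast
  ultimately show False using inverse_prime_reps assms by metis
qed

lemma weight_fund_unit:
  assumes "x \<in> O_K" shows "weight (x / fund_unit) = weight x"
proof -
  have "inverse fund_unit * fund_unit = 1" using fund_unit_bounds by (intro left_inverse) auto
  then have "weight (inverse fund_unit) = 1" by (intro weight_unit[of _ fund_unit]) auto
  then show ?thesis using weight_mult[OF assms inverse_fund_unit_O_K] by (simp only: divide_inverse)
qed

text \<open>Multiplication by p, corrected by a unit, maps the representatives prime to F onto those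
  that are in addition divisible by p. It multiplies each weight by \<open>weight p\<close>, so
  removing its image costs exactly this proportion.\<close>

lemma coprime_reps_insert:
  assumes F: "F \<subseteq> prime_reps" and p: "p \<in> prime_reps" "p \<notin> F"
  shows "infsum weight (coprime_reps (insert p F)) = (1 - weight p) * infsum weight (coprime_reps F)"
proof -
  define A where "A = {b \<in> coprime_reps F. b / p \<in> O_K}"
  \<comment> \<open>The product p c lies below the square of \<open>fund_unit\<close>, so at most
    one division by it is needed to return to \<open>O_K_reps\<close>.\<close>
  define h where "h = (\<lambda>c. if p * c < fund_unit then p * c else p * c / fund_unit)"
  have l: "fund_unit > 1" using fund_unit_bounds by simp
  have pp: "p \<in> O_K" "1 < p" "p < fund_unit" using prime_reps_D p by auto
  have h_unit: "\<exists>u. u \<in> O_K \<and> inverse u \<in> O_K \<and> u \<noteq> 0 \<and> h c = u * (p * c)" for c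
    using l by (auto simp: h_def divide_inverse intro: exI[of _ 1] exI[of _ "inverse fund_unit"])
  have "bij_betw h (coprime_reps F) A"
  proof (rule bij_betwI[where g = "\<lambda>b. if 1 \<le> b / p then b / p else fund_unit * b / p"])
    show "h \<in> coprime_reps F \<rightarrow> A"
    proof
      fix c assume c: "c \<in> coprime_reps F"
      then have cO: "c \<in> O_K" "1 \<le> c" "c < fund_unit" by (auto simp: coprime_reps_def O_K_reps_def)
      obtain u where u: "u \<in> O_K" "inverse u \<in> O_K" "u \<noteq> 0" "h c = u * (p * c)" using h_unit by metis
      have "h c \<in> O_K_reps"
      proof -
        have "h c \<in> O_K" using u pp cO by auto
        moreover have "1 * 1 \<le> p * c" using pp cO by (intro mult_mono) auto
        moreover have "p * c < fund_unit * fund_unit" using pp cO by (intro mult_strict_mono) auto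
        ultimately show ?thesis using l by (auto simp: O_K_reps_def h_def pos_divide_less_eq le_divide_eq_1_pos)
      qed
      moreover have "h c / q \<notin> O_K" if q: "q \<in> F" for q
      proof
        assume "h c / q \<in> O_K"
        then have "inverse u * (h c / q) \<in> O_K" using u by blast
        moreover have "inverse u * h c = p * c" unfolding u(4) using u(3) by (metis mult.assoc left_inverse mult_1)
        then have "inverse u * (h c / q) = p * c / q" by (metis times_divide_eq_right)
        ultimately have "p * c / q \<in> O_K" by metis
        then have "p / q \<in> O_K \<or> c / q \<in> O_K" using prime_reps_prime[of q p c] F q pp cO by blast
        then show False using c q prime_reps_not_divides[of p q] p F by (auto simp: coprime_reps_def)
      qed
      moreover have "h c / p \<in> O_K" using u pp cO by auto
      ultimately show "h c \<in> A" by (auto simp: A_def coprime_reps_def)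
    qed
    show "(\<lambda>b. if 1 \<le> b / p then b / p else fund_unit * b / p) \<in> A \<rightarrow> coprime_reps F"
    proof
      fix b assume b: "b \<in> A"
      then have bO: "b \<in> O_K" "1 \<le> b" "b < fund_unit" "b / p \<in> O_K" by (auto simp: A_def coprime_reps_def O_K_reps_def)
      define c where "c = (if 1 \<le> b / p then b / p else fund_unit * b / p)"
      obtain u where u: "u \<in> O_K" "inverse u \<in> O_K" "u \<noteq> 0" "c = u * (b / p)"
      proof (cases "1 \<le> b / p")
        case True
        then show ?thesis using that[of 1] by (simp add: c_def)
      next
        case False
        then show ?thesis using that[of fund_unit] l by (simp add: c_def)
      qed
      have "c \<in> O_K" using u bO by blast
      moreover have "1 \<le> c" "c < fund_unit"
      proof -
        have "fund_unit * 1 \<le> fund_unit * b" using bO l by (intro mult_left_mono) auto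
        then have *: "p \<le> fund_unit * b" using pp by linarith
        have "fund_unit * 1 < fund_unit * p" using pp l by (intro mult_strict_left_mono) auto
        then have **: "b < fund_unit * p" using bO by linarith
        show "1 \<le> c" "c < fund_unit" using * ** l pp
          by (auto simp: c_def pos_divide_less_eq le_divide_eq_1_pos)
      qed
      moreover have "c / q \<notin> O_K" if q: "q \<in> F" for q
      proof
        assume "c / q \<in> O_K"
        then have "p * (inverse u * (c / q)) \<in> O_K" using u pp by blast
        moreover have "inverse u * c = b / p" unfolding u(4) using u(3) by (metis mult.assoc left_inverse mult_1)
        then have "p * (inverse u * (c / q)) = b / q" using pp
          by (metis less_numeral_extra(1) less_trans nonzero_mult_div_cancel_left order_less_irrefl times_divide_eq_right)
        ultimately have "b / q \<in> O_K" by metis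
        then show False using b q by (auto simp: A_def coprime_reps_def)
      qed
      ultimately show "(if 1 \<le> b / p then b / p else fund_unit * b / p) \<in> coprime_reps F"
        unfolding c_def[symmetric] by (simp add: coprime_reps_def O_K_reps_def)
    qed
    show "(if 1 \<le> h c / p then h c / p else fund_unit * h c / p) = c" if "c \<in> coprime_reps F" for c
    proof (cases "p * c < fund_unit")
      case True
      then show ?thesis using that pp by (simp add: h_def coprime_reps_def O_K_reps_def)
    next
      case False
      then have "h c / p = c / fund_unit" using pp l by (simp add: h_def)
      moreover from this have "fund_unit * h c / p = c" using l by (metis less_numeral_extra(1) less_trans nonzero_mult_div_cancel_left order_less_irrefl times_divide_eq_right)
      ultimately show ?thesis using that l by (simp add: coprime_reps_def O_K_reps_def le_divide_eq_1_pos)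
    qed
    show "h (if 1 \<le> b / p then b / p else fund_unit * b / p) = b" if "b \<in> A" for b
    proof (cases "1 \<le> b / p")
      case True
      then show ?thesis using that pp by (simp add: h_def A_def coprime_reps_def O_K_reps_def)
    next
      case False
      have "1 \<le> b" using that by (simp add: A_def coprime_reps_def O_K_reps_def)
      then have "\<not> fund_unit * b < fund_unit" using l by simp
      then show ?thesis using False pp l by (simp add: h_def)
    qed
  qed
  then have "infsum weight A = infsum (\<lambda>c. weight (h c)) (coprime_reps F)"
    by (rule infsum_reindex_bij_betw[symmetric])
  also have "\<dots> = infsum (\<lambda>c. weight p * weight c) (coprime_reps F)"
  proof (rule infsum_cong)
    fix c assume "c \<in> coprime_reps F"
    then have "c \<in> O_K" by (auto simp: coprime_reps_def O_K_reps_def)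
    then show "weight (h c) = weight p * weight c" using pp weight_fund_unit[of "p * c"] weight_mult[of p c]
      by (auto simp: h_def)
  qed
  also have "\<dots> = weight p * infsum weight (coprime_reps F)" by (rule infsum_cmult_right')
  finally have A: "infsum weight A = weight p * infsum weight (coprime_reps F)" .
  have "infsum weight (coprime_reps (insert p F) \<union> A) = infsum weight (coprime_reps (insert p F)) + infsum weight A"
  proof (rule infsum_Un_disjoint)
    show "weight summable_on A"
      by (rule summable_on_subset_banach[OF coprime_reps_summable[of F]]) (auto simp: A_def)
    show "weight summable_on coprime_reps (insert p F)" by (rule coprime_reps_summable)
  qed (auto simp: A_def coprime_reps_def)
  moreover have "coprime_reps (insert p F) \<union> A = coprime_reps F" by (auto simp: A_def coprime_reps_def)
  ultimately show ?thesis using A by (simp add: algebra_simps)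
qed

lemma coprime_reps_infsum:
  assumes "finite F" "F \<subseteq> prime_reps"
  shows "infsum weight (coprime_reps F) = (\<Prod>p\<in>F. 1 - weight p) * zeta_K_2"
  using assms
proof (induction F)
  case empty
  then show ?case by (simp add: coprime_reps_def zeta_K_2_def)
next
  case (insert p F)
  then show ?case using coprime_reps_insert[of F p] by simp
qed

lemma one_in_O_K_reps: "1 \<in> O_K_reps"
  using fund_unit_bounds by (simp add: O_K_reps_def)

lemma zeta_K_2_ge_1: "1 \<le> zeta_K_2"
proof -
  have "sum weight {1} \<le> zeta_K_2" unfolding zeta_K_2_def
    by (rule finite_sum_le_infsum[OF weight_summable]) (auto simp: one_in_O_K_reps weight_nonneg)
  then show ?thesis by simp
qed

text \<open>Take a finite S carrying almost all of the sum, and let F contain a prime divisor of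
  each element of S other than 1. What survives the sieve besides 1 then avoids S and has small
  total weight.\<close>

lemma coprime_reps_tendsto: "((\<lambda>F. infsum weight (coprime_reps F)) \<longlongrightarrow> 1) (finite_subsets_at_top prime_reps)"
proof (rule tendstoI)
  fix e :: real assume e: "e > 0"
  have "(sum weight \<longlongrightarrow> zeta_K_2) (finite_subsets_at_top O_K_reps)"
    unfolding zeta_K_2_def has_sum_def[symmetric] using weight_summable by (rule has_sum_infsum)
  then have "eventually (\<lambda>S. dist (sum weight S) zeta_K_2 < e) (finite_subsets_at_top O_K_reps)"
    using e by (rule tendstoD)
  then obtain S where S: "finite S" "S \<subseteq> O_K_reps" "dist (sum weight S) zeta_K_2 < e"
    unfolding eventually_finite_subsets_at_top by blast
  have "\<exists>p. p \<in> prime_reps \<and> b / p \<in> O_K" if "b \<in> S - {1}" for b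
  proof -
    have b: "b \<in> O_K" "1 < b" "b < fund_unit" using that S by (auto simp: O_K_reps_def)
    then have "inverse b \<notin> O_K" using norm_K_gt_1[OF b] norm_K_eq_1I[of b "inverse b"] by auto
    then show ?thesis using exists_prime_divisor[of b] b by (metis not_one_less_zero)
  qed
  then obtain pr where pr: "\<And>b. b \<in> S - {1} \<Longrightarrow> pr b \<in> prime_reps \<and> b / pr b \<in> O_K" by metis
  have "dist (infsum weight (coprime_reps F)) 1 < e" if F: "F \<subseteq> prime_reps" "pr ` (S - {1}) \<subseteq> F" for F
  proof -
    have sub: "coprime_reps F - {1} \<subseteq> O_K_reps - S" using pr F by (auto simp: coprime_reps_def)
    have one: "1 \<in> coprime_reps F" using F inverse_prime_reps by (auto simp: coprime_reps_def one_in_O_K_reps field_simps)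
    then have "infsum weight (coprime_reps F) = 1 + infsum weight (coprime_reps F - {1})"
      using infsum_Un_disjoint[of weight "{1}" "coprime_reps F - {1}"] coprime_reps_summable[of F]
      by (simp add: summable_on_Diff insert_absorb summable_on_subset_banach)
    moreover have "infsum weight (coprime_reps F - {1}) \<le> infsum weight (O_K_reps - S)"
      by (intro infsum_mono_neutral) (use sub in \<open>auto intro: summable_on_subset_banach[OF weight_summable] 
           summable_on_subset_banach[OF coprime_reps_summable] weight_nonneg\<close>)
    moreover have "infsum weight (O_K_reps - S) = zeta_K_2 - sum weight S"
      unfolding zeta_K_2_def using S weight_summable by (subst infsum_Diff) auto
    moreover have "infsum weight (coprime_reps F - {1}) \<ge> 0" by (rule infsum_nonneg) (rule weight_nonneg)
    ultimately show ?thesis using S(3) by (simp add: dist_real_def)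
  qed
  then show "eventually (\<lambda>F. dist (infsum weight (coprime_reps F)) 1 < e) (finite_subsets_at_top prime_reps)"
    unfolding eventually_finite_subsets_at_top using S(1) pr by (intro exI[of _ "pr ` (S - {1})"]) auto
qed

lemma euler_product: "((\<lambda>F. \<Prod>p\<in>F. 1 - weight p) \<longlongrightarrow> 1 / zeta_K_2) (finite_subsets_at_top prime_reps)"
proof -
  have "((\<lambda>F. infsum weight (coprime_reps F) / zeta_K_2) \<longlongrightarrow> 1 / zeta_K_2) (finite_subsets_at_top prime_reps)"
    using zeta_K_2_ge_1 by (intro tendsto_divide coprime_reps_tendsto) auto
  moreover have "eventually (\<lambda>F. infsum weight (coprime_reps F) / zeta_K_2 = (\<Prod>p\<in>F. 1 - weight p)) (finite_subsets_at_top prime_reps)"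
    by (rule eventually_finite_subsets_at_top_weakI) (use zeta_K_2_ge_1 coprime_reps_infsum in auto)
  ultimately show ?thesis by (rule Lim_transform_eventually)
qed


section \<open>Ideals, their norms and the Dedekind zeta function\<close>

lemma O_K_unique:
  assumes "of_int a + of_int b * sqrt 2 = of_int c + of_int d * sqrt 2"
  shows "a = c \<and> b = d"
  using rat_sqrt2_unique[of "of_int a" "of_int b" "of_int c" "of_int d"] assms by auto

lemma cring_O_K: "cring (ring_on O_K)"
  by (rule cring_ring_on) auto

lemma ideal_O_K_iff: "ideal I (ring_on O_K) \<longleftrightarrow> O_K_ideal I"
proof
  assume "ideal I (ring_on O_K)"
  then interpret I: ideal I "ring_on O_K" .
  show "O_K_ideal I" unfolding O_K_ideal_def
    using I.a_subset additive_subgroup.zero_closed[OF I.additive_subgroup_axioms]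
      additive_subgroup.a_closed[OF I.additive_subgroup_axioms] I.I_l_closed by auto
next
  assume I: "O_K_ideal I"
  interpret cring "ring_on O_K" by (rule cring_O_K)
  have inv: "\<ominus>\<^bsub>ring_on O_K\<^esub> x = - x" if "x \<in> O_K" for x
    by (rule minus_equality) (use that in auto)
  show "ideal I (ring_on O_K)"
  proof (rule idealI)
    show "ring (ring_on O_K)" by (rule ring_axioms)
    show "subgroup I (add_monoid (ring_on O_K))"
    proof (rule add.subgroupI)
      fix x assume "x \<in> I"
      then have "x \<in> O_K" "(- 1) * x \<in> I" using I O_K_minus[of 1] unfolding O_K_ideal_def by auto
      then show "\<ominus>\<^bsub>ring_on O_K\<^esub> x \<in> I" using inv[of x] by simp
    qed (use I in \<open>auto simp: O_K_ideal_def\<close>)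
    fix a x assume "a \<in> I" "x \<in> carrier (ring_on O_K)"
    then have "x * a \<in> I" using I by (simp add: O_K_ideal_def)
    then show "x \<otimes>\<^bsub>ring_on O_K\<^esub> a \<in> I" "a \<otimes>\<^bsub>ring_on O_K\<^esub> x \<in> I" by (simp_all add: mult.commute)
  qed
qed

lemma O_K_ideal_multiples:
  assumes "b \<in> O_K" "b \<noteq> 0"
  shows "O_K_ideal {x. x / b \<in> O_K}"
  unfolding O_K_ideal_def
proof (intro conjI ballI)
  show "{x. x / b \<in> O_K} \<subseteq> O_K"
  proof
    fix x assume "x \<in> {x. x / b \<in> O_K}"
    then have "(x / b) * b \<in> O_K" using assms by blast
    then show "x \<in> O_K" using assms by simp
  qed
  show "r * x \<in> {x. x / b \<in> O_K}" if "r \<in> O_K" "x \<in> {x. x / b \<in> O_K}" for r x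
    using that O_K_mult[of r "x / b"] by simp
qed (auto simp: add_divide_distrib)

text \<open>The lattice \<open>b \<cdot> O_K\<close> has the triangular basis \<open>c + g \<surd>2\<close>, \<open>N(b) / g\<close>, where \<open>g\<close> is the
  gcd of the two coordinates of \<open>b\<close>; hence the residue system below.\<close>

lemma ideal_norm_multiples:
  assumes "b \<in> O_K" "b \<noteq> 0"
  shows "int (ideal_norm (ring_on O_K) {x. x / b \<in> O_K}) = norm_K b"
proof -
  define I where "I = {x. x / b \<in> O_K}"
  have I: "O_K_ideal I" unfolding I_def by (rule O_K_ideal_multiples[OF assms])
  have I_add: "x + y \<in> I" if "x \<in> I" "y \<in> I" for x y using that I by (simp add: O_K_ideal_def)
  have I_mult: "r * x \<in> I" if "r \<in> O_K" "x \<in> I" for x r using that I by (simp add: O_K_ideal_def)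
  have I_diff: "x - y \<in> I" if "x \<in> I" "y \<in> I" for x y using that by (simp add: I_def diff_divide_distrib O_K_diff)
  have I_0: "0 \<in> I" using I by (simp add: O_K_ideal_def)
  have I_O_K: "x \<in> O_K" if "x \<in> I" for x using that I by (auto simp: O_K_ideal_def)
  obtain m n where b: "b = of_int m + of_int n * sqrt 2" using assms(1) by (rule O_K_E)
  have mn: "m \<noteq> 0 \<or> n \<noteq> 0" using assms(2) b by auto
  define g where "g = gcd m n"
  have g: "g > 0" using mn by (simp add: g_def)
  define D where "D = m * m - 2 * n * n"
  have cb: "conj_K b = of_int m - of_int n * sqrt 2" by (simp add: b)
  have D: "b * conj_K b = of_int D" by (simp add: cb) (simp add: b D_def algebra_simps)
  have D0: "D \<noteq> 0" using D assms conj_K_eq_0[of b] by auto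
  have ND: "norm_K b = \<bar>D\<bar>" using of_int_norm_K[OF assms(1)] D by simp
  have "g dvd D" by (auto simp: D_def g_def)
  then obtain k where k: "\<bar>D\<bar> = g * k" by (metis dvd_abs_iff dvdE)
  have k0: "k > 0" using k g D0 by (metis abs_of_pos zero_less_abs_iff zero_less_mult_pos)
  have I_iff: "x \<in> I \<longleftrightarrow> x * conj_K b / of_int D \<in> O_K" if "x \<in> O_K" for x
  proof -
    have "x / b = x * conj_K b / of_int D" unfolding D[symmetric] using assms conj_K_eq_0[of b] by simp
    then show ?thesis by (simp add: I_def)
  qed
  have quot: "(of_int p + of_int q * sqrt 2) / of_int d \<in> O_K \<longleftrightarrow> d dvd p \<and> d dvd q" if "d \<noteq> 0" for p q d
  proof
    assume "(of_int p + of_int q * sqrt 2) / of_int d \<in> O_K"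
    then obtain r s where "(of_int p + of_int q * sqrt 2) / of_int d = of_int r + of_int s * sqrt 2" by (rule O_K_E)
    then have "of_int p + of_int q * sqrt 2 = of_int (d * r) + of_int (d * s) * sqrt 2"
      using that by (simp add: field_simps)
    then show "d dvd p \<and> d dvd q" using O_K_unique[of p q "d * r" "d * s"] by simp
  next
    assume "d dvd p \<and> d dvd q"
    then obtain r s where "p = d * r" "q = d * s" by (auto elim!: dvdE)
    then have "(of_int p + of_int q * sqrt 2) / of_int d = of_int r + of_int s * sqrt 2" using that by (simp add: field_simps)
    then show "(of_int p + of_int q * sqrt 2) / of_int d \<in> O_K" by (simp only: O_K_I)
  qed
  \<comment> \<open>Multiplying by the conjugate of b turns membership into divisibility by D. As D
    divides both t m and t n iff it divides t g, the integers in I are the multiples of k =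
    |D|/g.\<close>
  have I_int: "of_int t \<in> I \<longleftrightarrow> k dvd t" for t
  proof -
    have "of_int t * conj_K b = of_int (t * m) + of_int (t * (- n)) * sqrt 2" by (simp add: cb algebra_simps)
    then have "of_int t \<in> I \<longleftrightarrow> D dvd t * m \<and> D dvd t * (- n)" using I_iff[OF O_K_of_int[of t]] quot[OF D0, of "t * m" "t * (- n)"] by (simp only: O_K_of_int)
    also have "\<dots> \<longleftrightarrow> D dvd t * m \<and> D dvd t * n" by simp
    also have "\<dots> \<longleftrightarrow> D dvd gcd (t * m) (t * n)" by simp
    also have "gcd (t * m) (t * n) = \<bar>t * g\<bar>" by (simp add: gcd_mult_distrib_int g_def abs_mult)
    also have "D dvd \<bar>t * g\<bar> \<longleftrightarrow> g * k dvd g * t" unfolding k[symmetric] by (simp add: mult.commute)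
    finally show ?thesis using g by simp
  qed
  obtain c where c: "of_int c + of_int g * sqrt 2 \<in> I"
  proof -
    \<comment> \<open>The \<surd>2-coordinate of (v + u \<surd>2) b is u m + v n, so Bezout
      coefficients produce an element of I with that coordinate equal to g.\<close>
    obtain u v where uv: "u * m + v * n = g" using bezout_int[of m n] by (auto simp: g_def)
    have "b \<in> I" using assms by (simp add: I_def)
    then have "(of_int v + of_int u * sqrt 2) * b \<in> I" by (intro I_mult O_K_I)
    also have "(of_int v + of_int u * sqrt 2) * b = of_int (v * m + 2 * u * n) + of_int (u * m + v * n) * sqrt 2"
      by (simp add: b algebra_simps)
    finally show ?thesis using that uv by metis
  qed
  have I_g: "g dvd y" if xy: "of_int x + of_int y * sqrt 2 \<in> I" for x y
  proof -
    obtain p q where "(of_int x + of_int y * sqrt 2) / b = of_int p + of_int q * sqrt 2"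
      using xy unfolding I_def by (auto elim: O_K_E)
    then have "of_int x + of_int y * sqrt 2 = b * (of_int p + of_int q * sqrt 2)" using assms(2) by (simp add: field_simps)
    also have "\<dots> = of_int (m * p + 2 * n * q) + of_int (m * q + n * p) * sqrt 2" by (simp add: b algebra_simps)
    finally have "y = m * q + n * p" using O_K_unique by blast
    then show ?thesis by (simp add: g_def)
  qed
  define h where "h = (\<lambda>(x, y). {i + (of_int x + of_int y * sqrt 2) | i. i \<in> I})"
  have coset: "carrier (ring_on O_K Quot I) = (\<lambda>z. {i + z | i. i \<in> I}) ` O_K"
    by (auto simp: FactRing_def A_RCOSETS_def RCOSETS_def r_coset_def ring_on_def)
  have eqI: "{i + z | i. i \<in> I} = {i + w | i. i \<in> I}" if "z - w \<in> I" for z w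
  proof (intro equalityI subsetI)
    fix a assume "a \<in> {i + z | i. i \<in> I}"
    then obtain i where "i \<in> I" "a = (i + (z - w)) + w" by auto
    then show "a \<in> {i + w | i. i \<in> I}" using that I_add by blast
  next
    fix a assume "a \<in> {i + w | i. i \<in> I}"
    then obtain i where "i \<in> I" "a = (i - (z - w)) + z" by auto
    then show "a \<in> {i + z | i. i \<in> I}" using that I_diff by blast
  qed
  have eqD: "z - w \<in> I" if "{i + z | i. i \<in> I} = {i + w | i. i \<in> I}" for z w
  proof -
    have "0 + z \<in> {i + w | i. i \<in> I}" using I_0 that by blast
    then show ?thesis by auto
  qed
  have "bij_betw h ({0..<k} \<times> {0..<g}) (carrier (ring_on O_K Quot I))"
  proof (rule bij_betw_imageI)
    show "inj_on h ({0..<k} \<times> {0..<g})"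
    proof (rule inj_onI, clarify)
      fix x y x' y' assume r: "x \<in> {0..<k}" "y \<in> {0..<g}" "x' \<in> {0..<k}" "y' \<in> {0..<g}" "h (x, y) = h (x', y')"
      then have "(of_int x + of_int y * sqrt 2) - (of_int x' + of_int y' * sqrt 2) \<in> I"
        unfolding h_def prod.case by (intro eqD)
      then have *: "of_int (x - x') + of_int (y - y') * sqrt 2 \<in> I" by (simp add: algebra_simps)
      then have "g dvd y - y'" by (rule I_g)
      moreover have "\<bar>y - y'\<bar> < g" using r by auto
      ultimately have y: "y = y'" using dvd_imp_le_int[of "y - y'" g] by (smt (verit))
      then have "of_int (x - x') \<in> I" using * by simp
      then have "k dvd x - x'" using I_int by blast
      moreover have "\<bar>x - x'\<bar> < k" using r by auto
      ultimately have "x = x'" using dvd_imp_le_int[of "x - x'" k] by (smt (verit))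
      then show "x = x' \<and> y = y'" using y by simp
    qed
    have "{i + z | i. i \<in> I} \<in> h ` ({0..<k} \<times> {0..<g})" if z: "z \<in> O_K" for z
    proof -
      obtain x y where xy: "z = of_int x + of_int y * sqrt 2" using z by (rule O_K_E)
      \<comment> \<open>Triangular reduction: subtracting a multiple of c + g \<surd>2 brings the
        second coordinate into [0, g) and changes the first to x', which is then reduced modulo
        k.\<close>
      define x' where "x' = x - c * (y div g)"
      have "of_int (y div g) * (of_int c + of_int g * sqrt 2) + of_int (k * (x' div k)) \<in> I"
        using I_int[of "k * (x' div k)"] by (intro I_add I_mult[OF _ c]) (auto simp del: of_int_mult)
      also have "of_int (y div g) * (of_int c + of_int g * sqrt 2) + of_int (k * (x' div k)) =
          of_int (c * (y div g) + k * (x' div k)) + of_int (g * (y div g)) * sqrt 2" by (simp add: algebra_simps)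
      also have "c * (y div g) + k * (x' div k) = x - x' mod k" by (simp add: x'_def minus_mod_eq_mult_div[symmetric])
      also have "g * (y div g) = y - y mod g" by (simp add: minus_mod_eq_mult_div[symmetric])
      also have "of_int (x - x' mod k) + of_int (y - y mod g) * sqrt 2 = z - (of_int (x' mod k) + of_int (y mod g) * sqrt 2)"
        by (simp add: xy algebra_simps)
      finally have "{i + z | i. i \<in> I} = h (x' mod k, y mod g)" unfolding h_def prod.case by (rule eqI)
      then show ?thesis using g k0 by (auto intro!: image_eqI[of _ h "(x' mod k, y mod g)"])
    qed
    then show "h ` ({0..<k} \<times> {0..<g}) = carrier (ring_on O_K Quot I)"
      unfolding coset by (auto simp: h_def)
  qed
  then have "card (carrier (ring_on O_K Quot I)) = card ({0..<k} \<times> {0..<g})" by (metis bij_betw_same_card)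
  then show ?thesis using g k0 k ND by (simp add: ideal_norm_def I_def card_cartesian_product)
qed

text \<open>Every nonzero ideal has exactly one generator in \<open>O_K_reps\<close>, so the sum
  over ideals can be reindexed by generators.\<close>

lemma dedekind_zeta_2: "dedekind_zeta (ring_on O_K) 2 = zeta_K_2"
proof -
  define h where "h = (\<lambda>b. {x. x / b \<in> O_K})"
  have pos: "b \<in> O_K \<and> b \<noteq> 0" if "b \<in> O_K_reps" for b using that by (auto simp: O_K_reps_def)
  have "bij_betw h O_K_reps {I. ideal I (ring_on O_K) \<and> I \<noteq> {\<zero>\<^bsub>ring_on O_K\<^esub>}}"
  proof (rule bij_betw_imageI)
    show "inj_on h O_K_reps"
    proof (rule inj_onI)
      fix b c assume *: "b \<in> O_K_reps" "c \<in> O_K_reps" "h b = h c"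
      have "b \<in> h b" "c \<in> h c" using pos * by (auto simp: h_def)
      then have "b / c \<in> O_K" "c / b \<in> O_K" using * by (auto simp: h_def)
      then show "b = c" using O_K_reps_unique * by blast
    qed
    have "h b \<in> {I. O_K_ideal I \<and> I \<noteq> {0}}" if "b \<in> O_K_reps" for b
    proof -
      have "b \<in> h b" "b \<noteq> 0" using pos that by (auto simp: h_def)
      then have "h b \<noteq> {0}" by blast
      then show ?thesis using O_K_ideal_multiples pos that by (simp add: h_def)
    qed
    moreover have "I \<in> h ` O_K_reps" if "O_K_ideal I" "I \<noteq> {0}" for I
      using O_K_principal[OF that] by (metis h_def image_eqI)
    ultimately show "h ` O_K_reps = {I. ideal I (ring_on O_K) \<and> I \<noteq> {\<zero>\<^bsub>ring_on O_K\<^esub>}}"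
      unfolding ideal_O_K_iff ring_on_sel by blast
  qed
  then have "dedekind_zeta (ring_on O_K) 2 = infsum (\<lambda>b. real (ideal_norm (ring_on O_K) (h b)) powr (- 2)) O_K_reps"
    unfolding dedekind_zeta_def by (rule infsum_reindex_bij_betw[symmetric])
  also have "\<dots> = infsum weight O_K_reps"
  proof (rule infsum_cong)
    fix b assume b: "b \<in> O_K_reps"
    then have n: "real (ideal_norm (ring_on O_K) (h b)) = of_int (norm_K b)"
      using ideal_norm_multiples[of b] pos by (simp add: h_def)
    have "norm_K b \<ge> 1" using norm_K_ge_1 pos b by blast
    then have "real_of_int (norm_K b) powr (- 2) = 1 / (of_int (norm_K b))\<^sup>2"
      using powr_realpow[of "of_int (norm_K b)" 2] by (simp add: powr_minus divide_inverse)
    then show "real (ideal_norm (ring_on O_K) (h b)) powr (- 2) = weight b" by (simp add: n weight_def)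
  qed
  finally show ?thesis by (simp add: zeta_K_2_def)
qed


section \<open>Densities\<close>

text \<open>Multiplication by a unit permutes \<int>[\<zeta>], while the conjugate is scaled by
  \<open>conj_K u\<close>. Size can thus be moved between the two components.\<close>

lemma card_lattice_points_unit:
  assumes u: "u \<in> O_K" "inverse u \<in> O_K" "u \<noteq> 0"
  shows "card (lattice_points ((*\<^sub>R) u ` A) ((*\<^sub>R) (conj_K u) ` B)) = card (lattice_points A B)"
proof -
  have c: "conj_K u \<noteq> 0" using u conj_K_eq_0 by simp
  have "bij_betw ((*\<^sub>R) u) (lattice_points A B) (lattice_points ((*\<^sub>R) u ` A) ((*\<^sub>R) (conj_K u) ` B))"
  proof (rule bij_betw_imageI)
    show "inj_on ((*\<^sub>R) u) (lattice_points A B)" using u by (auto intro: inj_onI)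
    show "(*\<^sub>R) u ` lattice_points A B = lattice_points ((*\<^sub>R) u ` A) ((*\<^sub>R) (conj_K u) ` B)"
    proof (intro equalityI subsetI)
      fix x assume "x \<in> (*\<^sub>R) u ` lattice_points A B"
      then show "x \<in> lattice_points ((*\<^sub>R) u ` A) ((*\<^sub>R) (conj_K u) ` B)"
        using u by (auto simp: lattice_points_def galois_sigma_scaleR)
    next
      fix x assume x: "x \<in> lattice_points ((*\<^sub>R) u ` A) ((*\<^sub>R) (conj_K u) ` B)"
      then obtain a where a: "a \<in> A" "x = u *\<^sub>R a" by (auto simp: lattice_points_def)
      have "inverse u *\<^sub>R x \<in> Z_zeta8" using x u by (auto simp: lattice_points_def)
      then have aZ: "a \<in> Z_zeta8" using a u by simp
      obtain b where b: "b \<in> B" "galois_sigma x = conj_K u *\<^sub>R b" using x by (auto simp: lattice_points_def)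
      have "galois_sigma a = b" using b(2) galois_sigma_scaleR[OF u(1) aZ] c a by simp
      then show "x \<in> (*\<^sub>R) u ` lattice_points A B" using a b aZ by (auto simp: lattice_points_def)
    qed
  qed
  then show ?thesis by (metis bij_betw_same_card)
qed

text \<open>As \<open>\<bar>y\<bar> \<bar>\<sigma>(y)\<bar> \<ge> 1\<close> for \<open>y \<noteq> 0\<close>, the set is empty unless \<open>R S \<ge> 1\<close>; otherwise a unit moves
  \<open>R\<close> into \<open>[1, \<lambda>)\<close> and a volume bound applies.\<close>

lemma lattice_points_bound:
  obtains C where "\<And>R S. R > 0 \<Longrightarrow> S > 0 \<Longrightarrow>
    real (card (lattice_points (cball 0 R) (cball 0 S) - {0})) \<le> C * (R * S)\<^sup>2"
proof -
  define b where "b = measure lebesgue (ball (0::complex) 1)"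
  have b: "measure lebesgue (ball (0::complex) r) = r\<^sup>2 * b" if "r > 0" for r
  proof -
    have "ball (0::complex) r = (*\<^sub>R) r ` ball 0 1" using ball_scale[of r "0::complex" 1] that by simp
    then show ?thesis unfolding b_def by (simp only: measure_scaleR_image)
  qed
  have b0: "b \<ge> 0" by (simp add: b_def)
  have out: "outer_nbhd 8 (cball (0::complex) r) \<subseteq> ball 0 (r + 8)" for r
  proof
    fix z assume "z \<in> outer_nbhd 8 (cball (0::complex) r)"
    then obtain a where "norm a \<le> r" "dist a z < 8" by (auto simp: outer_nbhd_def)
    then show "z \<in> ball 0 (r + 8)" using norm_triangle_ineq[of a "z - a"] by (simp add: dist_norm norm_minus_commute)
  qed
  have out_meas: "measure lebesgue (outer_nbhd 8 (cball (0::complex) r)) \<le> (r + 8)\<^sup>2 * b" if "r > 0" for r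
  proof -
    have "measure lebesgue (outer_nbhd 8 (cball (0::complex) r)) \<le> measure lebesgue (ball (0::complex) (r + 8))"
      by (intro measure_mono_fmeasurable out fmeasurableD lmeasurable_outer) auto
    then show ?thesis using b[of "r + 8"] that by simp
  qed
  \<comment> \<open>The two outer radii are u R + 8 \<le> 9 \<lambda>, from u R < \<lambda>, and
    |\<sigma>(u)| S + 8 \<le> 9 R S, from |\<sigma>(u)| \<le> R and R S \<ge> 1; b is the area of
    the unit disc.\<close>
  define C where "C = (9 * fund_unit)\<^sup>2 * b * (9\<^sup>2 * b) / covol"
  have C0: "C \<ge> 0" using b0 covol_pos by (simp add: C_def)
  have l: "fund_unit > 1" using fund_unit_bounds by simp
  have "real (card (lattice_points (cball 0 R) (cball 0 S) - {0})) \<le> C * (R * S)\<^sup>2" if R: "R > 0" and S: "S > 0" for R S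
  proof (cases "lattice_points (cball 0 R) (cball 0 S) - {0} = {}")
    case True
    then show ?thesis using C0 by (simp only: card.empty) simp
  next
    case False
    then obtain x where x: "x \<in> Z_zeta8" "x \<noteq> 0" "cmod x \<le> R" "cmod (galois_sigma x) \<le> S"
      by (auto simp: lattice_points_def)
    have RS: "1 \<le> R * S"
    proof -
      have "1 \<le> cmod x * cmod (galois_sigma x)" using Z_zeta8_norm_ge_1 x by blast
      also have "\<dots> \<le> R * S" using x R by (intro mult_mono) auto
      finally show ?thesis .
    qed
    obtain k where k: "1 \<le> R * fund_unit powi k" "R * fund_unit powi k < fund_unit" using fund_unit_scale[OF R] by blast
    define u where "u = fund_unit powi k"
    have u0: "u > 0" unfolding u_def using l by (simp add: zero_less_power_int)
    have u: "u \<in> O_K" "inverse u \<in> O_K" using fund_unit_powi_O_K[of k] fund_unit_powi_O_K[of "-k"]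
      by (simp_all add: u_def power_int_minus)
    have uc: "\<bar>u * conj_K u\<bar> = 1"
      using of_int_norm_K[OF u(1)] norm_K_eq_1I[OF u(1,2)] u0 by simp
    have c0: "conj_K u \<noteq> 0" using uc by auto
    have img: "(*\<^sub>R) c ` cball (0::complex) r = cball 0 (\<bar>c\<bar> * r)" if "c \<noteq> 0" for c r
      using cball_scale[of c "0::complex" r] that by simp
    have "card (lattice_points (cball 0 R) (cball 0 S)) = card (lattice_points (cball 0 (u * R)) (cball 0 (\<bar>conj_K u\<bar> * S)))"
      using card_lattice_points_unit[OF u, of "cball 0 R" "cball 0 S"] u0 c0 by (simp add: img)
    moreover have "real (card (lattice_points (cball 0 R) (cball 0 S) - {0})) \<le> real (card (lattice_points (cball 0 R) (cball 0 S)))"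
      by (intro of_nat_mono card_mono lattice_points_upper) auto
    moreover have "real (card (lattice_points (cball 0 (u * R)) (cball 0 (\<bar>conj_K u\<bar> * S)))) * covol \<le>
      (9 * fund_unit)\<^sup>2 * b * (9\<^sup>2 * b * (R * S)\<^sup>2)"
    proof -
      have uR: "1 \<le> u * R" "u * R < fund_unit" using k by (simp_all add: u_def mult.commute)
      have cS: "\<bar>conj_K u\<bar> * S \<le> R * S"
      proof -
        have "\<bar>conj_K u\<bar> * 1 \<le> \<bar>conj_K u\<bar> * (u * R)" using uR by (intro mult_left_mono) auto
        also have "\<dots> = R" using uc u0 by (simp add: abs_mult mult_ac)
        finally show ?thesis using S by (simp add: mult_right_mono)
      qed
      have cS0: "\<bar>conj_K u\<bar> * S > 0" using c0 S by simp
      have "real (card (lattice_points (cball 0 (u * R)) (cball 0 (\<bar>conj_K u\<bar> * S)))) * covol \<le>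
         measure lebesgue (outer_nbhd 8 (cball (0::complex) (u * R))) * measure lebesgue (outer_nbhd 8 (cball (0::complex) (\<bar>conj_K u\<bar> * S)))"
        by (rule lattice_points_upper(2)) auto
      also have "\<dots> \<le> ((u * R + 8)\<^sup>2 * b) * ((\<bar>conj_K u\<bar> * S + 8)\<^sup>2 * b)"
        using uR cS0 b0 by (intro mult_mono out_meas) auto
      also have "\<dots> \<le> ((9 * fund_unit)\<^sup>2 * b) * ((9 * (R * S))\<^sup>2 * b)"
        using uR cS cS0 b0 RS l by (intro mult_mono power_mono) auto
      finally show ?thesis by (simp add: power_mult_distrib mult_ac)
    qed
    ultimately have "real (card (lattice_points (cball 0 R) (cball 0 S) - {0})) * covol \<le>
      (9 * fund_unit)\<^sup>2 * b * (9\<^sup>2 * b * (R * S)\<^sup>2)" 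
      using covol_pos by (smt (verit) mult_right_mono)
    then show ?thesis using covol_pos by (simp add: C_def field_simps)
  qed
  then show ?thesis using that by blast
qed

text \<open>The measure of D stands on the right, so that no division by a possibly vanishing
  measure occurs while densities are scaled and subtracted.\<close>

definition has_count_density :: "complex set \<Rightarrow> real \<Rightarrow> bool" where
  "has_count_density P d \<longleftrightarrow> (\<forall>D. jordan_measurable D \<longrightarrow>
     ((\<lambda>T. real (card (P \<inter> (*\<^sub>R) T ` D)) / T\<^sup>2) \<longlongrightarrow> measure lebesgue D * d) at_top)"

lemma has_count_densityD:
  "has_count_density P d \<Longrightarrow> jordan_measurable D \<Longrightarrow>
     ((\<lambda>T. real (card (P \<inter> (*\<^sub>R) T ` D)) / T\<^sup>2) \<longlongrightarrow> measure lebesgue D * d) at_top"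
  by (simp add: has_count_density_def)

lemma has_count_density_imp:
  assumes "locally_finite P" "has_count_density P d" shows "has_point_density P d"
  unfolding has_point_density_def
proof (intro conjI allI impI)
  fix D assume D: "jordan_measurable D \<and> 0 < measure lebesgue (D :: complex set)"
  then have "((\<lambda>T. real (card (P \<inter> (*\<^sub>R) T ` D)) / T\<^sup>2 / measure lebesgue D) \<longlongrightarrow> measure lebesgue D * d / measure lebesgue D) at_top"
    using assms(2) by (intro tendsto_divide tendsto_const has_count_densityD) auto
  then show "((\<lambda>T. real (card (P \<inter> (*\<^sub>R) T ` D)) / measure lebesgue ((*\<^sub>R) T ` D)) \<longlongrightarrow> d) at_top"
    using D by (simp add: measure_scaleR_image)
qed (use assms in auto)

lemma jordan_measurable_ball: "jordan_measurable (ball (0::complex) 1)"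
  by (simp add: jordan_measurable_def negligible_sphere negligible_iff_null_sets[symmetric])

lemma point_density_eq:
  fixes P :: "complex set"
  assumes "has_point_density P d" shows "point_density P = d"
  unfolding point_density_def
proof (rule the_equality[where P = "has_point_density P", OF assms])
  fix e assume e: "has_point_density P e"
  have "measure lebesgue (ball (0::complex) 1) > 0" by (simp add: content_ball_pos)
  then show "e = d" using assms e jordan_measurable_ball unfolding has_point_density_def
    by (meson tendsto_unique trivial_limit_at_top_linorder)
qed

lemma coprime_points_locally_finite:
  assumes "bounded V" shows "locally_finite (coprime_points F V)"
  unfolding locally_finite_def
proof (intro allI impI)
  fix B :: "complex set" assume B: "bounded B"
  show "finite (coprime_points F V \<inter> B)"
    by (rule finite_subset[OF _ lattice_points_upper(1)[OF B assms]])
       (auto simp: coprime_points_def lattice_points_def)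
qed

text \<open>The unit u of size about \<surd>T spreads the growth over both components:
  multiplication by u maps the points of (T/u) D with conjugate in u V onto those of T D with
  conjugate in V, and now both sets being counted in grow.\<close>

lemma has_count_density_window:
  assumes V: "jordan_measurable V"
  shows "has_count_density (coprime_points {} V) (measure lebesgue V / covol)"
  unfolding has_count_density_def
proof (intro allI impI)
  fix D :: "complex set" assume D: "jordan_measurable D"
  \<comment> \<open>The norm of \<lambda> is -1. Its square has norm 1, so the conjugate of u is 1/u
    and the window returns to V without a reflection.\<close>
  define m where "m = fund_unit\<^sup>2"
  have m1: "m > 1" using fund_unit_bounds by (simp add: m_def)
  \<comment> \<open>The exponent keeps u at most \<surd>T, hence T/u at least \<surd>T, while u
    still tends to infinity.\<close>
  define k where "k = (\<lambda>T::real. nat \<lfloor>log m (sqrt T)\<rfloor>)"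
  define u where "u = (\<lambda>T. m ^ k T)"
  have u1: "u T > 0" for T using m1 by (simp add: u_def)
  have lm: "ln m > 0" using m1 by simp
  have "filterlim (\<lambda>T. log m (sqrt T)) at_top at_top"
  proof -
    have "filterlim (\<lambda>T. (1 / ln m) * ln (sqrt T)) at_top at_top"
      by (rule filterlim_tendsto_pos_mult_at_top[OF tendsto_const])
         (use lm in \<open>auto intro: filterlim_compose[OF ln_at_top] sqrt_at_top\<close>)
    then show ?thesis by (simp add: log_def)
  qed
  then have k: "filterlim k sequentially at_top" unfolding k_def
    by (intro filterlim_compose[OF filterlim_nat_sequentially] filterlim_compose[OF filterlim_floor_sequentially])
  have "filterlim (\<lambda>n. m ^ n) at_top sequentially"
    using filterlim_realpow_sequentially_gt1[of m] m1 by (intro filterlim_at_infinity_imp_filterlim_at_top) auto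
  then have R2: "filterlim u at_top at_top" unfolding u_def by (rule filterlim_compose[OF _ k])
  have R1: "filterlim (\<lambda>T. T / u T) at_top at_top"
  proof (rule filterlim_at_top_mono[OF sqrt_at_top])
    show "eventually (\<lambda>T. sqrt T \<le> T / u T) at_top"
      using eventually_ge_at_top[of 1]
    proof eventually_elim
      case (elim T)
      then have "log m (sqrt T) \<ge> 0" using m1 by simp
      then have "real (k T) \<le> log m (sqrt T)" unfolding k_def by linarith
      then have "m powr (real (k T)) \<le> sqrt T" using m1 elim le_log_iff[of m "sqrt T" "real (k T)"] by simp
      then have "u T \<le> sqrt T" using m1 by (simp add: u_def powr_realpow)
      then have "sqrt T * u T \<le> sqrt T * sqrt T" using elim by (intro mult_left_mono) auto
      then show ?case using u1[of T] elim by (simp add: pos_le_divide_eq)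
    qed
  qed
  have lim: "((\<lambda>T. real (card (lattice_points ((*\<^sub>R) (T / u T) ` D) ((*\<^sub>R) (u T) ` V))) / ((T / u T)\<^sup>2 * (u T)\<^sup>2))
     \<longlongrightarrow> measure lebesgue D * measure lebesgue V / covol) at_top"
    by (rule lattice_points_tendsto[OF D V R1 R2])
  have "card (lattice_points ((*\<^sub>R) (T / u T) ` D) ((*\<^sub>R) (u T) ` V)) = card (coprime_points {} V \<inter> (*\<^sub>R) T ` D)" for T
  proof -
    have uO: "u T \<in> O_K" by (auto simp: u_def m_def)
    have cc: "u T * conj_K (u T) = 1"
    proof -
      have "fund_unit * conj_K fund_unit = -1" using sqrt2_minus_1_fund_unit by (simp add: conj_fund_unit mult.commute)
      then have "(fund_unit * conj_K fund_unit)\<^sup>2 ^ k T = 1" by simp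
      then show ?thesis by (simp add: u_def m_def conj_K_power O_K_power power_mult_distrib)
    qed
    then have "inverse (u T) \<in> O_K" using uO by (metis inverse_unique conj_K_in_O_K)
    then have "card (lattice_points ((*\<^sub>R) (T / u T) ` D) ((*\<^sub>R) (u T) ` V)) =
       card (lattice_points ((*\<^sub>R) (u T) ` (*\<^sub>R) (T / u T) ` D) ((*\<^sub>R) (conj_K (u T)) ` (*\<^sub>R) (u T) ` V))"
      using card_lattice_points_unit[OF uO] u1[of T] by simp
    also have "(*\<^sub>R) (u T) ` (*\<^sub>R) (T / u T) ` D = (*\<^sub>R) T ` D" using u1[of T] by (simp add: image_image)
    also have "(*\<^sub>R) (conj_K (u T)) ` (*\<^sub>R) (u T) ` V = V" using cc by (simp add: image_image mult.commute)
    also have "lattice_points ((*\<^sub>R) T ` D) V = coprime_points {} V \<inter> (*\<^sub>R) T ` D"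
      by (auto simp: lattice_points_def coprime_points_def)
    finally show ?thesis .
  qed
  moreover have "(T / u T)\<^sup>2 * (u T)\<^sup>2 = T\<^sup>2" for T using u1[of T] by (simp add: power_divide)
  ultimately show "((\<lambda>T. real (card (coprime_points {} V \<inter> (*\<^sub>R) T ` D)) / T\<^sup>2) \<longlongrightarrow> measure lebesgue D * (measure lebesgue V / covol)) at_top"
    using lim by simp
qed

lemma has_count_density_scaleR:
  assumes "has_count_density P d" "r > 0"
  shows "has_count_density ((*\<^sub>R) r ` P) (d / r\<^sup>2)"
  unfolding has_count_density_def
proof (intro allI impI)
  fix D :: "complex set" assume D: "jordan_measurable D"
  have "filterlim (\<lambda>T::real. T / r) at_top at_top"
    using filterlim_tendsto_pos_mult_at_top[OF tendsto_const[of "1 / r"] _ filterlim_ident] assms(2) by simp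
  then have "((\<lambda>T. real (card (P \<inter> (*\<^sub>R) (T / r) ` D)) / (T / r)\<^sup>2) \<longlongrightarrow> measure lebesgue D * d) at_top"
    by (rule filterlim_compose[OF has_count_densityD[OF assms(1) D]])
  then have "((\<lambda>T. real (card (P \<inter> (*\<^sub>R) (T / r) ` D)) / (T / r)\<^sup>2 / r\<^sup>2) \<longlongrightarrow> measure lebesgue D * d / r\<^sup>2) at_top"
    using assms(2) by (intro tendsto_divide tendsto_const) auto
  moreover have "card ((*\<^sub>R) r ` P \<inter> (*\<^sub>R) T ` D) = card (P \<inter> (*\<^sub>R) (T / r) ` D)" for T
  proof -
    have "(*\<^sub>R) T ` D = (*\<^sub>R) r ` (*\<^sub>R) (T / r) ` D" using assms(2) by (simp add: image_image)
    moreover have inj: "inj ((*\<^sub>R) r :: complex \<Rightarrow> complex)" using assms(2) by (auto intro: injI)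
    ultimately have "(*\<^sub>R) r ` P \<inter> (*\<^sub>R) T ` D = (*\<^sub>R) r ` (P \<inter> (*\<^sub>R) (T / r) ` D)" by (simp only: image_Int)
    then show ?thesis using inj by (simp add: card_image inj_on_subset)
  qed
  ultimately show "((\<lambda>T. real (card ((*\<^sub>R) r ` P \<inter> (*\<^sub>R) T ` D)) / T\<^sup>2) \<longlongrightarrow> measure lebesgue D * (d / r\<^sup>2)) at_top"
    using assms(2) by (simp add: power_divide)
qed

lemma has_count_density_Diff:
  assumes "has_count_density P c" "has_count_density Q d" "P \<subseteq> Q" "locally_finite Q"
  shows "has_count_density (Q - P) (d - c)"
  unfolding has_count_density_def
proof (intro allI impI)
  fix D :: "complex set" assume D: "jordan_measurable D"
  have "((\<lambda>T. real (card (Q \<inter> (*\<^sub>R) T ` D)) / T\<^sup>2 - real (card (P \<inter> (*\<^sub>R) T ` D)) / T\<^sup>2)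
      \<longlongrightarrow> measure lebesgue D * d - measure lebesgue D * c) at_top"
    by (intro tendsto_diff has_count_densityD assms D)
  moreover have "real (card ((Q - P) \<inter> (*\<^sub>R) T ` D)) = real (card (Q \<inter> (*\<^sub>R) T ` D)) - real (card (P \<inter> (*\<^sub>R) T ` D))" for T
  proof -
    have "finite (Q \<inter> (*\<^sub>R) T ` D)" using assms(4) D bounded_scaling[of D T]
      by (auto simp: locally_finite_def jordan_measurable_def)
    moreover have "P \<inter> (*\<^sub>R) T ` D \<subseteq> Q \<inter> (*\<^sub>R) T ` D" using assms(3) by blast
    moreover have "(Q - P) \<inter> (*\<^sub>R) T ` D = (Q \<inter> (*\<^sub>R) T ` D) - (P \<inter> (*\<^sub>R) T ` D)" by blast
    ultimately show ?thesis
      by (metis card_Diff_subset card_mono finite_subset of_nat_diff)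
  qed
  ultimately show "((\<lambda>T. real (card ((Q - P) \<inter> (*\<^sub>R) T ` D)) / T\<^sup>2) \<longlongrightarrow> measure lebesgue D * (d - c)) at_top"
    by (simp add: diff_divide_distrib right_diff_distrib)
qed

text \<open>From u p + v q = 1 one has y/q = u (p y/q) + v y.\<close>

lemma Z_zeta8_coprime_multiple:
  assumes "p \<in> prime_reps" "q \<in> prime_reps" "p \<noteq> q" "y \<in> Z_zeta8" "(p *\<^sub>R y) /\<^sub>R q \<in> Z_zeta8"
  shows "y /\<^sub>R q \<in> Z_zeta8"
proof -
  obtain u v where uv: "u \<in> O_K" "v \<in> O_K" "u * p + v * q = 1" using prime_reps_bezout assms by metis
  have q: "q \<noteq> 0" using prime_reps_D[OF assms(2)] by simp
  have "u *\<^sub>R ((p *\<^sub>R y) /\<^sub>R q) + v *\<^sub>R y = ((u * p + v * q) / q) *\<^sub>R y"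
    using q by (simp add: scaleR_add_left[symmetric] field_simps)
  then have "u *\<^sub>R ((p *\<^sub>R y) /\<^sub>R q) + v *\<^sub>R y = y /\<^sub>R q" using uv by (simp add: divide_inverse)
  moreover have "u *\<^sub>R ((p *\<^sub>R y) /\<^sub>R q) + v *\<^sub>R y \<in> Z_zeta8" using uv assms by blast
  ultimately show ?thesis by metis
qed

text \<open>Adding p to F removes p times the points that F leaves in the window V/\<sigma>(p). The
  window area contributes 1/\<sigma>(p)^2 and the dilation 1/p^2, together \<open>weight p\<close>.
  Since the window changes, the induction runs over all V.\<close>

lemma has_count_density_coprime_finite:
  assumes "finite F" "F \<subseteq> prime_reps" "jordan_measurable V"
  shows "has_count_density (coprime_points F V) (measure lebesgue V / covol * (\<Prod>p\<in>F. 1 - weight p))"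
  using assms
proof (induction F arbitrary: V)
  case empty
  then show ?case using has_count_density_window by simp
next
  case (insert p F)
  have p: "p \<in> prime_reps" "p \<in> O_K" "p > 0" using insert.prems prime_reps_D[of p] by auto
  have c0: "conj_K p \<noteq> 0" using p conj_K_eq_0 by simp
  define V' where "V' = (*\<^sub>R) (1 / conj_K p) ` V"
  have V': "jordan_measurable V'" unfolding V'_def using insert.prems c0 by (intro jordan_measurable_scaleR) auto
  have P: "has_count_density ((*\<^sub>R) p ` coprime_points F V') (measure lebesgue V' / covol * (\<Prod>p\<in>F. 1 - weight p) / p\<^sup>2)"
    using insert V' p by (intro has_count_density_scaleR insert.IH) auto
  have mem: "p *\<^sub>R y \<in> coprime_points F V \<longleftrightarrow> y \<in> coprime_points F V'" if y: "y \<in> Z_zeta8" for y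
  proof -
    have "galois_sigma (p *\<^sub>R y) \<in> V \<longleftrightarrow> galois_sigma y \<in> V'"
      using galois_sigma_scaleR[OF p(2) y] c0
      by (auto simp: V'_def image_iff intro!: bexI[of _ "conj_K p *\<^sub>R galois_sigma y"])
    moreover have "(p *\<^sub>R y) /\<^sub>R q \<in> Z_zeta8 \<longleftrightarrow> y /\<^sub>R q \<in> Z_zeta8" if "q \<in> F" for q
    proof
      show "(p *\<^sub>R y) /\<^sub>R q \<in> Z_zeta8 \<Longrightarrow> y /\<^sub>R q \<in> Z_zeta8"
        using Z_zeta8_coprime_multiple[of p q y] that insert y by auto
      assume "y /\<^sub>R q \<in> Z_zeta8"
      then have "p *\<^sub>R (y /\<^sub>R q) \<in> Z_zeta8" using p by blast
      then show "(p *\<^sub>R y) /\<^sub>R q \<in> Z_zeta8" by (simp add: mult.commute)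
    qed
    ultimately show ?thesis using y p by (auto simp: coprime_points_def)
  qed
  have sub: "(*\<^sub>R) p ` coprime_points F V' \<subseteq> coprime_points F V" using mem by (auto simp: coprime_points_def[of F V'])
  have "coprime_points (insert p F) V = coprime_points F V - (*\<^sub>R) p ` coprime_points F V'"
  proof (intro equalityI subsetI)
    fix x assume x: "x \<in> coprime_points (insert p F) V"
    have "x \<notin> (*\<^sub>R) p ` coprime_points F V'" using x p by (auto simp: coprime_points_def)
    then show "x \<in> coprime_points F V - (*\<^sub>R) p ` coprime_points F V'" using x by (auto simp: coprime_points_def)
  next
    fix x assume x: "x \<in> coprime_points F V - (*\<^sub>R) p ` coprime_points F V'"
    have "x /\<^sub>R p \<notin> Z_zeta8"
    proof
      assume y: "x /\<^sub>R p \<in> Z_zeta8"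
      have xp: "x = p *\<^sub>R (x /\<^sub>R p)" using p by simp
      then have "x /\<^sub>R p \<in> coprime_points F V'" using mem[OF y] x by simp
      then show False using x xp by blast
    qed
    then show "x \<in> coprime_points (insert p F) V" using x by (auto simp: coprime_points_def)
  qed
  moreover have "has_count_density (coprime_points F V - (*\<^sub>R) p ` coprime_points F V')
     (measure lebesgue V / covol * (\<Prod>p\<in>F. 1 - weight p) - measure lebesgue V' / covol * (\<Prod>p\<in>F. 1 - weight p) / p\<^sup>2)"
    using insert.prems insert.IH[of V] P sub
    by (intro has_count_density_Diff coprime_points_locally_finite) (auto simp: jordan_measurable_def)
  moreover have "measure lebesgue V' = measure lebesgue V / (conj_K p)\<^sup>2"
    unfolding V'_def measure_scaleR_image by (simp add: power_divide)
  then have "measure lebesgue V / covol * (\<Prod>p\<in>F. 1 - weight p) - measure lebesgue V' / covol * (\<Prod>p\<in>F. 1 - weight p) / p\<^sup>2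
     = measure lebesgue V / covol * ((1 - weight p) * (\<Prod>p\<in>F. 1 - weight p))"
    using weight_eq[OF p(2)] by (simp add: power_mult_distrib algebra_simps)
  ultimately show ?case using insert.hyps by simp
qed


section \<open>Passing to infinitely many primes\<close>

lemma weight_summable_prime_reps: "weight summable_on prime_reps"
  by (rule summable_on_subset_banach[OF weight_summable prime_reps_subset])

lemma weight_tail_tendsto:
  "((\<lambda>F. infsum weight (prime_reps - F)) \<longlongrightarrow> 0) (finite_subsets_at_top prime_reps)"
proof -
  have "(sum weight \<longlongrightarrow> infsum weight prime_reps) (finite_subsets_at_top prime_reps)"
    unfolding has_sum_def[symmetric] using weight_summable_prime_reps by (rule has_sum_infsum)
  from tendsto_diff[OF tendsto_const this, of "infsum weight prime_reps"]
  have "((\<lambda>F. infsum weight prime_reps - sum weight F) \<longlongrightarrow> 0) (finite_subsets_at_top prime_reps)" by simp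
  moreover have "eventually (\<lambda>F. infsum weight prime_reps - sum weight F = infsum weight (prime_reps - F)) (finite_subsets_at_top prime_reps)"
    by (rule eventually_finite_subsets_at_top_weakI) (use weight_summable_prime_reps in \<open>subst infsum_Diff, auto\<close>)
  ultimately show ?thesis by (rule Lim_transform_eventually)
qed

text \<open>Nonzero points divisible by p are p times nonzero points with radii R/p and
  S/|\<sigma>(p)|, so the uniform bound gains the factor \<open>weight p\<close>; the union bound
  sums these. The term 1 accounts for the origin, which every prime divides.\<close>

lemma lattice_points_multiples_bound:
  assumes C: "\<And>R S. R > 0 \<Longrightarrow> S > 0 \<Longrightarrow> real (card (lattice_points (cball 0 R) (cball 0 S) - {0})) \<le> C * (R * S)\<^sup>2"
    and R: "R > 0" and S: "S > 0" and X: "finite X" "X \<subseteq> lattice_points (cball 0 R) (cball 0 S)"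
    and Q: "Q \<subseteq> prime_reps" and XQ: "\<And>x. x \<in> X \<Longrightarrow> \<exists>p\<in>Q. x /\<^sub>R p \<in> Z_zeta8"
  shows "real (card X) \<le> 1 + C * (R * S)\<^sup>2 * infsum weight Q"
proof -
  obtain q where q: "\<And>x. x \<in> X \<Longrightarrow> q x \<in> Q \<and> x /\<^sub>R q x \<in> Z_zeta8" using XQ by metis
  define Y where "Y = (\<lambda>p. (*\<^sub>R) p ` (lattice_points (cball 0 (R / p)) (cball 0 (S / \<bar>conj_K p\<bar>)) - {0}))"
  have C0: "C \<ge> 0" using order_trans[OF of_nat_0_le_iff C[of 1 1]] by simp
  have p: "p \<in> O_K" "p > 0" "conj_K p \<noteq> 0" if "p \<in> Q" for p
    using prime_reps_D[of p] Q that conj_K_eq_0[of p] by auto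
  have Y_fin: "finite (Y p)" for p
    unfolding Y_def by (intro finite_imageI finite_Diff lattice_points_upper(1)) auto
  have Y_card: "real (card (Y p)) \<le> C * (R * S)\<^sup>2 * weight p" if "p \<in> Q" for p
  proof -
    have "real (card (Y p)) \<le> real (card (lattice_points (cball 0 (R / p)) (cball 0 (S / \<bar>conj_K p\<bar>)) - {0}))"
      unfolding Y_def by (intro of_nat_mono card_image_le finite_Diff lattice_points_upper(1)) auto
    also have "\<dots> \<le> C * (R / p * (S / \<bar>conj_K p\<bar>))\<^sup>2" using p[OF that] R S by (intro C) auto
    also have "\<dots> = C * (R * S)\<^sup>2 * weight p"
      using weight_eq[OF p(1)[OF that]] by (simp add: power_mult_distrib power_divide)
    finally show ?thesis .
  qed
  have "X - {0} \<subseteq> (\<Union>p\<in>q ` (X - {0}). Y p)"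
  proof
    fix x assume x: "x \<in> X - {0}"
    have qx: "q x \<in> Q" "x /\<^sub>R q x \<in> Z_zeta8" using q x by auto
    have xL: "cmod x \<le> R" "cmod (galois_sigma x) \<le> S" using X x by (auto simp: lattice_points_def)
    have "galois_sigma x = conj_K (q x) *\<^sub>R galois_sigma (x /\<^sub>R q x)"
      using galois_sigma_scaleR[OF p(1)[OF qx(1)] qx(2)] p[OF qx(1)] by simp
    then have "cmod (galois_sigma (x /\<^sub>R q x)) = cmod (galois_sigma x) / \<bar>conj_K (q x)\<bar>" using p[OF qx(1)] by simp
    then have "x /\<^sub>R q x \<in> lattice_points (cball 0 (R / q x)) (cball 0 (S / \<bar>conj_K (q x)\<bar>)) - {0}"
      using qx xL p[OF qx(1)] x by (auto simp: lattice_points_def divide_right_mono divide_inverse mult.commute)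
    then have "x \<in> Y (q x)" unfolding Y_def using p[OF qx(1)] by (intro image_eqI[of _ _ "x /\<^sub>R q x"]) auto
    then show "x \<in> (\<Union>p\<in>q ` (X - {0}). Y p)" using x by blast
  qed
  then have "card (X - {0}) \<le> card (\<Union>p\<in>q ` (X - {0}). Y p)"
    using X Y_fin by (intro card_mono) auto
  also have "\<dots> \<le> (\<Sum>p\<in>q ` (X - {0}). card (Y p))" using X by (intro card_UN_le) auto
  finally have "real (card (X - {0})) \<le> (\<Sum>p\<in>q ` (X - {0}). real (card (Y p)))" by (metis of_nat_le_iff of_nat_sum)
  also have "\<dots> \<le> (\<Sum>p\<in>q ` (X - {0}). C * (R * S)\<^sup>2 * weight p)" using q by (intro sum_mono Y_card) auto
  also have "\<dots> = C * (R * S)\<^sup>2 * sum weight (q ` (X - {0}))" by (simp add: sum_distrib_left)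
  also have "\<dots> \<le> C * (R * S)\<^sup>2 * infsum weight Q"
  proof (rule mult_left_mono)
    show "sum weight (q ` (X - {0})) \<le> infsum weight Q"
      using q X by (intro finite_sum_le_infsum summable_on_subset_banach[OF weight_summable_prime_reps Q]) (auto simp: weight_nonneg)
  qed (use C0 in auto)
  finally have "real (card (X - {0})) \<le> C * (R * S)\<^sup>2 * infsum weight Q" .
  moreover have "card X \<le> card (X - {0}) + 1" using X(1) by (cases "0 \<in> X") (auto simp: card_Diff_singleton_if)
  ultimately show ?thesis by linarith
qed

text \<open>The full sieve counts at most what the sieve by a finite F counts, and falls short of it
  by at most 1 + K T^2 times the weight of the remaining primes. F is fixed before T grows, which is
  legitimate because K depends on neither.\<close>

lemma has_count_density_coprime:
  assumes V: "jordan_measurable V"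
  shows "has_count_density (coprime_points prime_reps V) (measure lebesgue V / covol / zeta_K_2)"
  unfolding has_count_density_def
proof (intro allI impI)
  fix D :: "complex set" assume D: "jordan_measurable D"
  have bV: "bounded V" and bD: "bounded D" using V D by (auto simp: jordan_measurable_def)
  obtain M where M: "M > 0" "D \<subseteq> cball 0 M" using bounded_subset_ballD[OF bD, of 0]
    by (meson ball_subset_cball subset_trans)
  obtain M' where M': "M' > 0" "V \<subseteq> cball 0 M'" using bounded_subset_ballD[OF bV, of 0]
    by (meson ball_subset_cball subset_trans)
  obtain C where C: "\<And>R S. R > 0 \<Longrightarrow> S > 0 \<Longrightarrow> real (card (lattice_points (cball 0 R) (cball 0 S) - {0})) \<le> C * (R * S)\<^sup>2"
    using lattice_points_bound by blast
  define K where "K = C * (M * M')\<^sup>2"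
  define A where "A = measure lebesgue D * (measure lebesgue V / covol)"
  define N where "N = (\<lambda>F T. real (card (coprime_points F V \<inter> (*\<^sub>R) T ` D)))"
  have fin: "finite (coprime_points F V \<inter> (*\<^sub>R) T ` D)" for F and T :: real
    using coprime_points_locally_finite[OF bV] bounded_scaling[OF bD] by (auto simp: locally_finite_def)
  have mono: "N prime_reps T \<le> N F T" if "F \<subseteq> prime_reps" for F T
    unfolding N_def using that by (intro of_nat_mono card_mono fin) (auto simp: coprime_points_def)
  have tail: "N F T \<le> N prime_reps T + (1 + K * T\<^sup>2 * infsum weight (prime_reps - F))"
    if F: "F \<subseteq> prime_reps" and T: "T > 0" for F T
  proof -
    define X where "X = coprime_points F V \<inter> (*\<^sub>R) T ` D - coprime_points prime_reps V \<inter> (*\<^sub>R) T ` D"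
    have "real (card X) \<le> 1 + C * (T * M * M')\<^sup>2 * infsum weight (prime_reps - F)"
    proof (rule lattice_points_multiples_bound[OF C])
      show "finite X" unfolding X_def using fin by blast
      show "X \<subseteq> lattice_points (cball 0 (T * M)) (cball 0 M')"
        using M M' T by (auto simp: X_def lattice_points_def coprime_points_def subset_iff)
      show "\<exists>p\<in>prime_reps - F. x /\<^sub>R p \<in> Z_zeta8" if "x \<in> X" for x
        using that by (auto simp: X_def coprime_points_def)
    qed (use M M' T in auto)
    moreover have "C * (T * M * M')\<^sup>2 = K * T\<^sup>2" by (simp add: K_def power_mult_distrib)
    moreover have "N F T = N prime_reps T + real (card X)"
    proof -
      have sub: "coprime_points prime_reps V \<inter> (*\<^sub>R) T ` D \<subseteq> coprime_points F V \<inter> (*\<^sub>R) T ` D"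
        using F by (auto simp: coprime_points_def)
      have "card X = card (coprime_points F V \<inter> (*\<^sub>R) T ` D) - card (coprime_points prime_reps V \<inter> (*\<^sub>R) T ` D)"
        unfolding X_def by (rule card_Diff_subset[OF fin sub])
      then show ?thesis unfolding N_def using card_mono[OF fin sub] by simp
    qed
    ultimately show ?thesis by simp
  qed
  have "((\<lambda>T. N prime_reps T / T\<^sup>2) \<longlongrightarrow> A / zeta_K_2) at_top"
  proof (rule tendstoI)
    fix e :: real assume e: "e > 0"
    have "((\<lambda>F. A * (\<Prod>p\<in>F. 1 - weight p)) \<longlongrightarrow> A * (1 / zeta_K_2)) (finite_subsets_at_top prime_reps)"
      by (intro tendsto_mult tendsto_const euler_product)
    then have ev1: "eventually (\<lambda>F. dist (A * (\<Prod>p\<in>F. 1 - weight p)) (A * (1 / zeta_K_2)) < e / 4) (finite_subsets_at_top prime_reps)"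
      using e by (intro tendstoD) auto
    have "((\<lambda>F. K * infsum weight (prime_reps - F)) \<longlongrightarrow> K * 0) (finite_subsets_at_top prime_reps)"
      by (intro tendsto_mult tendsto_const weight_tail_tendsto)
    then have ev2: "eventually (\<lambda>F. dist (K * infsum weight (prime_reps - F)) (K * 0) < e / 4) (finite_subsets_at_top prime_reps)"
      using e by (intro tendstoD) auto
    have ev3: "eventually (\<lambda>F. finite F \<and> F \<subseteq> prime_reps) (finite_subsets_at_top prime_reps)"
      by (rule eventually_finite_subsets_at_top_weakI) auto
    obtain F where F: "finite F" "F \<subseteq> prime_reps" "dist (A * (\<Prod>p\<in>F. 1 - weight p)) (A * (1 / zeta_K_2)) < e / 4"
      "dist (K * infsum weight (prime_reps - F)) (K * 0) < e / 4"
      using eventually_happens[OF eventually_conj[OF ev1 eventually_conj[OF ev2 ev3]]] by auto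
    have "((\<lambda>T. N F T / T\<^sup>2) \<longlongrightarrow> A * (\<Prod>p\<in>F. 1 - weight p)) at_top"
      using has_count_densityD[OF has_count_density_coprime_finite[OF F(1,2) V] D] by (simp add: N_def A_def mult.assoc)
    then have "eventually (\<lambda>T. dist (N F T / T\<^sup>2) (A * (\<Prod>p\<in>F. 1 - weight p)) < e / 4) at_top"
      using e by (intro tendstoD) auto
    moreover have "((\<lambda>T::real. 1 / T\<^sup>2) \<longlongrightarrow> 0) at_top"
      by (intro tendsto_divide_0[OF tendsto_const] filterlim_at_top_imp_at_infinity filterlim_pow_at_top filterlim_ident) auto
    then have "eventually (\<lambda>T::real. dist (1 / T\<^sup>2) 0 < e / 4) at_top" using e by (intro tendstoD) auto
    ultimately show "eventually (\<lambda>T. dist (N prime_reps T / T\<^sup>2) (A / zeta_K_2) < e) at_top"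
      using eventually_gt_at_top[of 0]
    proof eventually_elim
      case (elim T)
      have "N prime_reps T / T\<^sup>2 \<le> N F T / T\<^sup>2" using mono[OF F(2)] by (simp add: divide_right_mono)
      moreover have "N F T / T\<^sup>2 \<le> N prime_reps T / T\<^sup>2 + (1 / T\<^sup>2 + K * infsum weight (prime_reps - F))"
      proof -
        have "N F T / T\<^sup>2 \<le> (N prime_reps T + (1 + K * T\<^sup>2 * infsum weight (prime_reps - F))) / T\<^sup>2"
          using tail[OF F(2)] elim by (intro divide_right_mono) auto
        then show ?thesis using elim by (simp add: add_divide_distrib)
      qed
      \<comment> \<open>The four errors are the limit for F, the origin term 1/T^2, the Euler
        product, and the tail of the primes.\<close>
      moreover have "\<bar>n - l\<bar> < e" if "n \<le> f" "f \<le> n + (t + k)" "\<bar>f - a\<bar> < e / 4" "\<bar>t\<bar> < e / 4" "\<bar>a - l\<bar> < e / 4" "\<bar>k\<bar> < e / 4"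
        for n f t k a l :: real using that by linarith
      ultimately show ?case using elim F(3,4) unfolding dist_real_def by simp
    qed
  qed
  then show "((\<lambda>T. real (card (coprime_points prime_reps V \<inter> (*\<^sub>R) T ` D)) / T\<^sup>2) \<longlongrightarrow>
      measure lebesgue D * (measure lebesgue V / covol / zeta_K_2)) at_top"
    by (simp add: N_def A_def)
qed

section \<open>Inclusion-exclusion as an absolutely convergent series\<close>

lemma has_sum_signed_subset_prods:
  fixes g :: "'a \<Rightarrow> real"
  assumes g: "g summable_on C" "\<And>c. c \<in> C \<Longrightarrow> 0 \<le> g c"
    and L: "((\<lambda>S. \<Prod>c\<in>S. 1 - g c) \<longlongrightarrow> L) (finite_subsets_at_top C)"
  shows "((\<lambda>F. (- 1) ^ card F * (\<Prod>c\<in>F. g c)) has_sum L) {F. F \<subseteq> C \<and> finite F}"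
proof -
  let ?h = "\<lambda>F. (- 1) ^ card F * (\<Prod>c\<in>F. g c)" and ?C = "{F. F \<subseteq> C \<and> finite F}"
  have "(\<lambda>F. \<Prod>c\<in>F. g c) summable_on ?C"
  proof (rule nonneg_bdd_above_summable_on)
    show "0 \<le> (\<Prod>c\<in>F. g c)" if "F \<in> ?C" for F using that g(2) by (intro prod_nonneg) auto
    show "bdd_above (sum (\<lambda>F. \<Prod>c\<in>F. g c) ` {X. X \<subseteq> ?C \<and> finite X})"
    proof (rule bdd_aboveI2)
      fix X assume X: "X \<in> {X. X \<subseteq> ?C \<and> finite X}"
      then have U: "finite (\<Union>X)" "\<Union>X \<subseteq> C" by auto
      \<comment> \<open>Enlarging X to all subsets of its union turns the sum into a product of
        factors 1 + g c, bounded by an exponential of the sum of g.\<close>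
      have "(\<Sum>F\<in>X. \<Prod>c\<in>F. g c) \<le> (\<Sum>F\<in>Pow (\<Union>X). \<Prod>c\<in>F. g c)"
      proof (intro sum_mono2 prod_nonneg)
        show "0 \<le> g c" if "F \<in> Pow (\<Union>X) - X" "c \<in> F" for F c using that U(2) by (intro g(2)) blast
      qed (use U in auto)
      also have "\<dots> = (\<Prod>c\<in>\<Union>X. g c + 1)" by (simp add: prod_add[OF U(1)])
      also have "\<dots> \<le> exp (sum g (\<Union>X))" using prod_le_exp_sum[of "\<Union>X" g] U g(2) by (simp add: add.commute subset_iff)
      also have "\<dots> \<le> exp (infsum g C)" using finite_sum_le_infsum[OF g(1) U] g(2) by simp
      finally show "(\<Sum>F\<in>X. \<Prod>c\<in>F. g c) \<le> exp (infsum g C)" .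
    qed
  qed
  then have "(\<lambda>F. norm (?h F)) summable_on ?C"
    by (rule summable_on_cong[THEN iffD1, rotated]) (use g(2) in \<open>auto simp: abs_mult power_abs prod_nonneg subset_iff\<close>)
  then have s: "(?h has_sum infsum ?h ?C) ?C" by (rule has_sum_infsum[OF abs_summable_summable])
  \<comment> \<open>Power sets of finite subsets are cofinal, so the sum may be computed along them,
    where each partial sum factors as a finite product.\<close>
  have "filterlim Pow (finite_subsets_at_top ?C) (finite_subsets_at_top C)"
    unfolding filterlim_finite_subsets_at_top
  proof (intro allI impI)
    fix X assume X: "finite X \<and> X \<subseteq> ?C"
    show "eventually (\<lambda>S. finite (Pow S) \<and> X \<subseteq> Pow S \<and> Pow S \<subseteq> ?C) (finite_subsets_at_top C)"
      unfolding eventually_finite_subsets_at_top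
      by (rule exI[of _ "\<Union>X"]) (use X in \<open>auto intro: finite_subset\<close>)
  qed
  then have "((\<lambda>S. sum ?h (Pow S)) \<longlongrightarrow> infsum ?h ?C) (finite_subsets_at_top C)"
    by (rule filterlim_compose[OF s[unfolded has_sum_def]])
  moreover have "eventually (\<lambda>S. sum ?h (Pow S) = (\<Prod>c\<in>S. 1 - g c)) (finite_subsets_at_top C)"
  proof (rule eventually_finite_subsets_at_top_weakI)
    fix S :: "'a set" assume "finite S"
    then show "sum ?h (Pow S) = (\<Prod>c\<in>S. 1 - g c)" by (simp add: prod_diff_conv_sum)
  qed
  ultimately have "((\<lambda>S. \<Prod>c\<in>S. 1 - g c) \<longlongrightarrow> infsum ?h ?C) (finite_subsets_at_top C)"
    by (rule Lim_transform_eventually)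
  then have "infsum ?h ?C = L" using L by (rule tendsto_unique[rotated]) simp
  then show ?thesis using s by simp
qed


section \<open>Intersections of multiples of the model set\<close>

lemma model_set_eq_coprime_points: "model_set W = coprime_points {} W"
  by (simp add: model_set_def coprime_points_def)

lemma mem_scaleR_model_set:
  assumes "c \<in> O_K" "c \<noteq> 0" "x \<in> Z_zeta8"
  shows "x \<in> (*\<^sub>R) c ` model_set W \<longleftrightarrow> x /\<^sub>R c \<in> Z_zeta8 \<and> galois_sigma x \<in> (*\<^sub>R) (conj_K c) ` W"
proof -
  have c0: "conj_K c \<noteq> 0" using assms conj_K_eq_0 by simp
  have "x \<in> (*\<^sub>R) c ` model_set W \<longleftrightarrow> x /\<^sub>R c \<in> model_set W"
    using assms(2) by (auto simp: image_iff intro!: bexI[of _ "x /\<^sub>R c"])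
  moreover have "galois_sigma (x /\<^sub>R c) \<in> W \<longleftrightarrow> galois_sigma x \<in> (*\<^sub>R) (conj_K c) ` W" if "x /\<^sub>R c \<in> Z_zeta8"
  proof -
    have "galois_sigma x = conj_K c *\<^sub>R galois_sigma (x /\<^sub>R c)"
      using galois_sigma_scaleR[OF assms(1) that] assms(2) by simp
    then show ?thesis using c0 by auto
  qed
  ultimately show ?thesis by (auto simp: model_set_def)
qed

lemma Z_zeta8_coprime_prod:
  assumes "finite F" "F \<subseteq> prime_reps" "q \<in> prime_reps" "q \<notin> F" "y \<in> Z_zeta8" "(\<Prod>F *\<^sub>R y) /\<^sub>R q \<in> Z_zeta8"
  shows "y /\<^sub>R q \<in> Z_zeta8"
  using assms
proof (induction F arbitrary: y)
  case empty
  then show ?case by simp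
next
  case (insert p F)
  have p: "p \<in> prime_reps" "p \<in> O_K" using insert.prems prime_reps_D by auto
  have "(\<Prod>F *\<^sub>R (p *\<^sub>R y)) /\<^sub>R q \<in> Z_zeta8" using insert by (simp add: mult_ac)
  then have "(p *\<^sub>R y) /\<^sub>R q \<in> Z_zeta8" using insert.IH[of "p *\<^sub>R y"] insert.prems p by auto
  then show ?case using Z_zeta8_coprime_multiple[of p q y] insert.prems p by auto
qed

text \<open>Distinct primes are coprime, so each further prime divides the quotient by the product
  of the earlier ones.\<close>

lemma Z_zeta8_divide_prod:
  assumes "finite F" "F \<subseteq> prime_reps" "x \<in> Z_zeta8" "\<And>p. p \<in> F \<Longrightarrow> x /\<^sub>R p \<in> Z_zeta8"
  shows "x /\<^sub>R \<Prod>F \<in> Z_zeta8"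
  using assms
proof (induction F)
  case empty
  then show ?case by simp
next
  case (insert p F)
  have p: "p \<in> prime_reps" "p \<notin> F" "F \<subseteq> prime_reps" using insert by auto
  have "\<Prod>F \<noteq> 0" using insert.hyps(1) p(3) prime_reps_D by fastforce
  then have "(\<Prod>F *\<^sub>R (x /\<^sub>R \<Prod>F)) /\<^sub>R p \<in> Z_zeta8" using insert.prems by simp
  moreover have "x /\<^sub>R \<Prod>F \<in> Z_zeta8" using insert by simp
  ultimately have "(x /\<^sub>R \<Prod>F) /\<^sub>R p \<in> Z_zeta8" using Z_zeta8_coprime_prod[of F p] insert.hyps p by blast
  then show ?case using insert.hyps by (simp add: mult_ac)
qed

text \<open>The factor 1/\<sigma>(p) maps W into itself. Therefore p A restricts the points of A by
  divisibility alone.\<close>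

lemma window_subset_prime:
  assumes W: "star_shaped W" "uminus ` W \<subseteq> (*\<^sub>R) (sqrt 2) ` W" and p: "p \<in> prime_reps"
  shows "W \<subseteq> (*\<^sub>R) (conj_K p) ` W"
proof
  fix w assume w: "w \<in> W"
  have pp: "p \<in> O_K" "1 < p" "p < fund_unit" using p prime_reps_D by auto
  have c0: "conj_K p \<noteq> 0" using pp conj_K_eq_0 by auto
  have "- 1 / sqrt 2 \<le> 1 / conj_K p" "1 / conj_K p \<le> 1"
    using conj_K_between_1_fund_unit[OF pp]
    by (auto simp: field_simps divide_simps sqrt2_bounds split: if_splits) (use sqrt2_bounds in linarith)+
  then have "(1 / conj_K p) *\<^sub>R w \<in> W" by (rule window_scale[OF W w])
  then show "w \<in> (*\<^sub>R) (conj_K p) ` W" using c0 by (intro image_eqI[of _ _ "(1 / conj_K p) *\<^sub>R w"]) auto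
qed

text \<open>Here \<sigma>(\<lambda>) itself, not its inverse, lies in [-1/\<surd>2, 1]. Divisibility
  by the unit \<lambda> is automatic, so \<lambda> A restricts the points of A by the window
  alone.\<close>

lemma window_subset_fund_unit:
  assumes W: "star_shaped W" "uminus ` W \<subseteq> (*\<^sub>R) (sqrt 2) ` W"
  shows "(*\<^sub>R) (1 - sqrt 2) ` W \<subseteq> W"
proof
  fix w assume "w \<in> (*\<^sub>R) (1 - sqrt 2) ` W"
  then obtain v where v: "v \<in> W" "w = (1 - sqrt 2) *\<^sub>R v" by blast
  have "- 1 / sqrt 2 = - (sqrt 2 / 2)" by (simp add: field_simps)
  then have "- 1 / sqrt 2 \<le> 1 - sqrt 2" "1 - sqrt 2 \<le> 1" using sqrt2_bounds by simp_all
  then show "w \<in> W" using window_scale[OF W v(1)] v(2) by blast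
qed

lemma fund_unit_not_prime: "fund_unit \<notin> prime_reps"
  by (auto simp: prime_reps_def)

text \<open>The proportion of points kept by intersecting with c A. A unit has weight 1, so for
  \<lambda> it is the area ratio \<sigma>(\<lambda>)^2 of the windows instead.\<close>

definition factor_density :: "real \<Rightarrow> real" where
  "factor_density c = (if c = fund_unit then (sqrt 2 - 1)\<^sup>2 else weight c)"

text \<open>The primes in F combine to divisibility by their product q, and \<lambda>, if present,
  replaces W by \<sigma>(\<lambda>) W. Dividing by q leaves a plain model set whose window is
  divided by \<sigma>(q), so its density is already known.\<close>

lemma intersection_eq:
  assumes W: "star_shaped W" "uminus ` W \<subseteq> (*\<^sub>R) (sqrt 2) ` W"
    and F: "F \<subseteq> prime_reps \<union> {fund_unit}" "finite F"
  defines "q \<equiv> \<Prod>(F - {fund_unit})"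
    and "W' \<equiv> if fund_unit \<in> F then (*\<^sub>R) (1 - sqrt 2) ` W else W"
  shows "model_set W \<inter> (\<Inter>c\<in>F. (*\<^sub>R) c ` model_set W) =
    (*\<^sub>R) q ` coprime_points {} ((*\<^sub>R) (1 / conj_K q) ` W')"
proof -
  define P where "P = F - {fund_unit}"
  have P: "finite P" "P \<subseteq> prime_reps" using F by (auto simp: P_def)
  have q: "q = \<Prod>P" "q \<in> O_K" "q > 0"
    using P prime_reps_D by (fastforce simp: q_def P_def intro: prod_pos)+
  have cq: "conj_K q \<noteq> 0" using q conj_K_eq_0 by simp
  have W'W: "W' \<subseteq> W" using window_subset_fund_unit[OF W] by (simp add: W'_def)
  have l: "fund_unit > 0" using fund_unit_bounds by simp
  have div_iff: "x /\<^sub>R q \<in> Z_zeta8 \<longleftrightarrow> (\<forall>p\<in>P. x /\<^sub>R p \<in> Z_zeta8)" if x: "x \<in> Z_zeta8" for x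
  proof
    assume a: "x /\<^sub>R q \<in> Z_zeta8"
    show "\<forall>p\<in>P. x /\<^sub>R p \<in> Z_zeta8"
    proof
      fix p assume p: "p \<in> P"
      have "\<Prod>(P - {p}) \<in> O_K" using P prime_reps_D by (intro O_K_prod) auto
      then have "\<Prod>(P - {p}) *\<^sub>R (x /\<^sub>R q) \<in> Z_zeta8" using a by blast
      moreover have "q = p * \<Prod>(P - {p})" unfolding q(1) using P p by (simp add: prod.remove)
      moreover have "p \<noteq> 0" "\<Prod>(P - {p}) \<noteq> 0" using q(3) calculation(2) by auto
      then have "\<Prod>(P - {p}) * inverse q = inverse p" using \<open>q = p * \<Prod>(P - {p})\<close> by simp
      then have "\<Prod>(P - {p}) *\<^sub>R (x /\<^sub>R q) = x /\<^sub>R p" by simp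
      ultimately show "x /\<^sub>R p \<in> Z_zeta8" by metis
    qed
  next
    assume "\<forall>p\<in>P. x /\<^sub>R p \<in> Z_zeta8"
    then show "x /\<^sub>R q \<in> Z_zeta8" unfolding q(1) using Z_zeta8_divide_prod[OF P x] by blast
  qed
  have mem: "x \<in> model_set W \<inter> (\<Inter>c\<in>F. (*\<^sub>R) c ` model_set W) \<longleftrightarrow>
      galois_sigma x \<in> W' \<and> x /\<^sub>R q \<in> Z_zeta8" if x: "x \<in> Z_zeta8" for x
  proof -
    have prime: "x \<in> (*\<^sub>R) p ` model_set W \<longleftrightarrow> x /\<^sub>R p \<in> Z_zeta8" if "p \<in> P" "galois_sigma x \<in> W" for p
    proof -
      have "p \<in> prime_reps" using that P by blast
      then show ?thesis
        using mem_scaleR_model_set[of p x W] prime_reps_D[of p] window_subset_prime[OF W, of p] that x by auto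
    qed
    have unit: "x \<in> (*\<^sub>R) fund_unit ` model_set W \<longleftrightarrow> galois_sigma x \<in> (*\<^sub>R) (1 - sqrt 2) ` W"
      using mem_scaleR_model_set[of fund_unit x W] Z_zeta8_scaleR[OF inverse_fund_unit_O_K x] l x by (simp add: conj_fund_unit)
    have W': "y \<in> W' \<longleftrightarrow> y \<in> W \<and> (fund_unit \<in> F \<longrightarrow> y \<in> (*\<^sub>R) (1 - sqrt 2) ` W)" for y
      using W'W unfolding W'_def by (cases "fund_unit \<in> F") (simp_all only: if_True if_False simp_thms, blast)
    have "x \<in> model_set W \<inter> (\<Inter>c\<in>F. (*\<^sub>R) c ` model_set W) \<longleftrightarrow>
        galois_sigma x \<in> W \<and> (fund_unit \<in> F \<longrightarrow> x \<in> (*\<^sub>R) fund_unit ` model_set W) \<and> (\<forall>p\<in>P. x \<in> (*\<^sub>R) p ` model_set W)"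
      using x by (auto simp: model_set_def P_def)
    also have "\<dots> \<longleftrightarrow> galois_sigma x \<in> W' \<and> (\<forall>p\<in>P. x /\<^sub>R p \<in> Z_zeta8)"
      unfolding W' using prime unit by blast
    finally show ?thesis using div_iff[OF x] by blast
  qed
  have mem': "q *\<^sub>R y \<in> model_set W \<inter> (\<Inter>c\<in>F. (*\<^sub>R) c ` model_set W) \<longleftrightarrow> 
     y \<in> coprime_points {} ((*\<^sub>R) (1 / conj_K q) ` W')" if y: "y \<in> Z_zeta8" for y
  proof -
    have "galois_sigma (q *\<^sub>R y) \<in> W' \<longleftrightarrow> galois_sigma y \<in> (*\<^sub>R) (1 / conj_K q) ` W'"
      using galois_sigma_scaleR[OF q(2) y] cq
      by (auto simp: image_iff intro!: bexI[of _ "conj_K q *\<^sub>R galois_sigma y"])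
    then show ?thesis using mem[of "q *\<^sub>R y"] y q by (auto simp: coprime_points_def)
  qed
  show ?thesis
  proof (intro equalityI subsetI)
    fix x assume x: "x \<in> model_set W \<inter> (\<Inter>c\<in>F. (*\<^sub>R) c ` model_set W)"
    then have "x \<in> Z_zeta8" by (simp add: model_set_def)
    then have y: "x /\<^sub>R q \<in> Z_zeta8" using mem x by blast
    have "q *\<^sub>R (x /\<^sub>R q) = x" using q by simp
    then show "x \<in> (*\<^sub>R) q ` coprime_points {} ((*\<^sub>R) (1 / conj_K q) ` W')" using mem'[OF y] x by (metis imageI)
  next
    fix x assume "x \<in> (*\<^sub>R) q ` coprime_points {} ((*\<^sub>R) (1 / conj_K q) ` W')"
    then obtain y where "y \<in> coprime_points {} ((*\<^sub>R) (1 / conj_K q) ` W')" "x = q *\<^sub>R y" by blast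
    then show "x \<in> model_set W \<inter> (\<Inter>c\<in>F. (*\<^sub>R) c ` model_set W)" using mem'[of y] by (auto simp: coprime_points_def)
  qed
qed

lemma model_set_locally_finite: "bounded W \<Longrightarrow> locally_finite (model_set W)"
  unfolding model_set_eq_coprime_points by (rule coprime_points_locally_finite)

lemma locally_finite_subset: "locally_finite Q \<Longrightarrow> P \<subseteq> Q \<Longrightarrow> locally_finite P"
  unfolding locally_finite_def by (meson Int_mono finite_subset order_refl)

lemma weight_prod: "finite F \<Longrightarrow> F \<subseteq> O_K \<Longrightarrow> weight (\<Prod>F) = (\<Prod>p\<in>F. weight p)"
  by (induction F rule: finite_induct) (auto simp: weight_mult O_K_prod subset_iff)

lemma intersection_density:
  assumes Wj: "jordan_measurable W" and W: "star_shaped W" "uminus ` W \<subseteq> (*\<^sub>R) (sqrt 2) ` W"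
    and F: "F \<subseteq> prime_reps \<union> {fund_unit}" "finite F"
  shows "has_point_density (model_set W \<inter> (\<Inter>c\<in>F. (*\<^sub>R) c ` model_set W))
    (measure lebesgue W / covol * (\<Prod>c\<in>F. factor_density c))"
proof (rule has_count_density_imp)
  show "locally_finite (model_set W \<inter> (\<Inter>c\<in>F. (*\<^sub>R) c ` model_set W))"
    by (rule locally_finite_subset[OF model_set_locally_finite]) (use Wj in \<open>auto simp: jordan_measurable_def\<close>)
  define P where "P = F - {fund_unit}"
  define q where "q = \<Prod>P"
  define W' where "W' = (if fund_unit \<in> F then (*\<^sub>R) (1 - sqrt 2) ` W else W)"
  have P: "finite P" "P \<subseteq> prime_reps" "P \<subseteq> O_K" using F prime_reps_D by (auto simp: P_def)
  have q: "q \<in> O_K" "q > 0" unfolding q_def using P prime_reps_D by (fastforce intro: prod_pos)+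
  have cq: "conj_K q \<noteq> 0" using q conj_K_eq_0 by simp
  have W'j: "jordan_measurable W'" using Wj by (auto simp: W'_def intro: jordan_measurable_scaleR)
  have "has_count_density ((*\<^sub>R) q ` coprime_points {} ((*\<^sub>R) (1 / conj_K q) ` W'))
     (measure lebesgue ((*\<^sub>R) (1 / conj_K q) ` W') / covol / q\<^sup>2)"
    using cq q W'j by (intro has_count_density_scaleR has_count_density_window jordan_measurable_scaleR) auto
  moreover have "measure lebesgue ((*\<^sub>R) (1 / conj_K q) ` W') / covol / q\<^sup>2 = measure lebesgue W / covol * (\<Prod>c\<in>F. factor_density c)"
  proof -
    have "(\<Prod>c\<in>P. factor_density c) = (\<Prod>c\<in>P. weight c)" by (intro prod.cong) (auto simp: P_def factor_density_def)
    also have "\<dots> = weight q" using weight_prod[OF P(1,3)] by (simp add: q_def)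
    finally have wq: "(\<Prod>c\<in>P. factor_density c) = 1 / (q * conj_K q)\<^sup>2" using weight_eq[OF q(1)] by simp
    have F_prod: "(\<Prod>c\<in>F. factor_density c) = (if fund_unit \<in> F then (sqrt 2 - 1)\<^sup>2 else 1) * (\<Prod>c\<in>P. factor_density c)"
    proof (cases "fund_unit \<in> F")
      case True
      then show ?thesis using F(2) by (simp add: P_def prod.remove[of F fund_unit] factor_density_def[of fund_unit])
    next
      case False
      then show ?thesis by (simp add: P_def)
    qed
    have "measure lebesgue W' = (if fund_unit \<in> F then (sqrt 2 - 1)\<^sup>2 else 1) * measure lebesgue W"
      by (simp add: W'_def measure_scaleR_image power2_commute)
    then show ?thesis unfolding measure_scaleR_image F_prod wq by (simp add: power_divide power_mult_distrib mult_ac)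
  qed
  moreover have "model_set W \<inter> (\<Inter>c\<in>F. (*\<^sub>R) c ` model_set W) = (*\<^sub>R) q ` coprime_points {} ((*\<^sub>R) (1 / conj_K q) ` W')"
    unfolding q_def P_def W'_def by (rule intersection_eq[OF W F])
  ultimately show "has_count_density (model_set W \<inter> (\<Inter>c\<in>F. (*\<^sub>R) c ` model_set W))
    (measure lebesgue W / covol * (\<Prod>c\<in>F. factor_density c))" by simp
qed

section \<open>Density of the visible points and value of the series\<close>

lemma visible_density:
  assumes Wj: "jordan_measurable W" and W: "star_shaped W" "uminus ` W \<subseteq> (*\<^sub>R) (sqrt 2) ` W"
  shows "has_point_density (visible (model_set W))
    (measure lebesgue W / covol * ((1 - (sqrt 2 - 1)\<^sup>2) / zeta_K_2))"
proof -
  let ?V = "W - (*\<^sub>R) (1 - sqrt 2) ` W"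
  have V: "jordan_measurable ?V" using Wj by (intro jordan_measurable_diff jordan_measurable_scaleR) auto
  have "measure lebesgue ?V = measure lebesgue W - measure lebesgue ((*\<^sub>R) (1 - sqrt 2) ` W)"
    using Wj window_subset_fund_unit[OF W]
    by (intro measurable_measure_Diff jordan_measurable_lmeasurable fmeasurableD jordan_measurable_scaleR) auto
  also have "\<dots> = (1 - (sqrt 2 - 1)\<^sup>2) * measure lebesgue W"
    by (simp add: measure_scaleR_image power2_commute left_diff_distrib)
  finally have "measure lebesgue ?V / covol / zeta_K_2 = measure lebesgue W / covol * ((1 - (sqrt 2 - 1)\<^sup>2) / zeta_K_2)"
    by simp
  moreover have "has_point_density (coprime_points prime_reps ?V) (measure lebesgue ?V / covol / zeta_K_2)"
    using V by (intro has_count_density_imp coprime_points_locally_finite has_count_density_coprime) (auto simp: jordan_measurable_def)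
  ultimately show ?thesis unfolding visible_model_set[OF W] by metis
qed

text \<open>Finite sets eventually contain \<lambda>, so its factor splits off and the Euler product
  over the primes remains.\<close>

lemma factor_density_prod_tendsto:
  "((\<lambda>S. \<Prod>c\<in>S. 1 - factor_density c) \<longlongrightarrow> (1 - (sqrt 2 - 1)\<^sup>2) / zeta_K_2) (finite_subsets_at_top (prime_reps \<union> {fund_unit}))"
proof -
  let ?C = "prime_reps \<union> {fund_unit}"
  have "filterlim (\<lambda>S. S - {fund_unit}) (finite_subsets_at_top prime_reps) (finite_subsets_at_top ?C)"
    unfolding filterlim_finite_subsets_at_top
  proof (intro allI impI)
    fix X assume X: "finite X \<and> X \<subseteq> prime_reps"
    then have "fund_unit \<notin> X" using fund_unit_not_prime by blast
    then show "eventually (\<lambda>S. finite (S - {fund_unit}) \<and> X \<subseteq> S - {fund_unit} \<and> S - {fund_unit} \<subseteq> prime_reps) (finite_subsets_at_top ?C)"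
      unfolding eventually_finite_subsets_at_top by (intro exI[of _ X]) (use X in auto)
  qed
  then have "((\<lambda>S. \<Prod>p\<in>S - {fund_unit}. 1 - weight p) \<longlongrightarrow> 1 / zeta_K_2) (finite_subsets_at_top ?C)"
    by (rule filterlim_compose[OF euler_product])
  then have "((\<lambda>S. (1 - (sqrt 2 - 1)\<^sup>2) * (\<Prod>p\<in>S - {fund_unit}. 1 - weight p)) \<longlongrightarrow> (1 - (sqrt 2 - 1)\<^sup>2) * (1 / zeta_K_2)) (finite_subsets_at_top ?C)"
    by (intro tendsto_mult tendsto_const)
  moreover have "eventually (\<lambda>S. (1 - (sqrt 2 - 1)\<^sup>2) * (\<Prod>p\<in>S - {fund_unit}. 1 - weight p) = (\<Prod>c\<in>S. 1 - factor_density c)) (finite_subsets_at_top ?C)"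
    unfolding eventually_finite_subsets_at_top
  proof (intro exI[of _ "{fund_unit}"] conjI allI impI)
    fix S assume S: "finite S \<and> {fund_unit} \<subseteq> S \<and> S \<subseteq> ?C"
    have "(\<Prod>c\<in>S - {fund_unit}. 1 - factor_density c) = (\<Prod>p\<in>S - {fund_unit}. 1 - weight p)"
      by (intro prod.cong) (auto simp: factor_density_def)
    then show "(1 - (sqrt 2 - 1)\<^sup>2) * (\<Prod>p\<in>S - {fund_unit}. 1 - weight p) = (\<Prod>c\<in>S. 1 - factor_density c)"
      using S by (subst prod.remove[of S fund_unit]) (auto simp: factor_density_def)
  qed auto
  ultimately have "((\<lambda>S. \<Prod>c\<in>S. 1 - factor_density c) \<longlongrightarrow> (1 - (sqrt 2 - 1)\<^sup>2) * (1 / zeta_K_2)) (finite_subsets_at_top ?C)"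
    by (rule Lim_transform_eventually)
  then show ?thesis by simp
qed

lemma factor_density_summable: "factor_density summable_on (prime_reps \<union> {fund_unit})"
proof (rule summable_on_union)
  have "factor_density summable_on prime_reps \<longleftrightarrow> weight summable_on prime_reps"
    using fund_unit_not_prime by (intro summable_on_cong) (auto simp: factor_density_def)
  then show "factor_density summable_on prime_reps" using weight_summable_prime_reps by simp
qed auto

lemma galois_sigma_of_real:
  assumes "r \<in> O_K" shows "galois_sigma (of_real r) = of_real (conj_K r)"
proof -
  have "z8 1 0 0 0 = 1" by (simp add: z8_eq)
  then have "1 \<in> Z_zeta8" "galois_sigma 1 = 1"
    using galois_sigma_z8[of 1 0 0 0] of_real_O_K_Z_zeta8[of 1] by (simp_all add: Complex_eq_1)
  then show ?thesis using galois_sigma_scaleR[OF assms, of 1] by (simp add: scaleR_conv_of_real)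
qed

theorem theorem4p9:
  fixes W :: "complex set" and C :: "real set"
  assumes "jordan_measurable W"
    and "star_shaped W"
    and "uminus ` W \<subseteq> (*\<^sub>R) (sqrt 2) ` W"
  defines "C \<equiv> prime_reps \<union> {fund_unit}"
  shows "(\<exists>d. has_point_density (model_set W) d) \<and>
    (\<exists>d. has_point_density (visible (model_set W)) d) \<and>
    (\<forall>F. F \<subseteq> C \<and> finite F \<longrightarrow>
       (\<exists>d. has_point_density (model_set W \<inter> (\<Inter>c\<in>F. (*\<^sub>R) c ` model_set W)) d)) \<and>
    ((\<lambda>F. (- 1) ^ card F * point_density (model_set W \<inter> (\<Inter>c\<in>F. (*\<^sub>R) c ` model_set W)))
       has_sum point_density (visible (model_set W))) {F. F \<subseteq> C \<and> finite F} \<and>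
    point_density (visible (model_set W)) =
      2 * cmod (galois_sigma (of_real fund_unit)) * point_density (model_set W) / dedekind_zeta (ring_on O_K) 2"
proof -
  define \<theta> where "\<theta> = measure lebesgue W / covol"
  let ?L = "(1 - (sqrt 2 - 1)\<^sup>2) / zeta_K_2"
  have vis: "has_point_density (visible (model_set W)) (\<theta> * ?L)"
    unfolding \<theta>_def by (rule visible_density[OF assms(1-3)])
  have int: "has_point_density (model_set W \<inter> (\<Inter>c\<in>F. (*\<^sub>R) c ` model_set W)) (\<theta> * (\<Prod>c\<in>F. factor_density c))"
    if "F \<subseteq> C" "finite F" for F
    unfolding \<theta>_def using that by (intro intersection_density assms(1-3)) (auto simp: C_def)
  have model: "has_point_density (model_set W) \<theta>" using int[of "{}"] by simp
  have "((\<lambda>F. (- 1) ^ card F * (\<Prod>c\<in>F. factor_density c)) has_sum ?L) {F. F \<subseteq> C \<and> finite F}"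
    unfolding C_def
    by (rule has_sum_signed_subset_prods[OF factor_density_summable _ factor_density_prod_tendsto])
       (auto simp: factor_density_def weight_nonneg)
  then have "((\<lambda>F. \<theta> * ((- 1) ^ card F * (\<Prod>c\<in>F. factor_density c))) has_sum \<theta> * ?L) {F. F \<subseteq> C \<and> finite F}"
    by (rule has_sum_cmult_right)
  then have sum: "((\<lambda>F. (- 1) ^ card F * point_density (model_set W \<inter> (\<Inter>c\<in>F. (*\<^sub>R) c ` model_set W)))
       has_sum \<theta> * ?L) {F. F \<subseteq> C \<and> finite F}"
    by (rule has_sum_cong[THEN iffD1, rotated]) (use point_density_eq[OF int] in \<open>auto simp: mult_ac\<close>)
  have "cmod (galois_sigma (of_real fund_unit)) = sqrt 2 - 1"
    using sqrt2_bounds by (simp add: galois_sigma_of_real conj_fund_unit del: of_real_diff)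
  \<comment> \<open>The origin of 2 |\<sigma>(\<lambda>)|: with s = |\<sigma>(\<lambda>)| one has
    s^2 + 2 s = 1.\<close>
  moreover have "1 - (sqrt 2 - 1)\<^sup>2 = 2 * (sqrt 2 - 1)" by (simp add: power2_eq_square algebra_simps)
  ultimately have "\<theta> * ?L = 2 * cmod (galois_sigma (of_real fund_unit)) * \<theta> / dedekind_zeta (ring_on O_K) 2"
    by (simp add: dedekind_zeta_2)
  then show ?thesis using vis int model sum point_density_eq[OF vis] point_density_eq[OF model] by auto
qed

end
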